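(* Let $1<p<N$ and let $\Omega\subseteq\mathbb{R}^N$ be a nonempty open set. Then: (a) $\mathcal{D}^{1,p}_0(\Omega)$ is continuously embedded into $\mathcal{E}(\Omega)$; (b) $\mathcal{E}(\Omega)$ is a proper subspace of the Lorentz space $L^{p^*,p}(\Omega)$, where $p^*=\frac{Np}{N-p}$.
   Context: $\mathcal{D}^{1,p}_0(\Omega)$ is the completion of $C_c^\infty(\Omega)$ with respect to the norm $\left[\int_\Omega|\nabla u|^p\,dx\right]^{1/p}$. For $F\subset\subset\Omega$ ($F$ relatively compact in $\Omega$), $\mathrm{Cap}_p(F,\Omega)=\inf\{\int_\Omega|\nabla u|^p\,dx: u\in\mathcal{D}^{1,p}_0(\Omega),\ u\ge 1\text{ in a neighbourhood of }F\}$. For $g\in L^1_{loc}(\Omega)$, $\|g\|=\sup\left\{\frac{\int_F|g|\,dx}{\mathrm{Cap}_p(F,\Omega)}: F\subset\subset\Omega \text{ measurable},\ |F|\neq0\right\}$. $\mathcal{H}(\Omega)$ is the set of all $g\in L^1_{loc}(\Omega)$ for which there is $C>0$ with $\int_\Omega|g||u|^p\,dx\le C\int_\Omega|\nabla u|^p\,dx$ for all $u\in\mathcal{D}^{1,p}_0(\Omega)$; equivalently (Maz'ya) $\|g\|<\infty$, and $\mathcal{H}(\Omega)$ is normed by $\|\cdot\|$. Let $\mathcal{M}(\Omega)$ be the set of extended real valued Lebesgue measurable functions that are finite a.e. in $\Omega$. For $v\in\mathcal{M}(\Omega)$ put $\|v\|'=\sup\{\int_\Omega|fv|\,dx: f\in\mathcal{H}(\Omega),\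 \|f\|\le1\}$ and $\mathcal{H}(\Omega)'=\{v\in\mathcal{M}(\Omega):\|v\|'<\infty\}$. Then $\mathcal{E}(\Omega)=\{u\in\mathcal{M}(\Omega):|u|^p\in\mathcal{H}(\Omega)'\}$ with norm $\|u\|_{\mathcal{E}}=(\||u|^p\|')^{1/p}$. With $f^*(t)=\inf\{s>0:|\{|f|>s\}|<t\}$ for $t>0$, $L^{p^*,p}(\Omega)=\{f\in\mathcal{M}(\Omega):\int_0^\infty [t^{\frac1{p^*}-\frac1p}f^*(t)]^p\,dt<\infty\}$. *)

theory Defs
  imports "HOL-Analysis.Analysis"
begin

section \<open>Test functions and weak gradients\<close>

text \<open>
  Iterated directional derivatives.  A function all of whose iterated partial derivatives are
  (Frechet) differentiable everywhere has continuous partial derivatives of all orders.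
\<close>

fun iter_deriv :: "'a::euclidean_space list \<Rightarrow> ('a \<Rightarrow> real) \<Rightarrow> 'a \<Rightarrow> real" where
  "iter_deriv [] f = f"
| "iter_deriv (v # vs) f = (\<lambda>x. frechet_derivative (iter_deriv vs f) (at x) v)"

definition smooth :: "('a::euclidean_space \<Rightarrow> real) \<Rightarrow> bool" where
  "smooth f \<longleftrightarrow> (\<forall>vs. set vs \<subseteq> Basis \<longrightarrow> (\<forall>x. iter_deriv vs f differentiable (at x)))"

text \<open>Elements of \<open>C\<^sub>c\<^sup>\<infinity>(\<Omega>)\<close>, extended by zero to the whole space.\<close>

definition test_functions :: "'a::euclidean_space set \<Rightarrow> ('a \<Rightarrow> real) set" where
  "test_functions \<Omega> =
     {\<phi>. smooth \<phi> \<and> compact (closure {x. \<phi> x \<noteq> 0}) \<and> closure {x. \<phi> x \<noteq> 0} \<subseteq> \<Omega>}"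

definition gradient :: "('a::euclidean_space \<Rightarrow> real) \<Rightarrow> 'a \<Rightarrow> 'a" where
  "gradient f x = (\<Sum>b\<in>Basis. frechet_derivative f (at x) b *\<^sub>R b)"

definition has_weak_gradient ::
    "'a::euclidean_space set \<Rightarrow> ('a \<Rightarrow> real) \<Rightarrow> ('a \<Rightarrow> 'a) \<Rightarrow> bool" where
  "has_weak_gradient \<Omega> u G \<longleftrightarrow>
     u \<in> borel_measurable (lebesgue_on \<Omega>) \<and> G \<in> borel_measurable (lebesgue_on \<Omega>) \<and>
     (\<forall>K. compact K \<and> K \<subseteq> \<Omega> \<longrightarrow> integrable (lebesgue_on K) u \<and> integrable (lebesgue_on K) G) \<and>
     (\<forall>\<phi>\<in>test_functions \<Omega>. \<forall>b\<in>Basis.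
        (LINT x|lebesgue_on \<Omega>. u x * (gradient \<phi> x \<bullet> b)) =
        - (LINT x|lebesgue_on \<Omega>. (G x \<bullet> b) * \<phi> x))"

text \<open>The weak gradient is unique up to null sets, so the choice is immaterial.\<close>

definition weak_gradient :: "'a::euclidean_space set \<Rightarrow> ('a \<Rightarrow> real) \<Rightarrow> 'a \<Rightarrow> 'a" where
  "weak_gradient \<Omega> u = (SOME G. has_weak_gradient \<Omega> u G)"

text \<open>The Dirichlet integral \<open>\<integral>\<^sub>\<Omega> |\<nabla>u|\<^sup>p dx\<close>.\<close>

definition energy :: "real \<Rightarrow> 'a::euclidean_space set \<Rightarrow> ('a \<Rightarrow> real) \<Rightarrow> ennreal" where
  "energy p \<Omega> u = (\<integral>\<^sup>+x. ennreal (norm (weak_gradient \<Omega> u x) powr p) \<partial>lebesgue_on \<Omega>)"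

text \<open>
  The completion of \<open>C\<^sub>c\<^sup>\<infinity>(\<Omega>)\<close> in the norm \<open>(\<integral>\<^sub>\<Omega> |\<nabla>u|\<^sup>p)\<^sup>1\<^sup>/\<^sup>p\<close>, realised
  as a space of functions.  For \<open>1 < p < N\<close> a sequence of test functions that is Cauchy in this
  norm converges in \<open>L\<^sup>1\<^sub>l\<^sub>o\<^sub>c(\<Omega>)\<close> (by the Sobolev inequality); its limit \<open>u\<close> has a weak
  gradient, which is the \<open>L\<^sup>p\<close> limit of the gradients, and \<open>u\<close> represents the class of the
  sequence.  Asking only for convergence of the gradients would be wrong: constants would then
  belong to the space.
\<close>

definition D0 :: "real \<Rightarrow> 'a::euclidean_space set \<Rightarrow> ('a \<Rightarrow> real) set" where
  "D0 p \<Omega> =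
     {u. (\<exists>G. has_weak_gradient \<Omega> u G) \<and>
         (\<exists>\<phi> :: nat \<Rightarrow> 'a \<Rightarrow> real. (\<forall>n. \<phi> n \<in> test_functions \<Omega>) \<and>
            (\<forall>K. compact K \<and> K \<subseteq> \<Omega> \<longrightarrow>
               (\<lambda>n. \<integral>\<^sup>+x. ennreal \<bar>\<phi> n x - u x\<bar> \<partial>lebesgue_on K) \<longlonglongrightarrow> 0) \<and>
            (\<lambda>n. \<integral>\<^sup>+x. ennreal (norm (gradient (\<phi> n) x - weak_gradient \<Omega> u x) powr p)
                   \<partial>lebesgue_on \<Omega>) \<longlonglongrightarrow> 0)}"

definition D0_norm :: "real \<Rightarrow> 'a::euclidean_space set \<Rightarrow> ('a \<Rightarrow> real) \<Rightarrow> real" where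
  "D0_norm p \<Omega> u = enn2real (energy p \<Omega> u) powr (1 / p)"


section \<open>Capacity and the space of Hardy weights\<close>

definition relatively_compact_in :: "'a::euclidean_space set \<Rightarrow> 'a set \<Rightarrow> bool" where
  "relatively_compact_in F \<Omega> \<longleftrightarrow> compact (closure F) \<and> closure F \<subseteq> \<Omega>"

text \<open>Elements of \<^term>\<open>D0 p \<Omega>\<close> are classes modulo null sets, so \<open>u \<ge> 1\<close> is read almost everywhere.\<close>

definition Cap :: "real \<Rightarrow> 'a::euclidean_space set \<Rightarrow> 'a set \<Rightarrow> ennreal" where
  "Cap p F \<Omega> =
     Inf {energy p \<Omega> u | u. u \<in> D0 p \<Omega> \<and>
            (\<exists>U. open U \<and> F \<subseteq> U \<and> U \<subseteq> \<Omega> \<and> (AE x in lebesgue_on U. 1 \<le> u x))}"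

text \<open>Absolute values and real powers with values in \<open>[0, \<infinity>]\<close>; the exponent is always positive.\<close>

definition eabs :: "ereal \<Rightarrow> ennreal" where
  "eabs x = e2ennreal \<bar>x\<bar>"

definition epowr :: "ennreal \<Rightarrow> real \<Rightarrow> ennreal" where
  "epowr x q = (if x = top then top else ennreal (enn2real x powr q))"

definition M_space :: "'a::euclidean_space set \<Rightarrow> ('a \<Rightarrow> ereal) set" where
  "M_space \<Omega> = {u. u \<in> borel_measurable (lebesgue_on \<Omega>) \<and> (AE x in lebesgue_on \<Omega>. \<bar>u x\<bar> \<noteq> \<infinity>)}"

definition L1_loc :: "'a::euclidean_space set \<Rightarrow> ('a \<Rightarrow> ereal) set" where
  "L1_loc \<Omega> = {g \<in> M_space \<Omega>.
     \<forall>K. compact K \<and> K \<subseteq> \<Omega> \<longrightarrow> (\<integral>\<^sup>+x. eabs (g x) \<partial>lebesgue_on K) < \<infinity>}"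

definition H_space :: "real \<Rightarrow> 'a::euclidean_space set \<Rightarrow> ('a \<Rightarrow> ereal) set" where
  "H_space p \<Omega> = {g \<in> L1_loc \<Omega>.
     \<exists>C>0. \<forall>u\<in>D0 p \<Omega>.
       (\<integral>\<^sup>+x. eabs (g x) * ennreal (\<bar>u x\<bar> powr p) \<partial>lebesgue_on \<Omega>) \<le> ennreal C * energy p \<Omega> u}"

definition H_norm :: "real \<Rightarrow> 'a::euclidean_space set \<Rightarrow> ('a \<Rightarrow> ereal) \<Rightarrow> ennreal" where
  "H_norm p \<Omega> g =
     Sup {(\<integral>\<^sup>+x. eabs (g x) \<partial>lebesgue_on F) / Cap p F \<Omega> | F.
            F \<in> sets lebesgue \<and> relatively_compact_in F \<Omega> \<and> emeasure lebesgue F \<noteq> 0}"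


section \<open>The associate space and the space E\<close>

definition assoc_norm :: "real \<Rightarrow> 'a::euclidean_space set \<Rightarrow> ('a \<Rightarrow> ereal) \<Rightarrow> ennreal" where
  "assoc_norm p \<Omega> v =
     Sup {\<integral>\<^sup>+x. eabs (f x * v x) \<partial>lebesgue_on \<Omega> | f. f \<in> H_space p \<Omega> \<and> H_norm p \<Omega> f \<le> 1}"

definition H_assoc :: "real \<Rightarrow> 'a::euclidean_space set \<Rightarrow> ('a \<Rightarrow> ereal) set" where
  "H_assoc p \<Omega> = {v \<in> M_space \<Omega>. assoc_norm p \<Omega> v < \<infinity>}"

definition abs_power :: "real \<Rightarrow> ('a \<Rightarrow> ereal) \<Rightarrow> 'a \<Rightarrow> ereal" where
  "abs_power p u = (\<lambda>x. enn2ereal (epowr (eabs (u x)) p))"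

definition E_space :: "real \<Rightarrow> 'a::euclidean_space set \<Rightarrow> ('a \<Rightarrow> ereal) set" where
  "E_space p \<Omega> = {u \<in> M_space \<Omega>. abs_power p u \<in> H_assoc p \<Omega>}"

definition E_norm :: "real \<Rightarrow> 'a::euclidean_space set \<Rightarrow> ('a \<Rightarrow> ereal) \<Rightarrow> real" where
  "E_norm p \<Omega> u = enn2real (assoc_norm p \<Omega> (abs_power p u)) powr (1 / p)"


section \<open>Lorentz space\<close>

definition rearrangement :: "'a::euclidean_space set \<Rightarrow> ('a \<Rightarrow> ereal) \<Rightarrow> real \<Rightarrow> ennreal" where
  "rearrangement \<Omega> f t =
     Inf {ennreal s | s. 0 < s \<and> emeasure lebesgue {x \<in> \<Omega>. ereal s < \<bar>f x\<bar>} < ennreal t}"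

definition Lorentz :: "real \<Rightarrow> real \<Rightarrow> 'a::euclidean_space set \<Rightarrow> ('a \<Rightarrow> ereal) set" where
  "Lorentz r q \<Omega> = {f \<in> M_space \<Omega>.
     (\<integral>\<^sup>+t\<in>{0<..}. epowr (ennreal (t powr (1 / r - 1 / q)) * rearrangement \<Omega> f t) q \<partial>lborel) < \<infinity>}"

definition sobolev_exponent :: "real \<Rightarrow> real \<Rightarrow> real" where
  "sobolev_exponent N p = N * p / (N - p)"

text \<open>
  Linear subspaces of \<^term>\<open>M_space \<Omega>\<close>.  Two members are finite almost everywhere, so the value
  that the pointwise sum takes where it reads \<open>\<infinity> - \<infinity>\<close> only matters on a null set.
\<close>

definition linear_function_space :: "('a \<Rightarrow> ereal) set \<Rightarrow> bool" where
  "linear_function_space V \<longleftrightarrow>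
     (\<lambda>x. 0) \<in> V \<and>
     (\<forall>u\<in>V. \<forall>v\<in>V. (\<lambda>x. u x + v x) \<in> V) \<and>
     (\<forall>c::real. \<forall>u\<in>V. (\<lambda>x. ereal c * u x) \<in> V)"

end

theory Submission imports Defs begin

text \<open>
  For (a), let \<open>\<parallel>f\<parallel> \<le> 1\<close>. Splitting \<open>|\<phi>|\<^sup>p\<close> over dyadic levels \<open>s\<close>, the integral of \<open>|f|\<close> over
  \<open>{|\<phi>| > s}\<close> is at most the capacity of this set, hence at most the energy of the smooth truncation
  \<open>2\<phi>\<^sup>2/(s\<^sup>2 + \<phi>\<^sup>2)\<close>; these energies, multiplied by \<open>s\<^sup>p\<close>, sum to a constant times the energy
  of \<open>\<phi>\<close> (Maz'ya). Fatou's lemma passes from test functions to \<open>D\<^sub>0\<close>.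

  For the inclusion in (b), a weak-type Sobolev inequality shows that weak \<open>L\<^bsup>N/p\<^esup>\<close> embeds into
  \<open>\<H>(\<Omega>)\<close>, so \<open>|u|\<^sup>p\<close> pairs boundedly with weak \<open>L\<^bsup>N/p\<^esup>\<close>, which is the Lorentz condition on \<open>u\<close>.
  The inclusion is strict because the functions \<open>1/e\<close> on slabs of width \<open>e\<close> around a hyperplane are
  bounded in \<open>\<H>(\<Omega>)\<close> uniformly in \<open>e\<close> but unbounded in weak \<open>L\<^bsup>N/p\<^esup>\<close>: a suitable negative
  power of the distance to the hyperplane lies in the Lorentz space but pairs unboundedly with them.
\<close>

section \<open>Smooth functions and test functions\<close>

text \<open>The associate norm ranges over weights that satisfy a Hardy inequality, while
  \<open>H_norm\<close> sees only capacities. So Maz'ya's passage from capacity to Hardy inequality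
  is used twice: for (a), and in (b) to admit the constructed weights to \<open>H_space\<close>.
  Since capacity enters only through sets where a test function reaches 1, those weights are tested
  on the sets {|\<phi>| >= 1} alone, and a weak-type Sobolev inequality suffices for them. It comes
  from a Vitali covering: around each point with |\<phi>| >= 1 some ball of bounded radius carries
  energy proportional to its volume. The competitors in \<open>Cap\<close> are only limits of test
  functions; passing to approximants costs factors 2^p, harmless because no sharp constant is
  claimed. For slabs, volume alone does not give a bound uniform in the width: transversal segments
  of unit length convert the slab integral into energy plus the volume of {|2 \<phi>| >= 1}.\<close>

lemma smooth_coinduct:
  assumes "f \<in> S"
    and diff: "\<And>g x. g \<in> S \<Longrightarrow> g differentiable (at x)"
    and deriv: "\<And>g b. g \<in> S \<Longrightarrow> b \<in> Basis \<Longrightarrow> (\<lambda>x. frechet_derivative g (at x) b) \<in> S"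
  shows "smooth f"
proof -
  have "set vs \<subseteq> Basis \<Longrightarrow> iter_deriv vs f \<in> S" for vs
    by (induction vs) (auto simp: assms)
  then show ?thesis
    by (auto simp: smooth_def diff)
qed

lemma iter_deriv_append: "iter_deriv (vs @ ws) f = iter_deriv vs (iter_deriv ws f)"
  by (induction vs) auto

lemma smooth_differentiable: "smooth f \<Longrightarrow> f differentiable (at x)"
  unfolding smooth_def by (metis empty_subsetI iter_deriv.simps(1) list.set(1))

lemma smooth_frechet_derivative:
  assumes "smooth f" "b \<in> Basis"
  shows "smooth (\<lambda>x. frechet_derivative f (at x) b)"
proof -
  have "iter_deriv (vs @ [b]) f differentiable (at x)" if "set vs \<subseteq> Basis" for vs x
    using assms that by (auto simp: smooth_def simp del: iter_deriv.simps)
  then show ?thesis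
    by (simp add: smooth_def iter_deriv_append)
qed

text \<open>Differentiating a product reproduces its factors, so a family of functions is rarely
  closed under derivatives by itself; the algebra it generates is a convenient invariant set for
  \<open>smooth_coinduct\<close>.\<close>

inductive_set generated_algebra :: "('a \<Rightarrow> real) set \<Rightarrow> ('a \<Rightarrow> real) set" for A where
  base: "g \<in> A \<Longrightarrow> g \<in> generated_algebra A"
| const: "(\<lambda>x. c) \<in> generated_algebra A"
| add: "f \<in> generated_algebra A \<Longrightarrow> g \<in> generated_algebra A \<Longrightarrow> (\<lambda>x. f x + g x) \<in> generated_algebra A"
| mult: "f \<in> generated_algebra A \<Longrightarrow> g \<in> generated_algebra A \<Longrightarrow> (\<lambda>x. f x * g x) \<in> generated_algebra A"

text \<open>The Leibniz rule makes the whole algebra stable under partial derivatives as soon as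
  those of the generators stay inside. The closure properties below reduce to a choice of
  generators.\<close>

lemma smooth_generated_algebra:
  fixes A :: "('a::euclidean_space \<Rightarrow> real) set"
  assumes f: "f \<in> generated_algebra A"
    and diff: "\<And>g x. g \<in> A \<Longrightarrow> g differentiable (at x)"
    and deriv: "\<And>g b. g \<in> A \<Longrightarrow> b \<in> Basis \<Longrightarrow> (\<lambda>x. frechet_derivative g (at x) b) \<in> generated_algebra A"
  shows "smooth f"
proof (rule smooth_coinduct[OF f])
  fix g x assume "g \<in> generated_algebra A"
  then show "g differentiable (at x)"
    by induction (auto intro: diff)
next
  fix g and b :: 'a
  assume "g \<in> generated_algebra A" and b: "b \<in> Basis"
  then have "(\<forall>x. g differentiable (at x)) \<and> (\<lambda>x. frechet_derivative g (at x) b) \<in> generated_algebra A"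
  proof induction
    case (base g)
    then show ?case by (auto intro: diff deriv b)
  next
    case (const c)
    then show ?case by (auto intro: generated_algebra.const)
  next
    case (add f g)
    have "frechet_derivative (\<lambda>x. f x + g x) (at x) b
        = frechet_derivative f (at x) b + frechet_derivative g (at x) b" for x
    proof -
      have "((\<lambda>x. f x + g x) has_derivative
          (\<lambda>v. frechet_derivative f (at x) v + frechet_derivative g (at x) v)) (at x)"
        using add.IH b by (intro has_derivative_add) (simp_all add: frechet_derivative_works[symmetric])
      from frechet_derivative_at[OF this] show ?thesis by metis
    qed
    then show ?case
      using add by (auto intro: generated_algebra.add generated_algebra.mult)
  next
    case (mult f g)
    have "frechet_derivative (\<lambda>x. f x * g x) (at x) b
        = f x * frechet_derivative g (at x) b + frechet_derivative f (at x) b * g x" for x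
    proof -
      have "((\<lambda>x. f x * g x) has_derivative
          (\<lambda>v. f x * frechet_derivative g (at x) v + frechet_derivative f (at x) v * g x)) (at x)"
        using mult.IH b by (intro has_derivative_mult) (simp_all add: frechet_derivative_works[symmetric])
      from frechet_derivative_at[OF this] show ?thesis by metis
    qed
    then show ?case
      using mult by (auto intro: generated_algebra.add generated_algebra.mult)
  qed
  then show "(\<lambda>x. frechet_derivative g (at x) b) \<in> generated_algebra A" by blast
qed

lemma smooth_const [simp]: "smooth (\<lambda>x. c)"
  by (rule smooth_generated_algebra[where A = "{}"]) (auto intro: generated_algebra.const)

lemma smooth_add: "smooth f \<Longrightarrow> smooth g \<Longrightarrow> smooth (\<lambda>x. f x + g x)"
  by (rule smooth_generated_algebra[where A = "Collect smooth"])
     (auto intro: generated_algebra.intros smooth_differentiable smooth_frechet_derivative)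

lemma smooth_mult: "smooth f \<Longrightarrow> smooth g \<Longrightarrow> smooth (\<lambda>x. f x * g x)"
  by (rule smooth_generated_algebra[where A = "Collect smooth"])
     (auto intro: generated_algebra.intros smooth_differentiable smooth_frechet_derivative)

lemma smooth_prod: "(\<And>i. i \<in> I \<Longrightarrow> smooth (f i)) \<Longrightarrow> smooth (\<lambda>x. \<Prod>i\<in>I. f i x)"
  by (induction I rule: infinite_finite_induct) (auto intro: smooth_mult)

lemma frechet_derivative_inverse_real:
  fixes f :: "'a::real_normed_vector \<Rightarrow> real"
  assumes "f differentiable (at x)" "f x \<noteq> 0"
  shows "frechet_derivative (\<lambda>x. inverse (f x)) (at x) v
    = - (inverse (f x) * frechet_derivative f (at x) v * inverse (f x))"
  unfolding frechet_derivative_at[OF Deriv.has_derivative_inverse[OF assms(2) assms(1)[unfolded frechet_derivative_works]], symmetric]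
  ..

text \<open>With 1/f adjoined to the smooth functions, the derivative -(1/f) f' (1/f) is again a
  polynomial in the generators, which replaces an induction on the order of differentiation.\<close>

lemma smooth_inverse:
  assumes f: "smooth f" and nz: "\<And>x. f x \<noteq> 0"
  shows "smooth (\<lambda>x. inverse (f x))"
proof (rule smooth_generated_algebra[where A = "insert (\<lambda>x. inverse (f x)) (Collect smooth)"])
  let ?A = "insert (\<lambda>x. inverse (f x)) (Collect smooth)"
  show "(\<lambda>x. inverse (f x)) \<in> generated_algebra ?A"
    by (auto intro: generated_algebra.base)
  show "g differentiable (at x)" if "g \<in> ?A" for g x
    using that smooth_differentiable[OF f] nz by (auto simp: smooth_differentiable)
  show "(\<lambda>x. frechet_derivative g (at x) b) \<in> generated_algebra ?A" if "g \<in> ?A" "b \<in> Basis" for g b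
  proof (cases "g = (\<lambda>x. inverse (f x))")
    case True
    have "(\<lambda>x. -1 * (inverse (f x) * frechet_derivative f (at x) b * inverse (f x))) \<in> generated_algebra ?A"
      using smooth_frechet_derivative[OF f \<open>b \<in> Basis\<close>]
      by (intro generated_algebra.mult generated_algebra.const generated_algebra.base) auto
    then show ?thesis
      using True by (simp add: frechet_derivative_inverse_real smooth_differentiable f nz)
  next
    case False
    then show ?thesis
      using that smooth_frechet_derivative by (auto intro: generated_algebra.base)
  qed
qed

text \<open>The classical exp(-1/t) is \<open>flat 0\<close>. The factors t^(-n) are kept because
  its derivatives produce them: the family over all n is closed under differentiation up to linear
  combinations.\<close>

definition flat :: "nat \<Rightarrow> real \<Rightarrow> real" where
  "flat n t = (if t \<le> 0 then 0 else inverse t ^ n * exp (- inverse t))"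

lemma flat_nonneg [simp]: "0 \<le> flat n t"
  by (simp add: flat_def)

lemma has_real_derivative_flat:
  "(flat n has_real_derivative flat (n + 2) t - of_nat n * flat (n + 1) t) (at t)"
proof (cases t "0 :: real" rule: linorder_cases)
  case less
  have "(flat n has_real_derivative 0) (at t)"
    by (rule has_field_derivative_transform_within_open[where S = "{..<0}" and f = "\<lambda>_. 0"])
       (use less in \<open>auto simp: flat_def\<close>)
  then show ?thesis using less by (simp add: flat_def)
next
  case greater
  have "((\<lambda>t. inverse t ^ n * exp (- inverse t)) has_real_derivative
      flat (n + 2) t - of_nat n * flat (n + 1) t) (at t)"
    using greater
    by (auto intro!: derivative_eq_intros simp: flat_def power2_eq_square field_simps)
       (cases n; simp add: field_simps)
  then show ?thesis
    by (rule has_field_derivative_transform_within_open[where S = "{0<..}"])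
       (use greater in \<open>auto simp: flat_def\<close>)
next
  case equal
  \<comment> \<open>At 0 the right difference quotient of \<open>flat n\<close> is y^(n+1) exp(-y)
    with y = 1/h tending to infinity; the left one vanishes identically.\<close>
  have "((\<lambda>y. y ^ (n + 1) * exp (- y)) \<longlongrightarrow> (0::real)) at_top"
    using tendsto_power_div_exp_0[of "n + 1"] by (simp add: exp_minus field_simps)
  then have "((\<lambda>h. inverse h ^ (n + 1) * exp (- inverse h)) \<longlongrightarrow> (0::real)) (at_right 0)"
    using filterlim_compose[OF _ filterlim_inverse_at_top_right] by blast
  then have r: "((\<lambda>h. flat n h / h) \<longlongrightarrow> 0) (at_right 0)"
    by (rule Lim_transform_eventually)
       (auto simp: flat_def eventually_at_right_less eventually_at_filter field_simps)
  have l: "((\<lambda>h. flat n h / h) \<longlongrightarrow> 0) (at_left 0)"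
    by (rule Lim_transform_eventually[OF tendsto_const])
       (auto simp: flat_def eventually_at_filter)
  have "((\<lambda>h. flat n h / h) \<longlongrightarrow> 0) (at 0)"
    using l r filterlim_split_at by blast
  then show ?thesis using equal
    by (simp add: DERIV_def flat_def)
qed

lemma smooth_flat_affine:
  fixes w :: "'a::euclidean_space"
  shows "smooth (\<lambda>x. flat n (c + x \<bullet> w))"
proof (rule smooth_generated_algebra[where A = "range (\<lambda>n x. flat n (c + x \<bullet> w))"])
  let ?A = "range (\<lambda>n x. flat n (c + x \<bullet> w))"
  have D: "((\<lambda>x. flat n (c + x \<bullet> w)) has_derivative
      (\<lambda>v. (v \<bullet> w) * (flat (n + 2) (c + x \<bullet> w) - of_nat n * flat (n + 1) (c + x \<bullet> w)))) (at x)" for n x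
  proof -
    have "((\<lambda>x. c + x \<bullet> w) has_derivative (\<lambda>v. v \<bullet> w)) (at x)"
      by (auto intro!: derivative_eq_intros)
    from has_derivative_compose[OF this has_real_derivative_flat[THEN has_field_derivative_imp_has_derivative]]
    show ?thesis by (simp add: mult.commute)
  qed
  show "(\<lambda>x. flat n (c + x \<bullet> w)) \<in> generated_algebra ?A"
    by (auto intro: generated_algebra.base)
  show "g differentiable (at x)" if "g \<in> ?A" for g x
    using that D differentiableI by fastforce
  show "(\<lambda>x. frechet_derivative g (at x) b) \<in> generated_algebra ?A" if g: "g \<in> ?A" for g b
  proof -
    obtain n where n: "g = (\<lambda>x. flat n (c + x \<bullet> w))" using g by auto
    have "(\<lambda>x. (b \<bullet> w) * (flat (n + 2) (c + x \<bullet> w) + (- of_nat n) * flat (n + 1) (c + x \<bullet> w)))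
        \<in> generated_algebra ?A"
      by (intro generated_algebra.intros) auto
    then show ?thesis
      unfolding n frechet_derivative_at[OF D, symmetric] by simp
  qed
qed

section \<open>Gradients and test functions\<close>

lemma has_derivative_gradient:
  assumes "f differentiable (at x)"
  shows "(f has_derivative (\<lambda>v. gradient f x \<bullet> v)) (at x)"
proof -
  have D: "(f has_derivative frechet_derivative f (at x)) (at x)"
    using assms frechet_derivative_works by blast
  interpret bounded_linear "frechet_derivative f (at x)"
    using D by (rule has_derivative_bounded_linear)
  have "frechet_derivative f (at x) v = gradient f x \<bullet> v" for v
  proof -
    have "frechet_derivative f (at x) v = frechet_derivative f (at x) (\<Sum>b\<in>Basis. (v \<bullet> b) *\<^sub>R b)"
      by (simp add: euclidean_representation)
    also have "\<dots> = (\<Sum>b\<in>Basis. (v \<bullet> b) * frechet_derivative f (at x) b)"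
      by (simp add: sum scaleR)
    also have "\<dots> = gradient f x \<bullet> v"
      unfolding gradient_def inner_sum_left by (intro sum.cong) (auto simp: inner_commute)
    finally show ?thesis .
  qed
  then show ?thesis using D by presburger
qed

lemma gradient_unique:
  assumes "(f has_derivative (\<lambda>v. g \<bullet> v)) (at x)"
  shows "gradient f x = g"
  unfolding gradient_def frechet_derivative_at[OF assms, symmetric]
  by (rule euclidean_representation)

lemma smooth_continuous_on: "smooth f \<Longrightarrow> continuous_on A f"
  by (meson differentiable_imp_continuous_within continuous_at_imp_continuous_on smooth_differentiable)

lemma smooth_continuous_on_gradient: "smooth f \<Longrightarrow> continuous_on A (gradient f)"
  unfolding gradient_def[abs_def]
  by (intro continuous_intros smooth_continuous_on smooth_frechet_derivative)

lemma gradient_eq_0_outside: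
  assumes "x \<notin> closure {x. f x \<noteq> 0}"
  shows "gradient f x = 0"
proof (rule gradient_unique)
  have "((\<lambda>_. 0) has_derivative (\<lambda>v. 0 \<bullet> v)) (at x)"
    by simp
  then show "(f has_derivative (\<lambda>v. 0 \<bullet> v)) (at x)"
    by (rule has_derivative_transform_within_open[where s = "- closure {x. f x \<noteq> 0}"])
       (use assms closure_subset[of "{x. f x \<noteq> 0}"] in auto)
qed

lemma test_functionsD:
  assumes "\<phi> \<in> test_functions \<Omega>"
  obtains K where "compact K" "K \<subseteq> \<Omega>" "\<And>x. x \<notin> K \<Longrightarrow> \<phi> x = 0" "\<And>x. x \<notin> K \<Longrightarrow> gradient \<phi> x = 0"
proof (rule that[of "closure {x. \<phi> x \<noteq> 0}"])
  show "\<phi> x = 0" if "x \<notin> closure {x. \<phi> x \<noteq> 0}" for x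
    using that closure_subset[of "{x. \<phi> x \<noteq> 0}"] by auto
qed (use assms in \<open>auto simp: test_functions_def gradient_eq_0_outside\<close>)

lemma test_functionsI:
  assumes "smooth \<phi>" "compact K" "K \<subseteq> \<Omega>" "\<And>x. x \<notin> K \<Longrightarrow> \<phi> x = 0"
  shows "\<phi> \<in> test_functions \<Omega>"
proof -
  have "closure {x. \<phi> x \<noteq> 0} \<subseteq> K"
    using assms by (intro closure_minimal) (auto simp: compact_imp_closed)
  moreover from this have "compact (closure {x. \<phi> x \<noteq> 0})"
    using assms(2) by (metis closed_closure compact_Int_closed inf.absorb_iff2)
  ultimately show ?thesis
    using assms by (auto simp: test_functions_def)
qed

lemma test_functions_smooth: "\<phi> \<in> test_functions \<Omega> \<Longrightarrow> smooth \<phi>"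
  by (simp add: test_functions_def)

lemma test_functions_mult:
  assumes "\<phi> \<in> test_functions \<Omega>" "smooth f"
  shows "(\<lambda>x. f x * \<phi> x) \<in> test_functions \<Omega>"
proof -
  obtain K where K: "compact K" "K \<subseteq> \<Omega>" "\<And>x. x \<notin> K \<Longrightarrow> \<phi> x = 0"
    by (rule test_functionsD[OF assms(1)]) (rule that)
  show ?thesis
  proof (rule test_functionsI)
    show "smooth (\<lambda>x. f x * \<phi> x)"
      using assms by (intro smooth_mult) (simp_all add: test_functions_smooth)
    show "f x * \<phi> x = 0" if "x \<notin> K" for x
      using K(3)[OF that] by simp
  qed fact+
qed

lemma borel_measurable_smooth [measurable_dest]: "smooth f \<Longrightarrow> f \<in> borel_measurable borel"
  by (intro borel_measurable_continuous_onI smooth_continuous_on)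

lemma borel_measurable_gradient [measurable_dest]: "smooth f \<Longrightarrow> gradient f \<in> borel_measurable borel"
  by (intro borel_measurable_continuous_onI smooth_continuous_on_gradient)

section \<open>Weak gradients of test functions\<close>

text \<open>The definitions integrate against the completed measure restricted to \<Omega>, whereas
  Fubini, translations and scalings are used for \<open>lborel\<close>; functions vanishing off the
  set may change sides.\<close>

lemma nn_integral_lebesgue_on_eq_lborel:
  fixes f :: "'a::euclidean_space \<Rightarrow> ennreal"
  assumes "S \<in> sets lebesgue" "\<And>x. x \<notin> S \<Longrightarrow> f x = 0"
  shows "(\<integral>\<^sup>+x. f x \<partial>lebesgue_on S) = (\<integral>\<^sup>+x. f x \<partial>lborel)"
proof -
  have "(\<integral>\<^sup>+x. f x \<partial>lebesgue_on S) = (\<integral>\<^sup>+x. f x * indicator S x \<partial>lebesgue)"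
    using assms(1) by (subst nn_integral_restrict_space) auto
  also have "\<dots> = (\<integral>\<^sup>+x. f x \<partial>lebesgue)"
    using assms(2) by (intro nn_integral_cong) (auto simp: indicator_def)
  finally show ?thesis by (simp add: nn_integral_completion)
qed

lemma integral_lebesgue_on_eq_lborel:
  fixes f :: "'a::euclidean_space \<Rightarrow> 'b::euclidean_space"
  assumes "S \<in> sets lebesgue" "\<And>x. x \<notin> S \<Longrightarrow> f x = 0" "f \<in> borel_measurable borel"
  shows "(LINT x|lebesgue_on S. f x) = (LINT x|lborel. f x)"
proof -
  have "(LINT x|lebesgue_on S. f x) = (LINT x|lebesgue. indicator S x *\<^sub>R f x)"
    using assms by (subst integral_restrict_space) auto
  also have "\<dots> = (LINT x|lebesgue. f x)"
    using assms(2) by (intro Bochner_Integration.integral_cong) (auto simp: indicator_def)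
  also have "\<dots> = (LINT x|lborel. f x)"
    using assms by (intro integral_completion) auto
  finally show ?thesis .
qed

lemma integrable_continuous_compact_support:
  fixes f :: "'a::euclidean_space \<Rightarrow> 'b::euclidean_space"
  assumes "continuous_on UNIV f" "compact K" "\<And>x. x \<notin> K \<Longrightarrow> f x = 0"
  shows "integrable lborel f"
proof -
  have "set_integrable lborel K f"
    unfolding set_integrable_def
    using assms(2) continuous_on_subset[OF assms(1)] by (intro borel_integrable_compact) auto
  then show ?thesis
    unfolding set_integrable_def
    by (rule Bochner_Integration.integrable_cong[THEN iffD1, rotated 2])
       (use assms in \<open>auto simp: indicator_def\<close>)
qed

lemma bounded_continuous_compact_support:
  fixes f :: "'a::euclidean_space \<Rightarrow> 'b::euclidean_space"
  assumes "continuous_on UNIV f" "compact K" "\<And>x. x \<notin> K \<Longrightarrow> f x = 0"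
  obtains B where "B > 0" "\<And>x. norm (f x) \<le> B"
proof -
  have "compact (f ` K)"
    using assms(2) continuous_on_subset[OF assms(1)] by (intro compact_continuous_image) auto
  then obtain B where B: "B > 0" "\<And>y. y \<in> f ` K \<Longrightarrow> norm y \<le> B"
    using bounded_pos compact_imp_bounded by metis
  then have "norm (f x) \<le> B" for x
    using assms(3)[of x] by (cases "x \<in> K") auto
  then show ?thesis using B(1) that by blast
qed

text \<open>The difference quotients in direction b have integral 0 by translation invariance, and
  they converge dominatedly to the derivative. This is the core of the integration by parts.\<close>

lemma integral_gradient_eq_0:
  fixes w :: "'a::euclidean_space \<Rightarrow> real"
  assumes w: "w \<in> test_functions \<Omega>" and b: "b \<in> Basis"
  shows "(LINT x|lborel. gradient w x \<bullet> b) = 0"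
proof -
  obtain K where K: "compact K" "\<And>x. x \<notin> K \<Longrightarrow> w x = 0" "\<And>x. x \<notin> K \<Longrightarrow> gradient w x = 0"
    by (rule test_functionsD[OF w]) (rule that)
  have sm: "smooth w" using w by (rule test_functions_smooth)
  have [measurable]: "w \<in> borel_measurable borel" "gradient w \<in> borel_measurable borel"
    using sm by (auto intro: borel_measurable_smooth borel_measurable_gradient)
  obtain B where B: "B > 0" "\<And>x. norm (gradient w x) \<le> B"
    using bounded_continuous_compact_support[OF smooth_continuous_on_gradient[OF sm] K(1,3)] by blast
  obtain r where r: "K \<subseteq> cball 0 r"
    using compact_imp_bounded[OF K(1)] by (auto simp: bounded_iff subset_iff)
  have int: "integrable lborel w"
    by (rule integrable_continuous_compact_support[OF smooth_continuous_on[OF sm] K(1,2)])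
  have lip: "\<bar>w y - w x\<bar> \<le> B * norm (y - x)" for x y
  proof -
    have "norm (w y - w x) \<le> B * norm (y - x)"
    proof (rule differentiable_bound[of UNIV w "\<lambda>x v. gradient w x \<bullet> v"])
      show "(w has_derivative (\<bullet>) (gradient w x)) (at x within UNIV)" for x
        by (simp add: has_derivative_gradient smooth_differentiable sm)
      show "onorm ((\<bullet>) (gradient w x)) \<le> B" for x
        proof (rule onorm_le)
          fix v
          have "\<bar>gradient w x \<bullet> v\<bar> \<le> norm (gradient w x) * norm v" by (rule Cauchy_Schwarz_ineq2)
          also have "\<dots> \<le> B * norm v" using B(2)[of x] by (intro mult_right_mono) auto
          finally show "norm (gradient w x \<bullet> v) \<le> B * norm v" by simp
        qed
    qed auto
    then show ?thesis by simp
  qed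
  define h where "h n = inverse (real (Suc n))" for n
  have h: "h n > 0" "h n \<le> 1" for n by (auto simp: h_def field_simps)
  define D where "D n x = (w (h n *\<^sub>R b + x) - w x) / h n" for n x
  have D0: "(LINT x|lborel. D n x) = 0" for n
  proof -
    have dist: "distr lborel borel ((+) (h n *\<^sub>R b)) = lborel"
      using lborel_affine[of 1 "h n *\<^sub>R b"] by (simp add: density_1)
    have "integrable lborel (\<lambda>x. w (h n *\<^sub>R b + x))"
      using int by (subst (asm) dist[symmetric]) (simp add: integrable_distr_eq)
    moreover have "(LINT x|lborel. w (h n *\<^sub>R b + x)) = (LINT x|lborel. w x)"
      by (subst (2) dist[symmetric]) (simp add: integral_distr)
    ultimately show ?thesis
      using int by (simp add: D_def)
  qed
  have "(\<lambda>n. LINT x|lborel. D n x) \<longlonglongrightarrow> (LINT x|lborel. gradient w x \<bullet> b)"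
  proof (rule integral_dominated_convergence)
    \<comment> \<open>The mean value bound B controls the quotients; since the steps
      \<open>h n\<close> are at most 1, they vanish outside the ball of radius r + 1.\<close>
    show "integrable lborel (\<lambda>x. B * indicator (cball 0 (r + 1) :: 'a set) x)"
      using emeasure_lborel_cball_finite by (intro integrable_mult_right) (auto simp: integrable_indicator_iff)
    show "AE x in lborel. norm (D n x) \<le> B * indicator (cball 0 (r + 1)) x" for n
    proof (intro AE_I2)
      fix x
      show "norm (D n x) \<le> B * indicator (cball 0 (r + 1)) x"
      proof (cases "x \<in> cball 0 (r + 1)")
        case True
        have "\<bar>D n x\<bar> = \<bar>w (h n *\<^sub>R b + x) - w x\<bar> / h n"
          using h[of n] by (simp add: D_def)
        also have "\<dots> \<le> B * norm (h n *\<^sub>R b) / h n"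
          using lip[of "h n *\<^sub>R b + x" x] h[of n] by (intro divide_right_mono) auto
        finally show ?thesis using True h[of n] b by simp
      next
        case False
        have "norm x \<le> norm (h n *\<^sub>R b + x) + norm (h n *\<^sub>R b)"
          by (metis add_diff_cancel_left' norm_triangle_ineq4 add.commute)
        then have "h n *\<^sub>R b + x \<notin> cball 0 r" "x \<notin> cball 0 r"
          using False h[of n] b by auto
        then show ?thesis
          using r K(2) False unfolding D_def by (metis (full_types) diff_self div_0 indicator_simps(2) mult_zero_right norm_zero order_refl subsetD)
      qed
    qed
    show "AE x in lborel. (\<lambda>n. D n x) \<longlonglongrightarrow> gradient w x \<bullet> b"
    proof (intro AE_I2)
      fix x
      have "((\<lambda>t. w (x + t *\<^sub>R b)) has_derivative (\<lambda>t. gradient w x \<bullet> (t *\<^sub>R b))) (at 0)"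
        using has_derivative_compose[of "\<lambda>t. x + t *\<^sub>R b" "\<lambda>t. t *\<^sub>R b" 0 UNIV w "\<lambda>v. gradient w x \<bullet> v"]
        by (force intro!: derivative_eq_intros has_derivative_gradient smooth_differentiable sm)
      then have "((\<lambda>t. w (x + t *\<^sub>R b)) has_field_derivative (gradient w x \<bullet> b)) (at 0)"
        by (simp add: has_field_derivative_def mult_commute_abs)
      then have "((\<lambda>t. (w (x + t *\<^sub>R b) - w x) / t) \<longlongrightarrow> gradient w x \<bullet> b) (at 0)"
        by (simp add: DERIV_def)
      moreover have "filterlim h (at 0) sequentially"
        using LIMSEQ_inverse_real_of_nat h(1) by (auto simp: filterlim_at h_def[abs_def])
      ultimately have "((\<lambda>n. (w (x + h n *\<^sub>R b) - w x) / h n) \<longlonglongrightarrow> gradient w x \<bullet> b)"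
        by (rule filterlim_compose)
      then show "(\<lambda>n. D n x) \<longlonglongrightarrow> gradient w x \<bullet> b"
        by (simp add: D_def add.commute)
    qed
    show "D n \<in> borel_measurable lborel" for n
      unfolding D_def[abs_def] by measurable
  qed auto
  then show ?thesis
    by (simp add: D0 LIMSEQ_const_iff)
qed

lemma gradient_mult:
  assumes "f differentiable (at x)" "g differentiable (at x)"
  shows "gradient (\<lambda>x. f x * g x) x = f x *\<^sub>R gradient g x + g x *\<^sub>R gradient f x"
proof (rule gradient_unique)
  show "((\<lambda>x. f x * g x) has_derivative (\<bullet>) (f x *\<^sub>R gradient g x + g x *\<^sub>R gradient f x)) (at x)"
    by (rule has_derivative_eq_rhs[OF has_derivative_mult])
       (auto intro!: has_derivative_gradient assms simp: inner_add_left)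
qed

text \<open>Integration by parts is \<open>integral_gradient_eq_0\<close> for the test function u
  \<phi>, split by the product rule.\<close>

lemma has_weak_gradient_test_function:
  fixes \<Omega> :: "'a::euclidean_space set"
  assumes "open \<Omega>" and u: "u \<in> test_functions \<Omega>"
  shows "has_weak_gradient \<Omega> u (gradient u)"
  unfolding has_weak_gradient_def
proof (intro conjI allI impI ballI)
  have sm: "smooth u" using u by (rule test_functions_smooth)
  have om: "\<Omega> \<in> sets lebesgue" using assms by (simp add: borel_open)
  note [measurable] = borel_measurable_smooth[OF sm] borel_measurable_gradient[OF sm]
  show "u \<in> borel_measurable (lebesgue_on \<Omega>)" "gradient u \<in> borel_measurable (lebesgue_on \<Omega>)"
    by (auto intro!: measurable_restrict_space1 measurable_completion)
  obtain K where K: "compact K" "K \<subseteq> \<Omega>" "\<And>x. x \<notin> K \<Longrightarrow> u x = 0" "\<And>x. x \<notin> K \<Longrightarrow> gradient u x = 0"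
    by (rule test_functionsD[OF u]) (rule that)
  have int: "integrable lborel u" "integrable lborel (gradient u)"
    using integrable_continuous_compact_support[OF smooth_continuous_on[OF sm] K(1,3)]
      integrable_continuous_compact_support[OF smooth_continuous_on_gradient[OF sm] K(1,4)] by auto
  show "integrable (lebesgue_on C) u" "integrable (lebesgue_on C) (gradient u)" if "compact C \<and> C \<subseteq> \<Omega>" for C
  proof -
    have "C \<in> sets lebesgue" using that by (simp add: borel_compact)
    moreover have "integrable lebesgue u" "integrable lebesgue (gradient u)"
      using int by (simp_all add: integrable_completion)
    ultimately show "integrable (lebesgue_on C) u" "integrable (lebesgue_on C) (gradient u)"
      using integrable_mult_indicator by (auto simp: integrable_restrict_space simp del: real_scaleR_def)
  qed
  fix \<phi> b assume phi: "\<phi> \<in> test_functions \<Omega>" and b: "b \<in> (Basis :: 'a set)"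
  have smp: "smooth \<phi>" using phi by (rule test_functions_smooth)
  note [measurable] = borel_measurable_smooth[OF smp] borel_measurable_gradient[OF smp]
  have cont: "continuous_on UNIV u" "continuous_on UNIV \<phi>" "continuous_on UNIV (gradient u)" "continuous_on UNIV (gradient \<phi>)"
    using sm smp smooth_continuous_on smooth_continuous_on_gradient by blast+
  have i1: "integrable lborel (\<lambda>x. u x * (gradient \<phi> x \<bullet> b))" and i2: "integrable lborel (\<lambda>x. (gradient u x \<bullet> b) * \<phi> x)"
    by (rule integrable_continuous_compact_support[OF _ K(1)]; use cont K in \<open>auto intro!: continuous_intros\<close>)+
  have w: "(\<lambda>x. u x * \<phi> x) \<in> test_functions \<Omega>"
    using test_functions_mult[OF phi sm] .
  have "gradient (\<lambda>x. u x * \<phi> x) x \<bullet> b = u x * (gradient \<phi> x \<bullet> b) + (gradient u x \<bullet> b) * \<phi> x" for x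
    by (subst gradient_mult) (auto simp: smooth_differentiable sm smp inner_add_left)
  then have "0 = (LINT x|lborel. u x * (gradient \<phi> x \<bullet> b) + (gradient u x \<bullet> b) * \<phi> x)"
    using integral_gradient_eq_0[OF w b] by simp
  also have "\<dots> = (LINT x|lborel. u x * (gradient \<phi> x \<bullet> b)) + (LINT x|lborel. (gradient u x \<bullet> b) * \<phi> x)"
    using i1 i2 by (rule Bochner_Integration.integral_add)
  also have "(LINT x|lborel. u x * (gradient \<phi> x \<bullet> b)) = (LINT x|lebesgue_on \<Omega>. u x * (gradient \<phi> x \<bullet> b))"
    using om K(2,3) by (subst integral_lebesgue_on_eq_lborel) auto
  also have "(LINT x|lborel. (gradient u x \<bullet> b) * \<phi> x) = (LINT x|lebesgue_on \<Omega>. (gradient u x \<bullet> b) * \<phi> x)"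
    using om K(2) K(4)[THEN arg_cong[where f = "\<lambda>v. v \<bullet> b"]]
    by (subst integral_lebesgue_on_eq_lborel) auto
  finally show "(LINT x|lebesgue_on \<Omega>. u x * (gradient \<phi> x \<bullet> b)) = - (LINT x|lebesgue_on \<Omega>. (gradient u x \<bullet> b) * \<phi> x)"
    by simp
qed

section \<open>Box indicators as limits of test functions, and uniqueness of weak gradients\<close>

definition box_bump :: "'a::euclidean_space \<Rightarrow> 'a \<Rightarrow> 'a \<Rightarrow> real" where
  "box_bump c d x = (\<Prod>i\<in>Basis. flat 0 (x \<bullet> i - c \<bullet> i) * flat 0 (d \<bullet> i - x \<bullet> i))"

lemma box_bump_nonneg: "0 \<le> box_bump c d x"
  unfolding box_bump_def by (intro prod_nonneg) auto

lemma box_bump_eq_0_iff: "box_bump c d x = 0 \<longleftrightarrow> x \<notin> box c d"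
proof -
  have "flat 0 t = 0 \<longleftrightarrow> t \<le> 0" for t
    by (simp add: flat_def)
  then show ?thesis
    by (auto simp: box_bump_def mem_box not_less)
qed

lemma smooth_box_bump: "smooth (box_bump c d)"
proof -
  have "smooth (\<lambda>x. flat 0 (x \<bullet> i - c \<bullet> i) * flat 0 (d \<bullet> i - x \<bullet> i))" for i
    using smooth_mult[OF smooth_flat_affine[of 0 "- (c \<bullet> i)" i] smooth_flat_affine[of 0 "d \<bullet> i" "- i"]]
    by (simp add: algebra_simps)
  then show ?thesis
    unfolding box_bump_def[abs_def] by (intro smooth_prod)
qed

text \<open>With b the bump of the box, n b / (1 + n b) stays below 1, tends to 1 where b > 0 and is
  0 elsewhere. Its support lies in the closed box, hence the assumption on
  \<open>cbox c d\<close>.\<close>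

lemma test_functions_approx_box:
  assumes "cbox c d \<subseteq> \<Omega>"
  obtains \<phi> :: "nat \<Rightarrow> 'a::euclidean_space \<Rightarrow> real"
  where "\<And>n. \<phi> n \<in> test_functions \<Omega>" "\<And>n x. 0 \<le> \<phi> n x" "\<And>n x. \<phi> n x \<le> indicator (box c d) x"
    "\<And>x. (\<lambda>n. \<phi> n x) \<longlonglongrightarrow> indicator (box c d) x"
proof
  let ?b = "box_bump c d"
  define \<phi> where "\<phi> n x = (real n * inverse (1 + real n * ?b x)) * ?b x" for n x
  have pos: "1 + real n * ?b x > 0" for n x
    by (simp add: add_pos_nonneg box_bump_nonneg)
  show "\<phi> n \<in> test_functions \<Omega>" for n
    unfolding \<phi>_def[abs_def]
  proof (rule test_functionsI)
    show "smooth (\<lambda>x. real n * inverse (1 + real n * ?b x) * ?b x)"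
      using pos by (intro smooth_mult smooth_const smooth_inverse smooth_add smooth_box_bump)
        (metis less_irrefl)
    show "real n * inverse (1 + real n * ?b x) * ?b x = 0" if "x \<notin> cbox c d" for x
      using that box_subset_cbox box_bump_eq_0_iff[of c d x] by auto
  qed (use assms in auto)
  show "0 \<le> \<phi> n x" for n x
    using pos[of n x] by (simp add: \<phi>_def box_bump_nonneg)
  show "\<phi> n x \<le> indicator (box c d) x" for n x
    using pos[of n x] box_bump_eq_0_iff[of c d x]
    by (auto simp: \<phi>_def indicator_def field_simps)
  show "(\<lambda>n. \<phi> n x) \<longlonglongrightarrow> indicator (box c d) x" for x
  proof (cases "x \<in> box c d")
    case True
    then have b: "?b x > 0"
      using box_bump_eq_0_iff[of c d x] box_bump_nonneg[of c d x] by linarith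
    have "(\<lambda>n. 1 - inverse (1 + real n * ?b x)) \<longlonglongrightarrow> 1 - 0"
      using b by (intro tendsto_diff tendsto_const tendsto_inverse_0_at_top
          filterlim_tendsto_add_at_top[OF tendsto_const] filterlim_at_top_mult_tendsto_pos[OF tendsto_const]
          filterlim_real_sequentially)
    moreover have "\<phi> n x = 1 - inverse (1 + real n * ?b x)" for n
      using pos[of n x] by (simp add: \<phi>_def field_simps)
    ultimately show ?thesis using True by simp
  next
    case False
    then show ?thesis using box_bump_eq_0_iff[of c d x] by (simp add: \<phi>_def)
  qed
qed

text \<open>Boxes are an intersection-stable generator of the Borel sets, so the vanishing extends
  to all Borel sets. The integral over the whole space is assumed separately because the space
  itself is no box and complements need it.\<close>

lemma AE_0_if_integral_boxes_0:
  fixes h :: "'a::euclidean_space \<Rightarrow> real"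
  assumes h: "integrable lborel h" and box: "\<And>c d. (LINT x|lborel. indicator (box c d) x * h x) = 0"
    and UN: "(LINT x|lborel. h x) = 0"
  shows "AE x in lborel. h x = 0"
proof (rule density_unique_real[OF h])
  have ind: "set_integrable lborel A h" if "A \<in> sets borel" for A
    unfolding set_integrable_def using h that by (intro integrable_mult_indicator) auto
  show "integrable lborel (\<lambda>x::'a. 0 :: real)" by simp
  fix A :: "'a set" assume "A \<in> sets lborel"
  then have "A \<in> sigma_sets UNIV (range (\<lambda>(a, b). box a b))"
    by (simp add: borel_eq_box)
  have stable: "Int_stable (range (\<lambda>(a, b). box a b :: 'a set))"
    by (auto simp: Int_stable_def box_Int_box)
  have sub: "range (\<lambda>(a, b). box a b :: 'a set) \<subseteq> Pow UNIV"
    by simp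
  from \<open>A \<in> sigma_sets _ _\<close> have "set_lebesgue_integral lborel A h = 0"
  proof (induction rule: sigma_sets_induct_disjoint[OF stable sub, consumes 1, case_names basic empty compl union])
    case (basic A)
    then show ?case using box by (auto simp: set_lebesgue_integral_def)
  next
    case empty
    show ?case by (simp add: set_lebesgue_integral_def)
  next
    case (compl A)
    then have [measurable]: "A \<in> sets borel" by (simp add: borel_eq_box)
    have "set_lebesgue_integral lborel (A \<union> (UNIV - A)) h = set_lebesgue_integral lborel A h + set_lebesgue_integral lborel (UNIV - A) h"
      using ind[of A] ind[of "UNIV - A"] by (intro set_integral_Un) auto
    then show ?case using compl UN by (simp add: set_lebesgue_integral_def)
  next
    case (union A)
    then have [measurable]: "A i \<in> sets borel" for i by (auto simp: borel_eq_box)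
    have "set_lebesgue_integral lborel (\<Union>i. A i) h = (\<Sum>i. set_lebesgue_integral lborel (A i) h)"
      using union.hyps(1) ind by (intro lebesgue_integral_countable_add) (auto simp: disjoint_family_on_def)
    then show ?case using union by simp
  qed
  then show "set_lebesgue_integral lborel A h = set_lebesgue_integral lborel A (\<lambda>x. 0)"
    by (simp add: set_lebesgue_integral_def)
qed

text \<open>The fundamental lemma of the calculus of variations. As g is only locally integrable,
  the argument runs in one box at a time with g cut off to it; the cut-off function then falls under
  \<open>AE_0_if_integral_boxes_0\<close>.\<close>

lemma AE_0_if_integral_test_functions_0:
  fixes g :: "'a::euclidean_space \<Rightarrow> real"
  assumes op: "open \<Omega>" and g: "g \<in> borel_measurable (lebesgue_on \<Omega>)"
    and int: "\<And>K. compact K \<Longrightarrow> K \<subseteq> \<Omega> \<Longrightarrow> integrable (lebesgue_on K) g"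
    and test: "\<And>\<phi>. \<phi> \<in> test_functions \<Omega> \<Longrightarrow> (LINT x|lebesgue_on \<Omega>. g x * \<phi> x) = 0"
  shows "AE x in lebesgue_on \<Omega>. g x = 0"
proof -
  have om: "\<Omega> \<in> sets lebesgue" using op by (simp add: borel_open)
  have local: "AE x in lebesgue. x \<in> box a b \<longrightarrow> g x = 0" if ab: "cbox a b \<subseteq> \<Omega>" for a b
  proof -
    have cint: "integrable lebesgue (\<lambda>x. indicator (cbox a b) x * g x)"
      using int[OF compact_cbox ab] by (simp add: integrable_restrict_space)
    have bint: "integrable lebesgue (\<lambda>x. indicator (box c d) x * (indicator (cbox a b) x * g x))" for c d
      using integrable_mult_indicator[OF _ cint, of "box c d"] by simp
    have eq: "indicator (box a b) x * (indicator (cbox a b) x * g x) = indicator (box a b) x * g x" for x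
      using box_subset_cbox by (auto simp: indicator_def)
    have hint: "integrable lebesgue (\<lambda>x. indicator (box a b) x * g x)"
      using bint[of a b] unfolding eq .
    \<comment> \<open>A Borel version of the cut-off g is taken, since g is merely Lebesgue
      measurable and the box lemma speaks of \<open>lborel\<close>.\<close>
    then obtain h where h: "h \<in> borel_measurable lborel" "AE x in lborel. indicator (box a b) x * g x = h x"
      using completion_ex_borel_measurable_real[OF borel_measurable_integrable] by blast
    then have hg: "AE x in lebesgue. indicator (box a b) x * g x = h x"
      by (intro AE_completion)
    have "integrable lebesgue h"
      using hint hg h(1) by (subst integrable_cong_AE[symmetric, OF _ _ hg]) (auto intro: measurable_completion)
    then have hint': "integrable lborel h"
      using h(1) by (simp add: integrable_completion)
    have box0: "(LINT x|lborel. indicator (box c d) x * h x) = 0" for c d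
    proof -
      obtain c' d' where cd: "box c d \<inter> box a b = box c' d'"
        by (simp add: box_Int_box)
      \<comment> \<open>The dominated convergence below uses test functions supported in the smaller
        closed box, which must therefore stay inside \<open>cbox a b\<close>; an empty open box says
        nothing about the closed one, hence the case split.\<close>
      have cd2: "box c' d' = {} \<or> cbox c' d' \<subseteq> cbox a b"
      proof (cases "box c' d' = {}")
        case False
        have "closure (box c' d') \<subseteq> cbox a b"
          using cd box_subset_cbox[of a b] by (intro closure_minimal) auto
        with False show ?thesis by (simp add: closure_box)
      qed simp
      have "(LINT x|lborel. indicator (box c d) x * h x) = (LINT x|lebesgue. indicator (box c d) x * h x)"
        using h(1) by (subst integral_completion) auto
      also have "\<dots> = (LINT x|lebesgue. indicator (box c' d') x * g x)"
      proof (rule integral_cong_AE)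
        show "AE x in lebesgue. indicator (box c d) x * h x = indicator (box c' d') x * g x"
          using hg by eventually_elim (auto simp: cd[symmetric] indicator_def)
        show "(\<lambda>x. indicator (box c d) x * h x) \<in> borel_measurable lebesgue"
          using h(1) by (intro measurable_completion) auto
        have "integrable lebesgue (\<lambda>x. indicator (box c d) x * (indicator (box a b) x * g x))"
          using integrable_mult_indicator[OF _ hint, of "box c d"] by simp
        then show "(\<lambda>x. indicator (box c' d') x * g x) \<in> borel_measurable lebesgue"
          by (auto simp: cd[symmetric] indicator_inter_arith mult.assoc)
      qed
      also have "\<dots> = 0"
      proof (cases "box c' d' = {}")
        case False
        then have sub: "cbox c' d' \<subseteq> cbox a b" using cd2 by simp
        with ab have "cbox c' d' \<subseteq> \<Omega>" by simp
        then obtain \<phi> :: "nat \<Rightarrow> 'a \<Rightarrow> real" where phi: "\<And>n. \<phi> n \<in> test_functions \<Omega>" "\<And>n x. 0 \<le> \<phi> n x"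
          "\<And>n x. \<phi> n x \<le> indicator (box c' d') x"
          "\<And>x. (\<lambda>n. \<phi> n x) \<longlonglongrightarrow> indicator (box c' d') x"
          using test_functions_approx_box by metis
        have out: "\<phi> n x = 0" if "x \<notin> box c' d'" for n x
          using phi(2)[of n x] phi(3)[of n x] that by simp
        have bsub: "box c' d' \<subseteq> cbox a b" using sub box_subset_cbox by blast
        have eq2: "(\<lambda>x. \<phi> n x * (indicator (cbox a b) x * g x)) = (\<lambda>x. g x * \<phi> n x)" for n
          using out bsub by (fastforce simp: indicator_def)
        have "(\<lambda>n. LINT x|lebesgue. \<phi> n x * (indicator (cbox a b) x * g x))
            \<longlonglongrightarrow> (LINT x|lebesgue. indicator (box c' d') x * (indicator (cbox a b) x * g x))"
        proof (rule integral_dominated_convergence[where w = "\<lambda>x. \<bar>indicator (cbox a b) x * g x\<bar>"])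
          show "integrable lebesgue (\<lambda>x. \<bar>indicator (cbox a b) x * g x\<bar>)"
            using cint by auto
          show "(\<lambda>x. indicator (box c' d') x * (indicator (cbox a b) x * g x)) \<in> borel_measurable lebesgue"
            using bint by (rule borel_measurable_integrable)
          show "(\<lambda>x. \<phi> n x * (indicator (cbox a b) x * g x)) \<in> borel_measurable lebesgue" for n
            using borel_measurable_smooth[OF test_functions_smooth[OF phi(1)]]
            by (intro borel_measurable_times[OF _ borel_measurable_integrable[OF cint]] measurable_completion) simp
          show "AE x in lebesgue. (\<lambda>n. \<phi> n x * (indicator (cbox a b) x * g x))
              \<longlonglongrightarrow> indicator (box c' d') x * (indicator (cbox a b) x * g x)"
            by (intro AE_I2 tendsto_mult phi(4) tendsto_const)
          show "AE x in lebesgue. norm (\<phi> n x * (indicator (cbox a b) x * g x)) \<le> \<bar>indicator (cbox a b) x * g x\<bar>" for n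
          proof (intro AE_I2)
            fix x
            have "\<bar>\<phi> n x\<bar> \<le> 1"
              using phi(2)[of n x] phi(3)[of n x] by (auto simp: indicator_def of_bool_def split: if_splits)
            then show "norm (\<phi> n x * (indicator (cbox a b) x * g x)) \<le> \<bar>indicator (cbox a b) x * g x\<bar>"
              by (simp add: abs_mult mult_left_le_one_le)
          qed
        qed
        moreover have "(LINT x|lebesgue. \<phi> n x * (indicator (cbox a b) x * g x)) = 0" for n
        proof -
          have "(LINT x|lebesgue. g x * \<phi> n x) = (LINT x|lebesgue. indicator \<Omega> x *\<^sub>R (g x * \<phi> n x))"
            using out bsub ab by (intro Bochner_Integration.integral_cong) (auto simp: indicator_def subset_iff)
          also have "\<dots> = (LINT x|lebesgue_on \<Omega>. g x * \<phi> n x)"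
            using om by (subst integral_restrict_space) auto
          finally show ?thesis using test[OF phi(1)] by (simp add: eq2)
        qed
        ultimately have "(LINT x|lebesgue. indicator (box c' d') x * (indicator (cbox a b) x * g x)) = 0"
          by (simp add: LIMSEQ_const_iff)
        moreover have "indicator (box c' d') x * (indicator (cbox a b) x * g x) = indicator (box c' d') x * g x" for x
          using bsub by (auto simp: indicator_def)
        ultimately show ?thesis by simp
      qed simp
      finally show ?thesis .
    qed
    have "(LINT x|lborel. h x) = (LINT x|lborel. indicator (box a b) x * h x)"
    proof (rule integral_cong_AE)
      show "AE x in lborel. h x = indicator (box a b) x * h x"
        using h(2) by eventually_elim (auto simp: indicator_def)
    qed (use h(1) in auto)
    then have "AE x in lborel. h x = 0"
      using box0[of a b] by (intro AE_0_if_integral_boxes_0[OF hint' box0]) simp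
    then have "AE x in lebesgue. h x = 0" by (rule AE_completion)
    with hg show ?thesis
      by eventually_elim (auto simp: indicator_def split: if_splits)
  qed
  \<comment> \<open>Countably many closed boxes exhaust \<Omega>; their boundaries are null sets, so
    the open boxes treated by \<open>local\<close> suffice.\<close>
  obtain D where D: "countable D" "D \<subseteq> Pow \<Omega>" "\<And>X. X \<in> D \<Longrightarrow> \<exists>a b. X = cbox a b" "\<Union>D = \<Omega>"
    using open_countable_Union_open_cbox[OF op] by metis
  have "AE x in lebesgue. x \<in> X \<longrightarrow> g x = 0" if XD: "X \<in> D" for X
  proof -
    obtain a b where X: "X = cbox a b" using D(3)[OF XD] by blast
    have "AE x in lebesgue. x \<notin> cbox a b - box a b"
      using negligible_frontier_interval[of a b]
      by (intro AE_not_in) (simp add: negligible_iff_null_sets)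
    moreover have "AE x in lebesgue. x \<in> box a b \<longrightarrow> g x = 0"
      using D(2) XD X by (intro local) auto
    ultimately show ?thesis unfolding X by eventually_elim auto
  qed
  then have aeD: "AE x in lebesgue. \<forall>X\<in>D. x \<in> X \<longrightarrow> g x = 0"
    using D(1) by (subst AE_ball_countable) auto
  have "AE x in lebesgue. x \<in> \<Omega> \<longrightarrow> g x = 0"
    unfolding D(4)[symmetric] by (rule AE_mp[OF aeD]) (auto intro!: AE_I2)
  then show ?thesis
    using om by (simp add: AE_restrict_space_iff)
qed

text \<open>\<open>weak_gradient\<close> is an arbitrary choice, so without uniqueness nothing could
  be said about \<open>energy\<close>, not even for a test function.\<close>

lemma has_weak_gradient_unique:
  fixes \<Omega> :: "'a::euclidean_space set"
  assumes op: "open \<Omega>" and G: "has_weak_gradient \<Omega> u G" and G': "has_weak_gradient \<Omega> u G'"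
  shows "AE x in lebesgue_on \<Omega>. G x = G' x"
proof -
  have om: "\<Omega> \<in> sets lebesgue" using op by (simp add: borel_open)
  have "AE x in lebesgue_on \<Omega>. (G x - G' x) \<bullet> b = 0" if b: "b \<in> Basis" for b
  proof (rule AE_0_if_integral_test_functions_0[OF op])
    have [measurable]: "G \<in> borel_measurable (lebesgue_on \<Omega>)" "G' \<in> borel_measurable (lebesgue_on \<Omega>)"
      using G G' by (auto simp: has_weak_gradient_def)
    show "(\<lambda>x. (G x - G' x) \<bullet> b) \<in> borel_measurable (lebesgue_on \<Omega>)"
      by measurable
    show int: "integrable (lebesgue_on K) (\<lambda>x. (G x - G' x) \<bullet> b)" if "compact K" "K \<subseteq> \<Omega>" for K
      using G G' that by (auto simp: has_weak_gradient_def)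
    fix \<phi> assume phi: "\<phi> \<in> test_functions \<Omega>"
    obtain K where K: "compact K" "K \<subseteq> \<Omega>" "\<And>x. x \<notin> K \<Longrightarrow> \<phi> x = 0"
      by (rule test_functionsD[OF phi]) (rule that)
    have sm: "smooth \<phi>" using phi by (rule test_functions_smooth)
    obtain B where B: "B > 0" "\<And>x. norm (\<phi> x) \<le> B"
      using bounded_continuous_compact_support[OF smooth_continuous_on[OF sm] K(1,3)] by blast
    have KL: "K \<in> sets lebesgue" using K(1) by (simp add: borel_compact)
    have i: "integrable (lebesgue_on \<Omega>) (\<lambda>x. (H x \<bullet> b) * \<phi> x)" if H: "has_weak_gradient \<Omega> u H" for H
    proof -
      have "integrable (lebesgue_on K) H" using H K by (auto simp: has_weak_gradient_def)
      then have Hi: "integrable lebesgue (\<lambda>x. indicator K x *\<^sub>R H x)"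
        using KL by (subst (asm) integrable_restrict_space) simp_all
      have "integrable lebesgue (\<lambda>x. \<phi> x * ((indicator K x *\<^sub>R H x) \<bullet> b))"
      proof (rule Bochner_Integration.integrable_bound[OF _ _ AE_I2])
        have Hb: "integrable lebesgue (\<lambda>x. (indicator K x *\<^sub>R H x) \<bullet> b)"
          using Hi by (rule integrable_inner_left)
        then show "integrable lebesgue (\<lambda>x. B * ((indicator K x *\<^sub>R H x) \<bullet> b))"
          by (rule integrable_mult_right)
        show "(\<lambda>x. \<phi> x * ((indicator K x *\<^sub>R H x) \<bullet> b)) \<in> borel_measurable lebesgue"
          using borel_measurable_smooth[OF sm]
          by (intro borel_measurable_times[OF _ borel_measurable_integrable[OF Hb]] measurable_completion) simp
        show "norm (\<phi> x * ((indicator K x *\<^sub>R H x) \<bullet> b)) \<le> norm (B * ((indicator K x *\<^sub>R H x) \<bullet> b))" for x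
          using B(1) B(2)[of x] by (simp add: abs_mult mult_right_mono)
      qed
      also have "(\<lambda>x. \<phi> x * ((indicator K x *\<^sub>R H x) \<bullet> b)) = (\<lambda>x. indicator \<Omega> x *\<^sub>R ((H x \<bullet> b) * \<phi> x))"
        using K(2,3) by (fastforce simp: indicator_def)
      finally show ?thesis
        using om by (subst integrable_restrict_space) simp_all
    qed
    have "(LINT x|lebesgue_on \<Omega>. (G x - G' x) \<bullet> b * \<phi> x) =
        (LINT x|lebesgue_on \<Omega>. (G x \<bullet> b) * \<phi> x) - (LINT x|lebesgue_on \<Omega>. (G' x \<bullet> b) * \<phi> x)"
      using i[OF G] i[OF G']
      by (subst Bochner_Integration.integral_diff[symmetric]) (simp_all add: inner_diff_left left_diff_distrib)
    also have "\<dots> = 0"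
    proof -
      have "(LINT x|lebesgue_on \<Omega>. u x * (gradient \<phi> x \<bullet> b)) = - (LINT x|lebesgue_on \<Omega>. (H x \<bullet> b) * \<phi> x)"
        if "has_weak_gradient \<Omega> u H" for H
        using that phi b unfolding has_weak_gradient_def by blast
      from this[OF G] this[OF G'] show ?thesis by simp
    qed
    finally show "(LINT x|lebesgue_on \<Omega>. (G x - G' x) \<bullet> b * \<phi> x) = 0" .
  qed
  then have "AE x in lebesgue_on \<Omega>. \<forall>b\<in>Basis. (G x - G' x) \<bullet> b = 0"
    by (subst AE_ball_countable) (auto intro: countable_finite)
  then show ?thesis
  proof eventually_elim
    case (elim x)
    show "G x = G' x"
      by (rule euclidean_eqI) (use elim in \<open>simp add: inner_diff_left\<close>)
  qed
qed

lemma has_weak_gradient_weak_gradient: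
  "has_weak_gradient \<Omega> u G \<Longrightarrow> has_weak_gradient \<Omega> u (weak_gradient \<Omega> u)"
  unfolding weak_gradient_def by (rule someI[of "has_weak_gradient \<Omega> u"])

lemma weak_gradient_test_function:
  fixes \<Omega> :: "'a::euclidean_space set"
  assumes "open \<Omega>" and "u \<in> test_functions \<Omega>"
  shows "AE x in lebesgue_on \<Omega>. weak_gradient \<Omega> u x = gradient u x"
proof (rule has_weak_gradient_unique[OF assms(1)])
  show "has_weak_gradient \<Omega> u (gradient u)"
    by (rule has_weak_gradient_test_function[OF assms])
  then show "has_weak_gradient \<Omega> u (weak_gradient \<Omega> u)"
    by (rule has_weak_gradient_weak_gradient)
qed

text \<open>Taken over the whole space with the classical gradient, this energy does not mention
  \<Omega> and is free of the choice in \<open>weak_gradient\<close>; on test functions it agrees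
  with \<open>energy\<close>.\<close>

definition dirichlet :: "real \<Rightarrow> ('a::euclidean_space \<Rightarrow> real) \<Rightarrow> ennreal" where
  "dirichlet p \<phi> = (\<integral>\<^sup>+x. ennreal (norm (gradient \<phi> x) powr p) \<partial>lborel)"

lemma dirichlet_eq_lebesgue_on:
  fixes \<Omega> :: "'a::euclidean_space set"
  assumes op: "open \<Omega>" and u: "u \<in> test_functions \<Omega>"
  shows "(\<integral>\<^sup>+x. ennreal (norm (gradient u x) powr p) \<partial>lebesgue_on \<Omega>) = dirichlet p u"
proof -
  obtain K where K: "K \<subseteq> \<Omega>" "\<And>x. x \<notin> K \<Longrightarrow> gradient u x = 0"
    by (rule test_functionsD[OF u]) (rule that)
  then show ?thesis
    unfolding dirichlet_def using op
    by (intro nn_integral_lebesgue_on_eq_lborel) (auto simp: borel_open)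
qed

lemma energy_test_function:
  fixes \<Omega> :: "'a::euclidean_space set"
  assumes op: "open \<Omega>" and u: "u \<in> test_functions \<Omega>"
  shows "energy p \<Omega> u = dirichlet p u"
  unfolding energy_def dirichlet_eq_lebesgue_on[OF assms, symmetric]
  using weak_gradient_test_function[OF assms] by (intro nn_integral_cong_AE) (auto elim!: eventually_mono)

lemma test_functions_subset_D0:
  fixes \<Omega> :: "'a::euclidean_space set"
  assumes op: "open \<Omega>" and u: "u \<in> test_functions \<Omega>"
  shows "u \<in> D0 p \<Omega>"
proof -
  have "(\<integral>\<^sup>+x. ennreal (norm (gradient u x - weak_gradient \<Omega> u x) powr p) \<partial>lebesgue_on \<Omega>)
      = (\<integral>\<^sup>+x. 0 \<partial>lebesgue_on \<Omega>)"
    using weak_gradient_test_function[OF assms] by (intro nn_integral_cong_AE) (auto elim!: eventually_mono)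
  then show ?thesis
    using has_weak_gradient_test_function[OF assms] u
    unfolding D0_def by (auto intro!: exI[of _ "\<lambda>_. u"])
qed

lemma dirichlet_finite:
  fixes u :: "'a::euclidean_space \<Rightarrow> real"
  assumes u: "u \<in> test_functions \<Omega>" and "0 \<le> p"
  shows "dirichlet p u < \<infinity>"
proof -
  obtain K where K: "compact K" "\<And>x. x \<notin> K \<Longrightarrow> gradient u x = 0"
    by (rule test_functionsD[OF u]) (rule that)
  obtain B where B: "B > 0" "\<And>x. norm (gradient u x) \<le> B"
    using bounded_continuous_compact_support[OF smooth_continuous_on_gradient[OF test_functions_smooth[OF u]] K]
    by blast
  have "dirichlet p u \<le> (\<integral>\<^sup>+x. ennreal (B powr p) * indicator K x \<partial>lborel)"
    unfolding dirichlet_def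
    using B assms K(2) by (intro nn_integral_mono) (auto simp: indicator_def intro!: ennreal_leI powr_mono2)
  also have "\<dots> = ennreal (B powr p) * emeasure lborel K"
    using K(1) by (simp add: nn_integral_cmult_indicator borel_compact)
  also have "\<dots> < \<infinity>"
    using emeasure_compact_finite[OF K(1)] by (simp add: ennreal_mult_less_top)
  finally show ?thesis .
qed

lemma dirichlet_cmult:
  assumes "\<phi> \<in> test_functions \<Omega>"
  shows "dirichlet p (\<lambda>x. c * \<phi> x) = ennreal (\<bar>c\<bar> powr p) * dirichlet p \<phi>"
proof -
  note sm = test_functions_smooth[OF assms]
  note [measurable] = borel_measurable_gradient[OF sm]
  have "gradient (\<lambda>x. c * \<phi> x) x = c *\<^sub>R gradient \<phi> x" for x
    using gradient_mult[of "\<lambda>_. c" x \<phi>] gradient_unique[of "\<lambda>_. c" 0 x] smooth_differentiable[OF sm] by simp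
  then show ?thesis
    unfolding dirichlet_def
    by (simp add: powr_mult ennreal_mult nn_integral_cmult)
qed

section \<open>A weak-type Sobolev inequality\<close>

text \<open>A linear substitute for Jensen's inequality: the level l separates small values of a
  from large ones, where a^(1-p) <= l^(1-p). It is applied with l the expected size of a gradient
  mean and with l = 1/4.\<close>

lemma le_add_powr:
  fixes a l p :: real
  assumes "0 \<le> a" "0 < l" "1 \<le> p"
  shows "a \<le> l + a powr p * l powr (1 - p)"
proof (cases "a \<le> l")
  case True
  then show ?thesis by (simp add: add_increasing2)
next
  case False
  then have "a = a powr p * a powr (1 - p)"
    using assms by (simp add: powr_add[symmetric])
  also have "\<dots> \<le> a powr p * l powr (1 - p)"
    using assms False by (intro mult_left_mono powr_mono2') auto
  finally show ?thesis using assms by simp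
qed

lemma cball_in_sets_borel [measurable, simp]: "cball (x::'a::euclidean_space) r \<in> sets borel"
  by (simp add: borel_closed)

lemma nn_integral_affine:
  fixes f :: "'a::euclidean_space \<Rightarrow> ennreal"
  assumes [measurable]: "f \<in> borel_measurable borel" and "0 < c"
  shows "(\<integral>\<^sup>+x. f x \<partial>lborel) = ennreal (c ^ DIM('a)) * (\<integral>\<^sup>+x. f (t + c *\<^sub>R x) \<partial>lborel)"
  using assms by (subst lborel_affine[of c t])
    (simp_all add: nn_integral_density nn_integral_distr nn_integral_cmult)

lemma nn_integral_translate:
  fixes f :: "'a::euclidean_space \<Rightarrow> ennreal"
  assumes "f \<in> borel_measurable borel"
  shows "(\<integral>\<^sup>+x. f (t + x) \<partial>lborel) = (\<integral>\<^sup>+x. f x \<partial>lborel)"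
  using nn_integral_affine[OF assms, of 1 t] by simp

lemma nn_integral_scaled_ball:
  fixes f :: "'a::euclidean_space \<Rightarrow> ennreal"
  assumes [measurable]: "f \<in> borel_measurable borel" and t: "0 < t"
  shows "(\<integral>\<^sup>+y. f y * indicator (cball x t) y \<partial>lborel)
    = ennreal (t ^ DIM('a)) * (\<integral>\<^sup>+z. f (x + t *\<^sub>R z) * indicator (cball 0 1) z \<partial>lborel)"
proof -
  have "indicator (cball x t) (x + t *\<^sub>R z) = (indicator (cball 0 1) z :: ennreal)" for z
    using t by (auto simp: indicator_def dist_norm)
  then show ?thesis
    using t by (subst nn_integral_affine[where c = t and t = x]) simp_all
qed

lemma smooth_segment_bound:
  fixes \<phi> :: "'a::euclidean_space \<Rightarrow> real"
  assumes sm: "smooth \<phi>" and R: "0 \<le> R"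
  shows "ennreal \<bar>\<phi> (x + R *\<^sub>R z) - \<phi> x\<bar>
    \<le> (\<integral>\<^sup>+t. ennreal (norm (gradient \<phi> (x + t *\<^sub>R z)) * norm z) * indicator {0..R} t \<partial>lborel)"
proof -
  let ?g = "\<lambda>t. gradient \<phi> (x + t *\<^sub>R z) \<bullet> z"
  have "((\<lambda>t. \<phi> (x + t *\<^sub>R z)) has_vector_derivative ?g t) (at t within {0..R})" for t
  proof -
    have "((\<lambda>t. x + t *\<^sub>R z) has_derivative (\<lambda>s. s *\<^sub>R z)) (at t)"
      by (auto intro!: derivative_eq_intros)
    from has_derivative_compose[OF this has_derivative_gradient[OF smooth_differentiable[OF sm]]]
    have "((\<lambda>t. \<phi> (x + t *\<^sub>R z)) has_derivative (\<lambda>s. s *\<^sub>R ?g t)) (at t)"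
      by simp
    then show ?thesis
      unfolding has_vector_derivative_def by (rule has_derivative_at_withinI)
  qed
  moreover have "continuous_on {0..R} ?g"
    by (intro continuous_intros continuous_on_compose2[OF smooth_continuous_on_gradient[OF sm, of UNIV]]) auto
  ultimately have I: "has_bochner_integral lborel (\<lambda>t. indicator {0..R} t *\<^sub>R ?g t)
      (\<phi> (x + R *\<^sub>R z) - \<phi> (x + 0 *\<^sub>R z))"
    using R by (intro has_bochner_integral_FTC_Icc)
  have "ennreal (norm (\<phi> (x + R *\<^sub>R z) - \<phi> x)) \<le> (\<integral>\<^sup>+t. ennreal (norm (indicator {0..R} t *\<^sub>R ?g t)) \<partial>lborel)"
    using integral_norm_bound_ennreal[of lborel "\<lambda>t. indicator {0..R} t *\<^sub>R ?g t"] I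
    by (auto simp: has_bochner_integral_iff)
  also have "\<dots> \<le> (\<integral>\<^sup>+t. ennreal (norm (gradient \<phi> (x + t *\<^sub>R z)) * norm z) * indicator {0..R} t \<partial>lborel)"
    by (intro nn_integral_mono) (auto simp: indicator_def Cauchy_Schwarz_ineq2 intro!: ennreal_leI)
  finally show ?thesis by simp
qed

context
  fixes p :: real and \<phi> :: "'a::euclidean_space \<Rightarrow> real" and \<Omega> :: "'a set" and N :: nat and \<omega> :: real
  assumes N: "N = DIM('a)" and \<omega>: "\<omega> = unit_ball_vol (real N)"
    and p: "1 < p" "p < real N" and test: "\<phi> \<in> test_functions \<Omega>"
begin

private lemma sm: "smooth \<phi>"
  using test by (rule test_functions_smooth)

private lemmas [measurable] = borel_measurable_smooth[OF sm] borel_measurable_gradient[OF sm]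

private lemma \<omega>_pos: "0 < \<omega>"
  by (simp add: \<omega> unit_ball_vol_pos)

private lemma emeasure_\<omega>: "0 \<le> r \<Longrightarrow> emeasure lborel (cball (x::'a) r) = ennreal (\<omega> * r ^ N)"
  by (simp add: emeasure_cball \<omega> N)

text \<open>The p-th power of the gradient is traded for the first by \<open>le_add_powr\<close>
  with the given l; both terms contribute l \<omega>, which explains the factor 2 where Jensen would
  give 1.\<close>

private lemma ball_average_gradient_le:
  assumes t: "0 < t" and l: "0 < l"
    and le: "(\<integral>\<^sup>+y. ennreal (norm (gradient \<phi> y) powr p) * indicator (cball x t) y \<partial>lborel)
      \<le> ennreal (l powr p * \<omega> * t ^ N)"
  shows "(\<integral>\<^sup>+z. ennreal (norm (gradient \<phi> (x + t *\<^sub>R z))) * indicator (cball 0 1) z \<partial>lborel) \<le> ennreal (2 * l * \<omega>)"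
proof -
  let ?G = "\<lambda>z. norm (gradient \<phi> (x + t *\<^sub>R z))"
  let ?I = "\<integral>\<^sup>+z. ennreal (?G z powr p) * indicator (cball 0 1) z \<partial>lborel"
  have "ennreal (t ^ N) * ?I \<le> ennreal (t ^ N) * ennreal (l powr p * \<omega>)"
  proof -
    have "ennreal (l powr p * \<omega> * t ^ N) = ennreal (t ^ N) * ennreal (l powr p * \<omega>)"
      using t \<omega>_pos by (subst ennreal_mult[symmetric]) (auto simp: mult_ac)
    then show ?thesis
      using le t by (subst (asm) nn_integral_scaled_ball) (auto simp: N)
  qed
  then have I: "?I \<le> ennreal (l powr p * \<omega>)"
    using t by (subst (asm) ennreal_mult_le_mult_iff) auto
  have "(\<integral>\<^sup>+z. ennreal (?G z) * indicator (cball 0 1) z \<partial>lborel)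
      \<le> (\<integral>\<^sup>+z. ennreal l * indicator (cball 0 1) z + ennreal (l powr (1 - p)) * (ennreal (?G z powr p) * indicator (cball 0 1) z) \<partial>lborel)"
  proof (rule nn_integral_mono)
    fix z
    have "ennreal (?G z) \<le> ennreal (l + l powr (1 - p) * ?G z powr p)"
      using le_add_powr[of "?G z" l p] p l by (intro ennreal_leI) (simp add: mult.commute)
    then show "ennreal (?G z) * indicator (cball 0 1) z \<le>
        ennreal l * indicator (cball 0 1) z + ennreal (l powr (1 - p)) * (ennreal (?G z powr p) * indicator (cball 0 1) z)"
      using l by (auto simp: indicator_def ennreal_mult[symmetric] ennreal_plus[symmetric] simp del: ennreal_plus)
  qed
  also have "\<dots> = ennreal l * ennreal \<omega> + ennreal (l powr (1 - p)) * ?I"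
    using emeasure_\<omega>[of 1 0] by (simp add: nn_integral_add nn_integral_cmult nn_integral_cmult_indicator)
  also have "\<dots> \<le> ennreal l * ennreal \<omega> + ennreal (l powr (1 - p)) * ennreal (l powr p * \<omega>)"
    by (intro add_mono mult_left_mono I) auto
  also have "\<dots> = ennreal (l * \<omega> + l powr (1 - p) * (l powr p * \<omega>))"
    using l \<omega>_pos by (simp add: ennreal_mult)
  also have "l powr (1 - p) * (l powr p * \<omega>) = l * \<omega>"
    using l by (simp add: mult.assoc[symmetric] powr_add[symmetric])
  finally show ?thesis by (simp add: mult_ac)
qed

text \<open>The fundamental theorem of calculus along the rays x + t z is averaged over z in the
  unit ball. Keeping the radius t outside leads to means over concentric balls instead of the
  singular kernel |x - y|^(1-N).\<close>

private lemma average_bound: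
  assumes R: "0 \<le> R"
  shows "ennreal (\<omega> * \<bar>\<phi> x\<bar>) \<le> (\<integral>\<^sup>+z. ennreal \<bar>\<phi> (x + R *\<^sub>R z)\<bar> * indicator (cball 0 1) z \<partial>lborel)
    + (\<integral>\<^sup>+t. (\<integral>\<^sup>+z. ennreal (norm (gradient \<phi> (x + t *\<^sub>R z))) * indicator (cball 0 1) z \<partial>lborel) * indicator {0..R} t \<partial>lborel)"
proof -
  let ?G = "\<lambda>t z. ennreal (norm (gradient \<phi> (x + t *\<^sub>R z)))"
  have "ennreal (\<omega> * \<bar>\<phi> x\<bar>) = (\<integral>\<^sup>+z. ennreal \<bar>\<phi> x\<bar> * indicator (cball 0 1) z \<partial>(lborel :: 'a measure))"
    using \<omega>_pos emeasure_\<omega>[of 1 0]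
    by (subst nn_integral_cmult_indicator) (auto simp: borel_closed ennreal_mult[symmetric] mult.commute)
  also have "\<dots> \<le> (\<integral>\<^sup>+z. ennreal \<bar>\<phi> (x + R *\<^sub>R z)\<bar> * indicator (cball 0 1) z
      + (\<integral>\<^sup>+t. ?G t z * indicator (cball 0 1) z * indicator {0..R} t \<partial>lborel) \<partial>lborel)"
  proof (rule nn_integral_mono)
    fix z :: 'a
    show "ennreal \<bar>\<phi> x\<bar> * indicator (cball 0 1) z \<le> ennreal \<bar>\<phi> (x + R *\<^sub>R z)\<bar> * indicator (cball 0 1) z
      + (\<integral>\<^sup>+t. ?G t z * indicator (cball 0 1) z * indicator {0..R} t \<partial>lborel)"
    proof (cases "z \<in> cball 0 1")
      case True
      have "ennreal \<bar>\<phi> x\<bar> \<le> ennreal (\<bar>\<phi> (x + R *\<^sub>R z)\<bar> + \<bar>\<phi> (x + R *\<^sub>R z) - \<phi> x\<bar>)"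
        by (intro ennreal_leI) linarith
      also have "\<dots> = ennreal \<bar>\<phi> (x + R *\<^sub>R z)\<bar> + ennreal \<bar>\<phi> (x + R *\<^sub>R z) - \<phi> x\<bar>"
        by simp
      also have "ennreal \<bar>\<phi> (x + R *\<^sub>R z) - \<phi> x\<bar>
          \<le> (\<integral>\<^sup>+t. ennreal (norm (gradient \<phi> (x + t *\<^sub>R z)) * norm z) * indicator {0..R} t \<partial>lborel)"
        by (rule smooth_segment_bound[OF sm R])
      also have "\<dots> \<le> (\<integral>\<^sup>+t. ?G t z * indicator {0..R} t \<partial>lborel)"
        using True by (intro nn_integral_mono mult_right_mono ennreal_leI) (auto simp: mult_left_le)
      finally show ?thesis using True by simp
    qed simp
  qed
  also have "\<dots> = (\<integral>\<^sup>+z. ennreal \<bar>\<phi> (x + R *\<^sub>R z)\<bar> * indicator (cball 0 1) z \<partial>lborel)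
      + (\<integral>\<^sup>+z. (\<integral>\<^sup>+t. ?G t z * indicator (cball 0 1) z * indicator {0..R} t \<partial>lborel) \<partial>lborel)"
    by (intro nn_integral_add) auto
  also have "(\<integral>\<^sup>+z. (\<integral>\<^sup>+t. ?G t z * indicator (cball 0 1) z * indicator {0..R} t \<partial>lborel) \<partial>lborel)
      = (\<integral>\<^sup>+t. (\<integral>\<^sup>+z. ?G t z * indicator (cball 0 1) z * indicator {0..R} t \<partial>lborel) \<partial>lborel)"
    by (rule lborel_pair.Fubini') (auto simp: split_beta')
  also have "\<dots> = (\<integral>\<^sup>+t. (\<integral>\<^sup>+z. ?G t z * indicator (cball 0 1) z \<partial>lborel) * indicator {0..R} t \<partial>lborel)"
    by (intro nn_integral_cong nn_integral_multc) auto
  finally show ?thesis .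
qed

text \<open>If all balls of radius at most \<rho> carried less, the gradient means in
  \<open>average_bound\<close> would contribute at most \<omega>/4 for t <= \<rho>. For larger t the
  total energy bounds them by a multiple of t^(-N/p), integrable because p < N, and \<rho> makes
  this tail \<omega>/4 as well. The mean of |\<phi>| over a huge ball adds another \<omega>/4, and
  the sum is below \<omega>.\<close>

private lemma exists_ball_large_gradient:
  assumes e: "0 < e" "dirichlet p \<phi> \<le> ennreal e" and x: "1 \<le> \<bar>\<phi> x\<bar>"
  defines "a \<equiv> real N / p - 1"
  defines "\<rho> \<equiv> (8 * (e / \<omega>) powr (1 / p) / a) powr (1 / a)"
  shows "\<exists>t. 0 < t \<and> t \<le> \<rho> \<and> ennreal ((1 / (8 * \<rho>)) powr p * \<omega> * t ^ N)
    \<le> (\<integral>\<^sup>+y. ennreal (norm (gradient \<phi> y) powr p) * indicator (cball x t) y \<partial>lborel)"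
proof (rule ccontr)
  assume neg: "\<not> ?thesis"
  have a: "a > 0" using p by (simp add: a_def field_simps)
  have \<rho>: "\<rho> > 0" using a e \<omega>_pos by (simp add: \<rho>_def)
  let ?G = "\<lambda>y. ennreal (norm (gradient \<phi> y) powr p)"
  let ?m = "\<lambda>t. \<integral>\<^sup>+z. ennreal (norm (gradient \<phi> (x + t *\<^sub>R z))) * indicator (cball 0 1) z \<partial>lborel"
  have m1: "?m t \<le> ennreal (\<omega> / (4 * \<rho>))" if "0 < t" "t \<le> \<rho>" for t
  proof -
    have "(\<integral>\<^sup>+y. ?G y * indicator (cball x t) y \<partial>lborel) \<le> ennreal ((1 / (8 * \<rho>)) powr p * \<omega> * t ^ N)"
      using neg that by (meson linear)
    then have "?m t \<le> ennreal (2 * (1 / (8 * \<rho>)) * \<omega>)"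
      using that \<rho> by (intro ball_average_gradient_le) auto
    then show ?thesis by simp
  qed
  define A where "A = (e / \<omega>) powr (1 / p)"
  have A: "A > 0" using e \<omega>_pos by (simp add: A_def)
  have m2: "?m t \<le> ennreal (2 * \<omega> * A * t powr (- real N / p))" if "\<rho> \<le> t" for t
  proof -
    have t: "t > 0" using that \<rho> by simp
    have "(\<integral>\<^sup>+y. ?G y * indicator (cball x t) y \<partial>lborel) \<le> dirichlet p \<phi>"
      unfolding dirichlet_def by (intro nn_integral_mono) (auto simp: indicator_def)
    also have "\<dots> \<le> ennreal e" by fact
    \<comment> \<open>The level l = A t^(-N/p) is the one for which l^p \<omega> t^N equals the
      whole energy bound e.\<close>
    also have "e = (A * t powr (- real N / p)) powr p * \<omega> * t ^ N"
    proof -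
      have "A powr p = e / \<omega>" using p e \<omega>_pos by (simp add: A_def powr_powr)
      moreover have "(t powr (- real N / p)) powr p * t ^ N = 1"
        using t p by (simp add: powr_powr powr_realpow[symmetric] powr_add[symmetric])
      ultimately show ?thesis using A t \<omega>_pos by (simp add: powr_mult mult.assoc)
    qed
    finally have "?m t \<le> ennreal (2 * (A * t powr (- real N / p)) * \<omega>)"
      using t A by (intro ball_average_gradient_le) auto
    then show ?thesis by (simp add: mult_ac)
  qed
  obtain K where K: "compact K" "\<And>x. x \<notin> K \<Longrightarrow> \<phi> x = 0"
    by (rule test_functionsD[OF test]) (rule that)
  have int: "integrable lborel \<phi>"
    by (rule integrable_continuous_compact_support[OF smooth_continuous_on[OF sm] K])
  define L where "L = (\<integral>x. norm (\<phi> x) \<partial>lborel)"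
  have L: "(\<integral>\<^sup>+x. ennreal \<bar>\<phi> x\<bar> \<partial>lborel) = ennreal L" "L \<ge> 0"
    using int by (auto simp: L_def nn_integral_eq_integral[symmetric])
  \<comment> \<open>Since R >= 1, dividing by R^N is at least as good as dividing by R; so L <= R
    \<omega>/4 pushes the mean over the ball of radius R below \<omega>/4.\<close>
  define R where "R = max 1 (4 * L / \<omega>)"
  have R: "R \<ge> 1" "L \<le> R * \<omega> / 4"
  proof -
    have "4 * L / \<omega> \<le> R" by (simp add: R_def)
    then show "L \<le> R * \<omega> / 4" using \<omega>_pos by (simp add: field_simps)
  qed (simp add: R_def)
  have first: "(\<integral>\<^sup>+z. ennreal \<bar>\<phi> (x + R *\<^sub>R z)\<bar> * indicator (cball 0 1) z \<partial>lborel) \<le> ennreal (\<omega> / 4)" (is "?F \<le> _")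
  proof -
    have "ennreal R * ?F \<le> ennreal (R ^ N) * ?F"
      using R(1) power_increasing[of 1 N R] DIM_positive[where 'a='a] N by (intro mult_right_mono ennreal_leI) auto
    also have "\<dots> = (\<integral>\<^sup>+y. ennreal \<bar>\<phi> y\<bar> * indicator (cball x R) y \<partial>lborel)"
      using R by (subst nn_integral_scaled_ball) (auto simp: N)
    also have "\<dots> \<le> (\<integral>\<^sup>+y. ennreal \<bar>\<phi> y\<bar> \<partial>lborel)"
      by (intro nn_integral_mono) (auto simp: indicator_def)
    also have "\<dots> \<le> ennreal (R * (\<omega> / 4))"
      unfolding L(1) using R(2) by (intro ennreal_leI) simp
    also have "\<dots> = ennreal R * ennreal (\<omega> / 4)"
      using R \<omega>_pos by (intro ennreal_mult) auto
    finally show ?thesis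
      using R by (subst (asm) ennreal_mult_le_mult_iff) auto
  qed
  have "(\<integral>\<^sup>+t. ?m t * indicator {0..R} t \<partial>lborel)
      \<le> (\<integral>\<^sup>+t. ennreal (\<omega> / (4 * \<rho>)) * indicator {0..\<rho>} t
        + ennreal (2 * \<omega> * A * t powr (- real N / p)) * indicator {\<rho>..} t \<partial>lborel)"
  proof (rule nn_integral_mono_AE)
    have "AE t in lborel. t \<noteq> (0::real)" by (rule AE_lborel_singleton)
    then show "AE t in lborel. ?m t * indicator {0..R} t \<le> ennreal (\<omega> / (4 * \<rho>)) * indicator {0..\<rho>} t
        + ennreal (2 * \<omega> * A * t powr (- real N / p)) * indicator {\<rho>..} t"
    proof eventually_elim
      case (elim t)
      show ?case
      proof (cases "t \<in> {0..R}")
        case True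
        show ?thesis
        proof (cases "t \<le> \<rho>")
          case True
          then have "?m t \<le> ennreal (\<omega> / (4 * \<rho>))" using \<open>t \<in> {0..R}\<close> elim by (intro m1) auto
          then show ?thesis using True \<open>t \<in> {0..R}\<close> by (simp add: add_increasing2)
        next
          case False
          then show ?thesis using m2[of t] True by (simp add: add_increasing)
        qed
      qed simp
    qed
  qed
  also have "\<dots> = ennreal (\<omega> / (4 * \<rho>)) * ennreal \<rho>
      + (\<integral>\<^sup>+t. ennreal (2 * \<omega> * A * t powr (- real N / p)) * indicator {\<rho>..} t \<partial>lborel)"
    using \<rho> by (subst nn_integral_add) (auto simp: nn_integral_cmult)
  also have "(\<integral>\<^sup>+t. ennreal (2 * \<omega> * A * t powr (- real N / p)) * indicator {\<rho>..} t \<partial>lborel)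
      = ennreal (0 - (- 2 * \<omega> * A / a * \<rho> powr (- a)))"
  proof (rule nn_integral_FTC_atLeast)
    show "((\<lambda>t. - 2 * \<omega> * A / a * t powr (- a)) has_real_derivative 2 * \<omega> * A * t powr (- real N / p)) (at t)"
      if "\<rho> \<le> t" for t
    proof -
      have "((\<lambda>t. - 2 * \<omega> * A / a * t powr (- a)) has_real_derivative
          - 2 * \<omega> * A / a * (- a * t powr (- a - 1))) (at t)"
        using that \<rho> by (auto intro!: derivative_eq_intros)
      moreover have "- a - 1 = - real N / p" by (simp add: a_def)
      ultimately show ?thesis using a by (simp add: mult_ac)
    qed
    have "((\<lambda>t. t powr (- a)) \<longlongrightarrow> 0) at_top"
      using a by (intro tendsto_neg_powr filterlim_ident) auto
    then show "((\<lambda>t. - 2 * \<omega> * A / a * t powr (- a)) \<longlongrightarrow> 0) at_top"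
      using tendsto_mult_right_zero by blast
    show "0 \<le> 2 * \<omega> * A * t powr (- real N / p)" for t
      using A \<omega>_pos by simp
  qed auto
  \<comment> \<open>Here lies the origin of \<rho>: it makes the tail (2 \<omega> A / a) \<rho>^(-a)
    equal to \<omega>/4.\<close>
  also have "\<rho> powr (- a) = a / (8 * A)"
    using a A by (simp add: \<rho>_def powr_powr A_def[symmetric] powr_minus field_simps)
  also have "0 - (- 2 * \<omega> * A / a * (a / (8 * A))) = \<omega> / 4"
    using a A by (simp add: field_simps)
  also have "ennreal (\<omega> / (4 * \<rho>)) * ennreal \<rho> = ennreal (\<omega> / 4)"
    using \<rho> \<omega>_pos by (subst ennreal_mult[symmetric]) auto
  finally have second: "(\<integral>\<^sup>+t. ?m t * indicator {0..R} t \<partial>lborel) \<le> ennreal (\<omega> / 4) + ennreal (\<omega> / 4)" .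
  have "ennreal (\<omega> * 1) \<le> ennreal (\<omega> * \<bar>\<phi> x\<bar>)"
    using x \<omega>_pos by (intro ennreal_leI mult_left_mono) auto
  also have "\<dots> \<le> ennreal (\<omega> / 4) + (ennreal (\<omega> / 4) + ennreal (\<omega> / 4))"
    by (rule order_trans[OF average_bound add_mono[OF first second]]) (use R in auto)
  also have "\<dots> = ennreal (\<omega> * 3 / 4)"
    using \<omega>_pos by (simp add: ennreal_plus[symmetric] del: ennreal_plus)
  finally show False using \<omega>_pos by (subst (asm) ennreal_le_iff) auto
qed

text \<open>The radii are bounded by \<rho>, so Vitali's lemma yields disjoint balls whose fivefold
  enlargements cover. Each enlargement has volume at most 5^N (8 \<rho>)^p times the energy in its
  own ball, and by disjointness these energies add up to at most e.\<close>

private lemma superlevel_vitali: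
  assumes e: "0 < e" "dirichlet p \<phi> \<le> ennreal e"
  defines "a \<equiv> real N / p - 1"
  defines "\<rho> \<equiv> (8 * (e / \<omega>) powr (1 / p) / a) powr (1 / a)"
  shows "emeasure lborel {x. 1 \<le> \<bar>\<phi> x\<bar>} \<le> ennreal (5 ^ N * (8 * \<rho>) powr p * e)"
proof -
  let ?S = "{x. 1 \<le> \<bar>\<phi> x\<bar>}"
  let ?G = "\<lambda>y. ennreal (norm (gradient \<phi> y) powr p)"
  have a: "a > 0" using p by (simp add: a_def field_simps)
  have \<rho>: "\<rho> > 0" using a e \<omega>_pos by (simp add: \<rho>_def)
  have "\<forall>x\<in>?S. \<exists>t. 0 < t \<and> t \<le> \<rho> \<and> ennreal ((1 / (8 * \<rho>)) powr p * \<omega> * t ^ N)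
    \<le> (\<integral>\<^sup>+y. ?G y * indicator (cball x t) y \<partial>lborel)"
    using exists_ball_large_gradient[OF e] unfolding \<rho>_def a_def by blast
  from bchoice[OF this] obtain r where r: "\<And>x. x \<in> ?S \<Longrightarrow> 0 < r x \<and> r x \<le> \<rho>"
    and big: "\<And>x. x \<in> ?S \<Longrightarrow> ennreal ((1 / (8 * \<rho>)) powr p * \<omega> * r x ^ N)
    \<le> (\<integral>\<^sup>+y. ?G y * indicator (cball x (r x)) y \<partial>lborel)"
    by blast
  have "?S \<subseteq> (\<Union>i\<in>?S. cball i (r i))"
  proof
    fix x assume "x \<in> ?S"
    then show "x \<in> (\<Union>i\<in>?S. cball i (r i))"
      using r[of x] by (intro UN_I[of x]) auto
  qed
  from Vitali_covering_lemma_cballs[OF this r] obtain C where C: "countable C" "C \<subseteq> ?S"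
      "pairwise (\<lambda>i j. disjnt (cball i (r i)) (cball j (r j))) C"
      "?S \<subseteq> (\<Union>i\<in>C. cball i (5 * r i))"
    by blast
  let ?c = "5 ^ N * (8 * \<rho>) powr p"
  have "emeasure lborel ?S = (\<integral>\<^sup>+x. indicator ?S x \<partial>lborel)"
    by simp
  \<comment> \<open>Sums over the countable family are written as integrals over
    \<open>count_space C\<close>, so that exchanging them with the integral is an instance of
    Tonelli.\<close>
  also have "\<dots> \<le> (\<integral>\<^sup>+x. \<integral>\<^sup>+i. indicator (cball i (5 * r i)) x \<partial>count_space C \<partial>lborel)"
  proof (rule nn_integral_mono)
    fix x :: 'a
    show "indicator ?S x \<le> (\<integral>\<^sup>+i. indicator (cball i (5 * r i)) x \<partial>count_space C)"
    proof (cases "x \<in> ?S")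
      case True
      then obtain j where j: "j \<in> C" "x \<in> cball j (5 * r j)" using C(4) by blast
      have "1 = (\<integral>\<^sup>+i. indicator {j} i \<partial>count_space C)" using j(1) by simp
      also have "\<dots> \<le> (\<integral>\<^sup>+i. indicator (cball i (5 * r i)) x \<partial>count_space C)"
        using j(2) by (intro nn_integral_mono) (auto simp: indicator_def)
      finally show ?thesis using True by simp
    qed simp
  qed
  also have "\<dots> = (\<integral>\<^sup>+i. \<integral>\<^sup>+x. indicator (cball i (5 * r i)) x \<partial>lborel \<partial>count_space C)"
    by (rule nn_integral_count_space_nn_integral[OF C(1)]) auto
  also have "\<dots> \<le> (\<integral>\<^sup>+i. \<integral>\<^sup>+y. ennreal ?c * (?G y * indicator (cball i (r i)) y) \<partial>lborel \<partial>count_space C)"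
  proof (rule nn_integral_mono)
    fix i assume "i \<in> space (count_space C)"
    then have i: "i \<in> ?S" using C(2) by auto
    have ri: "r i > 0" using r[OF i] by simp
    have "(\<integral>\<^sup>+x. indicator (cball i (5 * r i)) x \<partial>lborel) = ennreal (\<omega> * (5 * r i) ^ N)"
      using ri by (simp add: borel_closed emeasure_\<omega>)
    also have "\<omega> * (5 * r i) ^ N = ?c * ((1 / (8 * \<rho>)) powr p * \<omega> * r i ^ N)"
      using \<rho> by (simp add: powr_divide power_mult_distrib)
    also have "ennreal \<dots> = ennreal ?c * ennreal ((1 / (8 * \<rho>)) powr p * \<omega> * r i ^ N)"
      by (rule ennreal_mult') simp
    also have "\<dots> \<le> ennreal ?c * (\<integral>\<^sup>+y. ?G y * indicator (cball i (r i)) y \<partial>lborel)"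
      by (intro mult_left_mono big[OF i]) simp
    also have "\<dots> = (\<integral>\<^sup>+y. ennreal ?c * (?G y * indicator (cball i (r i)) y) \<partial>lborel)"
      by (subst nn_integral_cmult) auto
    finally show "(\<integral>\<^sup>+x. indicator (cball i (5 * r i)) x \<partial>lborel)
        \<le> (\<integral>\<^sup>+y. ennreal ?c * (?G y * indicator (cball i (r i)) y) \<partial>lborel)" .
  qed
  also have "\<dots> = (\<integral>\<^sup>+y. \<integral>\<^sup>+i. ennreal ?c * (?G y * indicator (cball i (r i)) y) \<partial>count_space C \<partial>lborel)"
    by (rule nn_integral_count_space_nn_integral[OF C(1), symmetric]) auto
  also have "\<dots> \<le> (\<integral>\<^sup>+y. ennreal ?c * ?G y \<partial>lborel)"
  proof (rule nn_integral_mono)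
    fix y :: 'a
    have "(\<integral>\<^sup>+i. indicator (cball i (r i)) y \<partial>count_space C) \<le> (1 :: ennreal)"
    proof (cases "\<exists>j\<in>C. y \<in> cball j (r j)")
      case True
      then obtain j where j: "j \<in> C" "y \<in> cball j (r j)" by blast
      have "(\<integral>\<^sup>+i. indicator (cball i (r i)) y \<partial>count_space C) \<le> (\<integral>\<^sup>+i. indicator {j} i \<partial>count_space C)"
      proof (rule nn_integral_mono)
        fix i assume "i \<in> space (count_space C)"
        then show "indicator (cball i (r i)) y \<le> (indicator {j} i :: ennreal)"
          using j C(3) unfolding pairwise_def disjnt_iff by (auto simp: indicator_def simp del: mem_cball)
      qed
      then show ?thesis using j(1) by simp
    next
      case False
      then have "(\<integral>\<^sup>+i. indicator (cball i (r i)) y \<partial>count_space C) = (\<integral>\<^sup>+i. 0 \<partial>count_space C)"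
        by (intro nn_integral_cong) (auto simp: indicator_def)
      then show ?thesis by simp
    qed
    then have "ennreal ?c * (?G y * (\<integral>\<^sup>+i. indicator (cball i (r i)) y \<partial>count_space C)) \<le> ennreal ?c * (?G y * 1)"
      by (intro mult_left_mono) auto
    then show "(\<integral>\<^sup>+i. ennreal ?c * (?G y * indicator (cball i (r i)) y) \<partial>count_space C) \<le> ennreal ?c * ?G y"
      by (simp add: nn_integral_cmult)
  qed
  also have "\<dots> = ennreal ?c * dirichlet p \<phi>"
    unfolding dirichlet_def by (rule nn_integral_cmult) simp
  also have "\<dots> \<le> ennreal ?c * ennreal e"
    by (intro mult_left_mono e) simp
  finally show ?thesis using e by (simp add: ennreal_mult)
qed

text \<open>Here \<rho>^p is proportional to e^(1/a), and 1/a + 1 = N/(N-p) turns the Vitali bound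
  into the Sobolev power of e.\<close>

lemma superlevel_measure_aux:
  assumes e: "0 < e" "dirichlet p \<phi> \<le> ennreal e"
  shows "emeasure lborel {x. 1 \<le> \<bar>\<phi> x\<bar>} \<le> ennreal (5 ^ N * 8 powr p *
    (8 / (real N / p - 1) / \<omega> powr (1 / p)) powr (p / (real N / p - 1)) * e powr (real N / (real N - p)))"
proof -
  define a where "a = real N / p - 1"
  have a: "a > 0" using p by (simp add: a_def field_simps)
  define \<rho> where "\<rho> = (8 * (e / \<omega>) powr (1 / p) / a) powr (1 / a)"
  define k where "k = 8 / a / \<omega> powr (1 / p)"
  have "8 * (e / \<omega>) powr (1 / p) / a = k * e powr (1 / p)"
    using e by (simp add: powr_divide k_def)
  moreover have "k \<ge> 0" using a by (simp add: k_def)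
  ultimately have "\<rho> powr p = k powr (p / a) * e powr (1 / a)"
    using a p e by (simp add: \<rho>_def powr_powr powr_mult)
  moreover have "e powr (1 / a) * e = e powr (real N / (real N - p))"
  proof -
    have "1 / a + 1 = real N / (real N - p)" using p by (simp add: a_def field_simps)
    then show ?thesis using e by (metis powr_add powr_one less_imp_le)
  qed
  ultimately have "5 ^ N * (8 * \<rho>) powr p * e = 5 ^ N * 8 powr p * k powr (p / a) * e powr (real N / (real N - p))"
    by (simp add: powr_mult mult.assoc)
  then show ?thesis
    using superlevel_vitali[OF e] unfolding \<rho>_def a_def k_def by metis
qed

end

text \<open>C depends only on p and the dimension, not on \<Omega>. Other levels follow by scaling
  \<phi>. A real bound e > 0 in place of the energy itself keeps \<open>powr\<close> away from 0 and
  infinity.\<close>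

lemma weak_sobolev:
  fixes p :: real
  assumes p: "1 < p" "p < real DIM('a::euclidean_space)"
  obtains C where "C > 0"
    "\<And>(\<phi> :: 'a \<Rightarrow> real) \<Omega> e. \<phi> \<in> test_functions \<Omega> \<Longrightarrow> 0 < e \<Longrightarrow> dirichlet p \<phi> \<le> ennreal e \<Longrightarrow>
      emeasure lborel {x. 1 \<le> \<bar>\<phi> x\<bar>} \<le> ennreal (C * e powr (real DIM('a) / (real DIM('a) - p)))"
proof (rule that)
  have "real DIM('a) / p - 1 > 0" using p by (simp add: field_simps)
  moreover have "unit_ball_vol (real DIM('a)) \<noteq> 0" by (simp add: less_imp_neq[symmetric])
  ultimately show "0 < 5 ^ DIM('a) * 8 powr p * (8 / (real DIM('a) / p - 1)
      / unit_ball_vol (real DIM('a)) powr (1 / p)) powr (p / (real DIM('a) / p - 1))"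
    by (intro mult_pos_pos) auto
qed (rule superlevel_measure_aux[OF refl refl p])

section \<open>Capacitary bounds\<close>

lemma powr_add_le:
  fixes a b p :: real
  assumes "0 \<le> a" "0 \<le> b" "0 \<le> p"
  shows "(a + b) powr p \<le> 2 powr p * (a powr p + b powr p)"
proof -
  have "(a + b) powr p \<le> (2 * max a b) powr p"
    using assms by (intro powr_mono2) auto
  also have "\<dots> = 2 powr p * max a b powr p"
    using assms by (simp add: powr_mult)
  also have "\<dots> \<le> 2 powr p * (a powr p + b powr p)"
    by (intro mult_left_mono) (auto simp: max_def)
  finally show ?thesis .
qed

text \<open>Stands in for Minkowski's inequality; its constant 2^p reappears in every passage
  between a member of \<open>D0\<close> and its approximants.\<close>

lemma nn_integral_norm_powr_le:
  fixes f g :: "'b \<Rightarrow> 'c::euclidean_space"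
  assumes [measurable]: "f \<in> borel_measurable M" "g \<in> borel_measurable M" and "0 \<le> p"
  shows "(\<integral>\<^sup>+x. ennreal (norm (f x) powr p) \<partial>M)
    \<le> ennreal (2 powr p) * ((\<integral>\<^sup>+x. ennreal (norm (f x - g x) powr p) \<partial>M) + (\<integral>\<^sup>+x. ennreal (norm (g x) powr p) \<partial>M))"
proof -
  have "norm (f x) powr p \<le> 2 powr p * (norm (f x - g x) powr p + norm (g x) powr p)" for x
  proof -
    have "norm (f x) \<le> norm (f x - g x) + norm (g x)"
      by (metis diff_add_cancel norm_triangle_ineq)
    then have "norm (f x) powr p \<le> (norm (f x - g x) + norm (g x)) powr p"
      using assms(3) by (intro powr_mono2) auto
    also have "\<dots> \<le> 2 powr p * (norm (f x - g x) powr p + norm (g x) powr p)"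
      using assms(3) by (intro powr_add_le) auto
    finally show ?thesis .
  qed
  then have "(\<integral>\<^sup>+x. ennreal (norm (f x) powr p) \<partial>M)
      \<le> (\<integral>\<^sup>+x. ennreal (2 powr p) * (ennreal (norm (f x - g x) powr p) + ennreal (norm (g x) powr p)) \<partial>M)"
    by (intro nn_integral_mono) (simp add: ennreal_plus[symmetric] ennreal_mult[symmetric] ennreal_leI del: ennreal_plus)
  also have "\<dots> = ennreal (2 powr p) * ((\<integral>\<^sup>+x. ennreal (norm (f x - g x) powr p) \<partial>M) + (\<integral>\<^sup>+x. ennreal (norm (g x) powr p) \<partial>M))"
    by (simp add: nn_integral_cmult nn_integral_add)
  finally show ?thesis .
qed

lemma AE_lebesgue_on_iff:
  assumes "S \<in> sets lebesgue"
  shows "(AE x in lebesgue_on S. P x) \<longleftrightarrow> (AE x in lebesgue. x \<in> S \<longrightarrow> P x)"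
  using assms by (subst AE_restrict_space_iff) auto

lemma nn_integral_lebesgue_on:
  assumes "S \<in> sets lebesgue"
  shows "(\<integral>\<^sup>+x. f x \<partial>lebesgue_on S) = (\<integral>\<^sup>+x. f x * indicator S x \<partial>lebesgue)"
  using assms by (subst nn_integral_restrict_space) auto

lemma nn_integral_lebesgue_on_subset:
  assumes "S \<in> sets lebesgue" "T \<in> sets lebesgue" "S \<subseteq> T"
  shows "(\<integral>\<^sup>+x. f x \<partial>lebesgue_on S) = (\<integral>\<^sup>+x. f x * indicator S x \<partial>lebesgue_on T)"
  using assms by (auto simp: nn_integral_lebesgue_on indicator_def intro!: nn_integral_cong)

text \<open>A smooth stand-in for min(1, |\<phi>|/s), which is not differentiable; for s > 0 it is
  at least 1 exactly where |\<phi>| >= s. The last factor \<phi> is split off so that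
  \<open>test_functions_mult\<close> gives the compact support.\<close>

definition truncation :: "real \<Rightarrow> ('a \<Rightarrow> real) \<Rightarrow> 'a \<Rightarrow> real" where
  "truncation s \<phi> x = (2 * \<phi> x * inverse (s\<^sup>2 + \<phi> x * \<phi> x)) * \<phi> x"

text \<open>With g in the role of an absolute value, this is \<open>H_norm\<close> at most c with
  the quotient multiplied out, which keeps the conventions for division by 0 and infinity out of the
  estimates.\<close>

definition capacity_bound :: "real \<Rightarrow> 'a::euclidean_space set \<Rightarrow> ('a \<Rightarrow> ennreal) \<Rightarrow> ennreal \<Rightarrow> bool" where
  "capacity_bound p \<Omega> g c \<longleftrightarrow> (\<forall>F. F \<in> sets lebesgue \<longrightarrow> relatively_compact_in F \<Omega> \<longrightarrow> emeasure lebesgue F \<noteq> 0 \<longrightarrow>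
     (\<integral>\<^sup>+x. g x \<partial>lebesgue_on F) \<le> c * Cap p F \<Omega>)"

text \<open>Increasing and bounded by 1 on r >= 0, with increment r / ((1 + 2 r) (1 + r)) from r to
  2 r. Up to a constant, this increment dominates the gradient factor of a truncation.\<close>

definition telescope :: "real \<Rightarrow> real" where
  "telescope r = r / (1 + r)"

context
  fixes \<Omega> :: "'a::euclidean_space set" and p :: real
  assumes op: "open \<Omega>" and p: "1 < p"
begin

private lemma \<Omega>_sets: "\<Omega> \<in> sets lebesgue"
  using op by (simp add: borel_open)

private lemma gradient_measurable:
  assumes "\<phi> \<in> test_functions \<Omega>"
  shows "gradient \<phi> \<in> borel_measurable (lebesgue_on \<Omega>)"
  using borel_measurable_gradient[OF test_functions_smooth[OF assms]]
  by (intro measurable_restrict_space1 measurable_completion) simp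

private lemma weak_gradient_D0:
  assumes "u \<in> D0 p \<Omega>"
  shows "has_weak_gradient \<Omega> u (weak_gradient \<Omega> u)"
  using assms has_weak_gradient_weak_gradient by (auto simp: D0_def)

private lemma weak_gradient_measurable:
  assumes "u \<in> D0 p \<Omega>"
  shows "weak_gradient \<Omega> u \<in> borel_measurable (lebesgue_on \<Omega>)"
  using weak_gradient_D0[OF assms] by (simp add: has_weak_gradient_def)

lemma D0_measurable:
  assumes "u \<in> D0 p \<Omega>"
  shows "u \<in> borel_measurable (lebesgue_on \<Omega>)"
  using weak_gradient_D0[OF assms] by (simp add: has_weak_gradient_def)

text \<open>Finiteness is not written into \<open>D0\<close>; it is inherited from a test function
  whose gradient is close to that of u.\<close>

lemma energy_D0_finite:
  assumes u: "u \<in> D0 p \<Omega>"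
  shows "energy p \<Omega> u < \<infinity>"
proof -
  let ?d = "\<lambda>\<phi>. \<integral>\<^sup>+x. ennreal (norm (gradient \<phi> x - weak_gradient \<Omega> u x) powr p) \<partial>lebesgue_on \<Omega>"
  obtain \<phi> where phi: "\<And>n::nat. \<phi> n \<in> test_functions \<Omega>" "(\<lambda>n. ?d (\<phi> n)) \<longlonglongrightarrow> 0"
    using u by (auto simp: D0_def)
  have "eventually (\<lambda>n. ?d (\<phi> n) < 1) sequentially"
    by (rule order_tendstoD(2)[OF phi(2)]) simp
  then obtain n where n: "?d (\<phi> n) < 1"
    by (auto simp: eventually_sequentially)
  have "energy p \<Omega> u \<le> ennreal (2 powr p) *
      ((\<integral>\<^sup>+x. ennreal (norm (weak_gradient \<Omega> u x - gradient (\<phi> n) x) powr p) \<partial>lebesgue_on \<Omega>)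
       + (\<integral>\<^sup>+x. ennreal (norm (gradient (\<phi> n) x) powr p) \<partial>lebesgue_on \<Omega>))"
    unfolding energy_def
    using p by (intro nn_integral_norm_powr_le weak_gradient_measurable gradient_measurable u phi) simp
  also have "\<dots> = ennreal (2 powr p) * (?d (\<phi> n) + dirichlet p (\<phi> n))"
    by (simp add: norm_minus_commute dirichlet_eq_lebesgue_on[OF op phi(1)])
  also have "\<dots> < \<infinity>"
    using n dirichlet_finite[OF phi(1), of p n] p by (auto simp: ennreal_mult_less_top intro: less_trans)
  finally show ?thesis .
qed

text \<open>L1 convergence on K gives a.e. convergence only along a subsequence, which depends on K;
  hence one compact set is fixed. The uses below ask for bounded energies only, so the factor 2^p is
  accepted.\<close>

lemma D0_approximation:
  assumes u: "u \<in> D0 p \<Omega>" and K: "compact K" "K \<subseteq> \<Omega>" and e: "0 < e"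
  obtains \<phi> :: "nat \<Rightarrow> 'a \<Rightarrow> real" where "\<And>k. \<phi> k \<in> test_functions \<Omega>"
    "AE x in lebesgue_on K. (\<lambda>k. \<phi> k x) \<longlonglongrightarrow> u x"
    "\<And>k. dirichlet p (\<phi> k) \<le> ennreal (2 powr p) * energy p \<Omega> u + ennreal e"
proof -
  let ?d = "\<lambda>\<phi>. \<integral>\<^sup>+x. ennreal (norm (gradient \<phi> x - weak_gradient \<Omega> u x) powr p) \<partial>lebesgue_on \<Omega>"
  obtain \<phi> where phi: "\<And>n::nat. \<phi> n \<in> test_functions \<Omega>" "(\<lambda>n. ?d (\<phi> n)) \<longlonglongrightarrow> 0"
    "(\<lambda>n. \<integral>\<^sup>+x. ennreal \<bar>\<phi> n x - u x\<bar> \<partial>lebesgue_on K) \<longlonglongrightarrow> 0"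
    using u K by (auto simp: D0_def)
  have "eventually (\<lambda>n. ?d (\<phi> n) < ennreal (e / 2 powr p)) sequentially"
    using e by (intro order_tendstoD(2)[OF phi(2)]) simp
  then obtain m where m: "\<And>n. n \<ge> m \<Longrightarrow> ?d (\<phi> n) < ennreal (e / 2 powr p)"
    by (auto simp: eventually_sequentially)
  have bound: "dirichlet p (\<phi> n) \<le> ennreal (2 powr p) * energy p \<Omega> u + ennreal e" if "n \<ge> m" for n
  proof -
    have "dirichlet p (\<phi> n) \<le> ennreal (2 powr p) * (?d (\<phi> n) + energy p \<Omega> u)"
      unfolding dirichlet_eq_lebesgue_on[OF op phi(1), symmetric] energy_def
      using p by (intro nn_integral_norm_powr_le weak_gradient_measurable gradient_measurable u phi) simp
    also have "\<dots> \<le> ennreal (2 powr p) * (ennreal (e / 2 powr p) + energy p \<Omega> u)"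
      using m[OF that] by (intro mult_left_mono add_right_mono) auto
    also have "\<dots> = ennreal (2 powr p) * energy p \<Omega> u + ennreal (2 powr p) * ennreal (e / 2 powr p)"
      by (simp add: distrib_left add.commute)
    also have "ennreal (2 powr p) * ennreal (e / 2 powr p) = ennreal e"
      using e by (subst ennreal_mult[symmetric]) auto
    finally show ?thesis .
  qed
  have int: "integrable (lebesgue_on K) (\<lambda>x. \<phi> n x - u x)" for n
    using has_weak_gradient_test_function[OF op phi(1)[of n]] weak_gradient_D0[OF u] K
    by (auto simp: has_weak_gradient_def)
  have "(\<lambda>n. \<integral>x. norm (\<phi> (n + m) x - u x) \<partial>lebesgue_on K) \<longlonglongrightarrow> 0"
  proof (rule tendsto_ennrealD)
    have "ennreal (\<integral>x. norm (\<phi> (n + m) x - u x) \<partial>lebesgue_on K)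
        = (\<integral>\<^sup>+x. ennreal \<bar>\<phi> (n + m) x - u x\<bar> \<partial>lebesgue_on K)" for n
      using int[of "n + m"] by (subst nn_integral_eq_integral[symmetric]) auto
    then show "(\<lambda>n. ennreal (\<integral>x. norm (\<phi> (n + m) x - u x) \<partial>lebesgue_on K)) \<longlonglongrightarrow> ennreal 0"
      using LIMSEQ_ignore_initial_segment[OF phi(3), of m] by simp
  qed auto
  then obtain r where r: "strict_mono r" "AE x in lebesgue_on K. (\<lambda>n. \<phi> (r n + m) x - u x) \<longlonglongrightarrow> 0"
    using tendsto_L1_AE_subseq[of "lebesgue_on K" "\<lambda>n x. \<phi> (n + m) x - u x"] int by blast
  show thesis
  proof (rule that[of "\<lambda>k. \<phi> (r k + m)"])
    show "AE x in lebesgue_on K. (\<lambda>k. \<phi> (r k + m) x) \<longlonglongrightarrow> u x"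
      using r(2) by eventually_elim (simp add: LIM_zero_iff)
  qed (auto intro: phi bound)
qed

section \<open>Energies of the smooth truncations at dyadic levels\<close>

private lemma truncation_test:
  assumes "\<phi> \<in> test_functions \<Omega>" "0 < s"
  shows "truncation s \<phi> \<in> test_functions \<Omega>"
  unfolding truncation_def[abs_def]
proof (rule test_functions_mult[OF assms(1)])
  have "s\<^sup>2 + \<phi> x * \<phi> x \<noteq> 0" for x
    using assms(2) by (metis add_pos_nonneg less_irrefl zero_le_square zero_less_power)
  then show "smooth (\<lambda>x. 2 * \<phi> x * inverse (s\<^sup>2 + \<phi> x * \<phi> x))"
    using test_functions_smooth[OF assms(1)]
    by (intro smooth_mult smooth_const smooth_inverse smooth_add) auto
qed

private lemma truncation_ge_1:
  assumes "0 < s" "s \<le> \<bar>\<phi> x\<bar>"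
  shows "1 \<le> truncation s \<phi> x"
proof -
  have "s\<^sup>2 \<le> (\<phi> x)\<^sup>2"
    using assms by (metis abs_le_square_iff abs_of_pos)
  then show ?thesis
    using assms by (simp add: truncation_def field_simps power2_eq_square add_pos_nonneg)
qed

private lemma gradient_truncation:
  assumes "\<phi> \<in> test_functions \<Omega>" "0 < s"
  shows "gradient (truncation s \<phi>) x = (4 * s\<^sup>2 * \<phi> x / (s\<^sup>2 + (\<phi> x)\<^sup>2)\<^sup>2) *\<^sub>R gradient \<phi> x"
proof (rule gradient_unique)
  have pos: "s\<^sup>2 + t * t > 0" for t :: real
    using assms(2) by (intro add_pos_nonneg) auto
  have "((\<lambda>t. (2 * t * inverse (s\<^sup>2 + t * t)) * t) has_real_derivative 4 * s\<^sup>2 * t / (s\<^sup>2 + t\<^sup>2)\<^sup>2) (at t)" for t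
    using pos[of t] less_imp_neq[OF pos[of t]]
    by (auto intro!: derivative_eq_intros simp: field_simps power2_eq_square)
  from has_derivative_compose[OF has_derivative_gradient[OF smooth_differentiable[OF test_functions_smooth[OF assms(1)]]]
      this[THEN has_field_derivative_imp_has_derivative]]
  show "(truncation s \<phi> has_derivative (\<bullet>) ((4 * s\<^sup>2 * \<phi> x / (s\<^sup>2 + (\<phi> x)\<^sup>2)\<^sup>2) *\<^sub>R gradient \<phi> x)) (at x)"
    unfolding truncation_def[abs_def] by (rule has_derivative_eq_rhs) (simp add: fun_eq_iff)
qed

text \<open>With r = |t|/s the scaled derivative is 4 q, where q = r/(1 + r^2)^2 <= 1, so its p-th
  power is at most 4^p q. The bound q <= 6 r/((1 + 2 r) (1 + r)) then matches the increment of
  \<open>telescope\<close>; large r is harmless because q decays like r^(-3).\<close>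

private lemma truncation_factor_bound:
  assumes "0 < s"
  shows "(s * \<bar>4 * s\<^sup>2 * t / (s\<^sup>2 + t\<^sup>2)\<^sup>2\<bar>) powr p \<le> 4 powr p * (6 * (telescope (2 * (\<bar>t\<bar> / s)) - telescope (\<bar>t\<bar> / s)))"
proof -
  define r where "r = \<bar>t\<bar> / s"
  have r: "r \<ge> 0" "\<bar>t\<bar> = r * s" "t\<^sup>2 = r\<^sup>2 * s\<^sup>2"
    using assms by (auto simp: r_def power_divide)
  define q where "q = r / (1 + r\<^sup>2)\<^sup>2"
  have pos: "1 + r\<^sup>2 > 0" by (intro add_pos_nonneg) auto
  have "s * \<bar>4 * s\<^sup>2 * t / (s\<^sup>2 + t\<^sup>2)\<^sup>2\<bar> = s * (4 * s\<^sup>2 * (r * s) / (s\<^sup>2 + r\<^sup>2 * s\<^sup>2)\<^sup>2)"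
    using r by (simp add: abs_mult)
  also have "\<dots> = 4 * (s ^ 4 * r) / (s ^ 4 * (1 + r\<^sup>2)\<^sup>2)"
    by (simp add: power2_eq_square power4_eq_xxxx algebra_simps)
  also have "\<dots> = 4 * q"
    using assms by (simp add: q_def)
  finally have eq: "s * \<bar>4 * s\<^sup>2 * t / (s\<^sup>2 + t\<^sup>2)\<^sup>2\<bar> = 4 * q" .
  have q0: "q \<ge> 0" using r by (simp add: q_def)
  have "r \<le> 1 + r\<^sup>2"
    using sum_squares_bound[of r 1] r by (simp add: power2_eq_square)
  also have "\<dots> \<le> (1 + r\<^sup>2)\<^sup>2"
    by (rule self_le_power) auto
  finally have q1: "q \<le> 1"
    using pos by (simp add: q_def)
  have "(4 * q) powr p = 4 powr p * q powr p"
    using q0 by (simp add: powr_mult)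
  also have "q powr p \<le> q powr 1"
    using q0 q1 p by (intro powr_mono') auto
  also have "q powr 1 = q" using q0 by simp
  also have "q \<le> 6 * (r / ((1 + 2 * r) * (1 + r)))"
  proof -
    have "(1 + 2 * r) * (1 + r) \<le> 6 * (1 + r\<^sup>2)\<^sup>2"
    proof -
      have "(1 + 2 * r) * (1 + r) = 1 + 3 * r + 2 * r\<^sup>2"
        by (simp add: power2_eq_square algebra_simps)
      also have "\<dots> \<le> 6 * (1 + r\<^sup>2)"
        using sum_squares_bound[of r 1] r by (simp add: power2_eq_square)
      also have "\<dots> \<le> 6 * (1 + r\<^sup>2)\<^sup>2"
        using self_le_power[of "1 + r\<^sup>2" 2] by simp
      finally show ?thesis .
    qed
    then have "r * ((1 + 2 * r) * (1 + r)) \<le> r * (6 * (1 + r\<^sup>2)\<^sup>2)"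
      using r by (intro mult_left_mono)
    then show ?thesis
      using r pos unfolding q_def by (simp add: divide_simps)
  qed
  also have "r / ((1 + 2 * r) * (1 + r)) = telescope (2 * r) - telescope r"
    using r by (simp add: telescope_def divide_simps) (simp add: algebra_simps)
  finally show ?thesis
    unfolding eq r_def[symmetric] by (simp add: mult_left_mono)
qed

text \<open>Halving the level doubles the ratio |t|/s, so the increments of \<open>telescope\<close>
  along the dyadic levels collapse to a difference of at most 1. The 8^p is 2^p from the factor 2 at
  each level times 4^p from the derivative.\<close>

private lemma truncation_sum_bound:
  assumes "0 < B"
  shows "(\<Sum>k. ennreal ((2 * (B / 2 ^ (k + 1))) powr p * \<bar>4 * (B / 2 ^ (k + 1))\<^sup>2 * t / ((B / 2 ^ (k + 1))\<^sup>2 + t\<^sup>2)\<^sup>2\<bar> powr p))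
    \<le> ennreal (6 * 8 powr p)"
proof -
  define r where "r k = \<bar>t\<bar> * 2 ^ (k + 1) / B" for k :: nat
  have r: "r k \<ge> 0" "2 * r k = r (Suc k)" for k
    using assms by (auto simp: r_def)
  let ?f = "\<lambda>k. (2 * (B / 2 ^ (k + 1))) powr p * \<bar>4 * (B / 2 ^ (k + 1))\<^sup>2 * t / ((B / 2 ^ (k + 1))\<^sup>2 + t\<^sup>2)\<^sup>2\<bar> powr p"
  have le: "?f k \<le> 6 * 8 powr p * (telescope (r (Suc k)) - telescope (r k))" for k
  proof -
    let ?s = "B / 2 ^ (k + 1)"
    have s: "?s > 0" using assms by simp
    have "?f k = 2 powr p * (?s * \<bar>4 * ?s\<^sup>2 * t / (?s\<^sup>2 + t\<^sup>2)\<^sup>2\<bar>) powr p"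
      using s by (simp only: powr_mult mult.assoc less_imp_le abs_ge_zero)
    also have "\<dots> \<le> 2 powr p * (4 powr p * (6 * (telescope (2 * (\<bar>t\<bar> / ?s)) - telescope (\<bar>t\<bar> / ?s))))"
      by (intro mult_left_mono truncation_factor_bound s) simp
    also have "\<bar>t\<bar> / ?s = r k" by (simp add: r_def)
    also have "2 powr p * (4 powr p * (6 * (telescope (2 * r k) - telescope (r k)))) = 6 * (2 * 4) powr p * (telescope (r (Suc k)) - telescope (r k))"
      unfolding r(2) by (subst powr_mult) simp_all
    finally show ?thesis by simp
  qed
  have "(\<Sum>k<n. ennreal (?f k)) \<le> ennreal (6 * 8 powr p)" for n
  proof -
    have "(\<Sum>k<n. ?f k) \<le> (\<Sum>k<n. 6 * 8 powr p * (telescope (r (Suc k)) - telescope (r k)))"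
      by (intro sum_mono le)
    also have "\<dots> = 6 * 8 powr p * (\<Sum>k<n. telescope (r (Suc k)) - telescope (r k))"
      by (rule sum_distrib_left[symmetric])
    also have "(\<Sum>k<n. telescope (r (Suc k)) - telescope (r k)) = telescope (r n) - telescope (r 0)"
      by (rule sum_lessThan_telescope)
    also have "6 * 8 powr p * (telescope (r n) - telescope (r 0)) \<le> 6 * 8 powr p * 1"
    proof (intro mult_left_mono)
      have "telescope (r n) \<le> 1" "0 \<le> telescope (r 0)" using r(1)[of n] r(1)[of 0] by (auto simp: telescope_def field_simps)
      then show "telescope (r n) - telescope (r 0) \<le> 1" by simp
    qed simp
    finally have "ennreal (\<Sum>k<n. ?f k) \<le> ennreal (6 * 8 powr p)"
      by (intro ennreal_leI) simp
    moreover have "(\<Sum>k<n. ennreal (?f k)) = ennreal (\<Sum>k<n. ?f k)"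
      by (intro sum_ennreal mult_nonneg_nonneg powr_ge_zero)
    ultimately show ?thesis by metis
  qed
  then show ?thesis
    unfolding suminf_eq_SUP by (intro SUP_least)
qed

text \<open>The truncation at level s competes in the capacity of its superlevel set, which is open
  by the strict inequality and so serves as its own neighbourhood. Null sets are treated apart
  because the capacity bound says nothing about them.\<close>

private lemma superlevel_capacity:
  assumes phi: "\<phi> \<in> test_functions \<Omega>" and s: "0 < s" and g: "capacity_bound p \<Omega> g c"
  shows "(\<integral>\<^sup>+x. g x * indicator {x. s < \<bar>\<phi> x\<bar>} x \<partial>lebesgue_on \<Omega>) \<le> c * dirichlet p (truncation s \<phi>)"
proof -
  let ?F = "{x. s < \<bar>\<phi> x\<bar>}"
  obtain K where K: "compact K" "K \<subseteq> \<Omega>" "\<And>x. x \<notin> K \<Longrightarrow> \<phi> x = 0"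
    by (rule test_functionsD[OF phi]) (rule that)
  have FK: "?F \<subseteq> K" using K(3) s by force
  have opF: "open ?F"
    by (intro open_Collect_less continuous_intros smooth_continuous_on test_functions_smooth[OF phi])
  then have F: "?F \<in> sets lebesgue" by (simp add: borel_open)
  have eq: "(\<integral>\<^sup>+x. g x \<partial>lebesgue_on ?F) = (\<integral>\<^sup>+x. g x * indicator ?F x \<partial>lebesgue_on \<Omega>)"
    using FK K(2) by (intro nn_integral_lebesgue_on_subset F \<Omega>_sets) auto
  show ?thesis
  proof (cases "emeasure lebesgue ?F = 0")
    case True
    then have "AE x in lebesgue. x \<notin> ?F"
      using F by (intro AE_not_in) (simp add: null_sets_def)
    then have "AE x in lebesgue. x \<in> \<Omega> \<longrightarrow> g x * indicator ?F x = 0"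
      by eventually_elim (auto simp: indicator_def)
    then have "(\<integral>\<^sup>+x. g x * indicator ?F x \<partial>lebesgue_on \<Omega>) = (\<integral>\<^sup>+x. 0 \<partial>lebesgue_on \<Omega>)"
      by (intro nn_integral_cong_AE) (simp add: AE_lebesgue_on_iff \<Omega>_sets)
    then show ?thesis by simp
  next
    case False
    have "closure ?F \<subseteq> K"
      using FK K(1) by (intro closure_minimal compact_imp_closed)
    then have "relatively_compact_in ?F \<Omega>"
      using K(1,2) unfolding relatively_compact_in_def
      by (metis closed_closure compact_Int_closed inf.absorb_iff2 order_trans)
    then have "(\<integral>\<^sup>+x. g x \<partial>lebesgue_on ?F) \<le> c * Cap p ?F \<Omega>"
      using g False F by (auto simp: capacity_bound_def)
    also have "Cap p ?F \<Omega> \<le> energy p \<Omega> (truncation s \<phi>)"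
      unfolding Cap_def
    proof (intro Inf_lower CollectI exI conjI)
      show "truncation s \<phi> \<in> D0 p \<Omega>"
        by (intro test_functions_subset_D0 op truncation_test phi s)
      show "AE x in lebesgue_on ?F. 1 \<le> truncation s \<phi> x"
        unfolding AE_lebesgue_on_iff[OF F] by (intro AE_I2 impI truncation_ge_1[OF s]) simp
      show "?F \<subseteq> \<Omega>" using FK K(2) by blast
    qed (auto simp: opF)
    also have "energy p \<Omega> (truncation s \<phi>) = dirichlet p (truncation s \<phi>)"
      by (intro energy_test_function op truncation_test phi s)
    finally show ?thesis unfolding eq by (simp add: mult_left_mono)
  qed
qed

text \<open>Maz'ya's truncation argument; the sum over the levels is controlled by telescoping \<open>r/(1 + r)\<close>.\<close>

lemma capacity_bound_test_function:
  assumes phi: "\<phi> \<in> test_functions \<Omega>" and g: "capacity_bound p \<Omega> g c"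
    and [measurable]: "g \<in> borel_measurable (lebesgue_on \<Omega>)"
  shows "(\<integral>\<^sup>+x. g x * ennreal (\<bar>\<phi> x\<bar> powr p) \<partial>lebesgue_on \<Omega>) \<le> c * (ennreal (6 * 8 powr p) * dirichlet p \<phi>)"
proof -
  note sm = test_functions_smooth[OF phi]
  obtain K where K: "compact K" "K \<subseteq> \<Omega>" "\<And>x. x \<notin> K \<Longrightarrow> \<phi> x = 0"
    by (rule test_functionsD[OF phi]) (rule that)
  obtain B where B: "B > 0" "\<And>x. norm (\<phi> x) \<le> B"
    using bounded_continuous_compact_support[OF smooth_continuous_on[OF sm] K(1,3)] by blast
  \<comment> \<open>The shift k + 1 makes twice the top level equal to B, so that no value of
    |\<phi>| lies above the scale.\<close>
  define s where "s k = B / 2 ^ (k + 1)" for k :: nat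
  have s: "s k > 0" for k using B by (simp add: s_def)
  let ?F = "\<lambda>k. {x. s k < \<bar>\<phi> x\<bar>}"
  have [measurable]: "\<phi> \<in> borel_measurable borel" "gradient \<phi> \<in> borel_measurable borel"
    using sm by (auto intro: borel_measurable_smooth borel_measurable_gradient)
  have F: "?F k \<in> sets lebesgue" for k
    by (intro sets_completionI_sets) (simp add: borel_open open_Collect_less continuous_intros smooth_continuous_on sm)
  have Fm: "(\<lambda>x. g x * indicator (?F k) x) \<in> borel_measurable (lebesgue_on \<Omega>)" for k
  proof -
    have "(\<lambda>x. indicator (?F k) x :: ennreal) \<in> borel_measurable (lebesgue_on \<Omega>)"
      using F[of k] by (intro measurable_restrict_space1 borel_measurable_indicator)
    then show ?thesis by measurable
  qed
  have pw: "ennreal (\<bar>\<phi> x\<bar> powr p) \<le> (\<Sum>k. ennreal ((2 * s k) powr p) * indicator (?F k) x)" for x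
  proof (cases "\<phi> x = 0")
    case False
    have "(\<lambda>k. B / 2 ^ (k + 1)) \<longlonglongrightarrow> 0"
      using LIMSEQ_Suc[OF LIMSEQ_divide_realpow_zero[of 2 B]] by simp
    then have "eventually (\<lambda>k. s k < \<bar>\<phi> x\<bar>) sequentially"
      unfolding s_def using False by (intro order_tendstoD(2)) auto
    then have ex: "\<exists>k. s k < \<bar>\<phi> x\<bar>" by (auto simp: eventually_sequentially)
    \<comment> \<open>A single term of the series suffices: the first level below |\<phi> x| is at
      least half of it.\<close>
    define k where "k = (LEAST k. s k < \<bar>\<phi> x\<bar>)"
    have k: "s k < \<bar>\<phi> x\<bar>" unfolding k_def using ex by (rule LeastI_ex)
    have "\<bar>\<phi> x\<bar> \<le> 2 * s k"
    proof (cases k)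
      case 0
      then show ?thesis using B(2)[of x] by (simp add: s_def)
    next
      case (Suc j)
      then have "\<not> s j < \<bar>\<phi> x\<bar>" using not_less_Least[of j "\<lambda>k. s k < \<bar>\<phi> x\<bar>"] by (simp add: k_def)
      then show ?thesis using Suc by (simp add: s_def)
    qed
    then have "ennreal (\<bar>\<phi> x\<bar> powr p) \<le> ennreal ((2 * s k) powr p) * indicator (?F k) x"
      using k p by (auto intro!: ennreal_leI powr_mono2)
    also have "\<dots> \<le> (\<Sum>k. ennreal ((2 * s k) powr p) * indicator (?F k) x)"
    proof -
      have "h k \<le> (\<Sum>k. h k)" for h :: "nat \<Rightarrow> ennreal"
        using sum_le_suminf[of h "{k}"] by simp
      then show ?thesis .
    qed
    finally show ?thesis .
  qed simp
  have "(\<integral>\<^sup>+x. g x * ennreal (\<bar>\<phi> x\<bar> powr p) \<partial>lebesgue_on \<Omega>)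
      \<le> (\<integral>\<^sup>+x. (\<Sum>k. ennreal ((2 * s k) powr p) * (g x * indicator (?F k) x)) \<partial>lebesgue_on \<Omega>)"
  proof (rule nn_integral_mono)
    fix x
    have "g x * ennreal (\<bar>\<phi> x\<bar> powr p) \<le> g x * (\<Sum>k. ennreal ((2 * s k) powr p) * indicator (?F k) x)"
      by (intro mult_left_mono pw) simp
    also have "\<dots> = (\<Sum>k. ennreal ((2 * s k) powr p) * (g x * indicator (?F k) x))"
      by (subst ennreal_suminf_cmult[symmetric]) (simp add: mult_ac)
    finally show "g x * ennreal (\<bar>\<phi> x\<bar> powr p) \<le> (\<Sum>k. ennreal ((2 * s k) powr p) * (g x * indicator (?F k) x))" .
  qed
  also have "\<dots> = (\<Sum>k. \<integral>\<^sup>+x. ennreal ((2 * s k) powr p) * (g x * indicator (?F k) x) \<partial>lebesgue_on \<Omega>)"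
    by (intro nn_integral_suminf borel_measurable_times_ennreal[OF borel_measurable_const Fm])
  also have "\<dots> = (\<Sum>k. ennreal ((2 * s k) powr p) * (\<integral>\<^sup>+x. g x * indicator (?F k) x \<partial>lebesgue_on \<Omega>))"
    using Fm by (intro suminf_cong nn_integral_cmult)
  also have "\<dots> \<le> (\<Sum>k. ennreal ((2 * s k) powr p) * (c * dirichlet p (truncation (s k) \<phi>)))"
    by (intro suminf_le mult_left_mono superlevel_capacity phi s g) auto
  also have "\<dots> = c * (\<Sum>k. ennreal ((2 * s k) powr p) * dirichlet p (truncation (s k) \<phi>))"
    by (subst ennreal_suminf_cmult[symmetric]) (simp add: mult_ac)
  also have "(\<Sum>k. ennreal ((2 * s k) powr p) * dirichlet p (truncation (s k) \<phi>))
      = (\<Sum>k. \<integral>\<^sup>+x. ennreal ((2 * s k) powr p * \<bar>4 * (s k)\<^sup>2 * \<phi> x / ((s k)\<^sup>2 + (\<phi> x)\<^sup>2)\<^sup>2\<bar> powr p)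
        * ennreal (norm (gradient \<phi> x) powr p) \<partial>lborel)"
  proof (intro suminf_cong)
    fix k
    have "ennreal ((2 * s k) powr p) * dirichlet p (truncation (s k) \<phi>)
        = (\<integral>\<^sup>+x. ennreal ((2 * s k) powr p) * ennreal (norm (gradient (truncation (s k) \<phi>) x) powr p) \<partial>lborel)"
      unfolding dirichlet_def
      using borel_measurable_gradient[OF test_functions_smooth[OF truncation_test[OF phi s]]]
      by (intro nn_integral_cmult[symmetric]) simp
    also have "\<dots> = (\<integral>\<^sup>+x. ennreal ((2 * s k) powr p * \<bar>4 * (s k)\<^sup>2 * \<phi> x / ((s k)\<^sup>2 + (\<phi> x)\<^sup>2)\<^sup>2\<bar> powr p)
        * ennreal (norm (gradient \<phi> x) powr p) \<partial>lborel)"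
      by (rule nn_integral_cong)
        (simp only: gradient_truncation[OF phi s] norm_scaleR powr_mult
          ennreal_mult powr_ge_zero mult_nonneg_nonneg mult.assoc)
    finally show "ennreal ((2 * s k) powr p) * dirichlet p (truncation (s k) \<phi>)
        = (\<integral>\<^sup>+x. ennreal ((2 * s k) powr p * \<bar>4 * (s k)\<^sup>2 * \<phi> x / ((s k)\<^sup>2 + (\<phi> x)\<^sup>2)\<^sup>2\<bar> powr p)
        * ennreal (norm (gradient \<phi> x) powr p) \<partial>lborel)" .
  qed
  also have "\<dots> = (\<integral>\<^sup>+x. (\<Sum>k. ennreal ((2 * s k) powr p * \<bar>4 * (s k)\<^sup>2 * \<phi> x / ((s k)\<^sup>2 + (\<phi> x)\<^sup>2)\<^sup>2\<bar> powr p)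
        * ennreal (norm (gradient \<phi> x) powr p)) \<partial>lborel)"
    by (intro nn_integral_suminf[symmetric]) measurable
  also have "\<dots> \<le> (\<integral>\<^sup>+x. ennreal (6 * 8 powr p) * ennreal (norm (gradient \<phi> x) powr p) \<partial>lborel)"
  proof (rule nn_integral_mono)
    fix x
    show "(\<Sum>k. ennreal ((2 * s k) powr p * \<bar>4 * (s k)\<^sup>2 * \<phi> x / ((s k)\<^sup>2 + (\<phi> x)\<^sup>2)\<^sup>2\<bar> powr p)
        * ennreal (norm (gradient \<phi> x) powr p)) \<le> ennreal (6 * 8 powr p) * ennreal (norm (gradient \<phi> x) powr p)"
      unfolding ennreal_suminf_multc s_def by (intro mult_right_mono truncation_sum_bound B) simp
  qed
  also have "\<dots> = ennreal (6 * 8 powr p) * dirichlet p \<phi>"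
    unfolding dirichlet_def by (intro nn_integral_cmult) simp
  finally show ?thesis by (simp add: mult_left_mono)
qed

text \<open>Fatou's lemma is applied on compact sets, where approximants converge a.e., and an
  exhaustion of \<Omega> finishes by monotone convergence. The constant 16^p is 8^p from test
  functions times 2^p from the approximation.\<close>

lemma capacity_bound_D0:
  assumes u: "u \<in> D0 p \<Omega>" and g: "capacity_bound p \<Omega> g (ennreal c)" and c: "0 < c"
    and gm [measurable]: "g \<in> borel_measurable (lebesgue_on \<Omega>)"
  shows "(\<integral>\<^sup>+x. g x * ennreal (\<bar>u x\<bar> powr p) \<partial>lebesgue_on \<Omega>) \<le> ennreal (c * (6 * 16 powr p)) * energy p \<Omega> u"
proof -
  have um [measurable]: "u \<in> borel_measurable (lebesgue_on \<Omega>)"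
    using u by (rule D0_measurable)
  have local: "(\<integral>\<^sup>+x. g x * ennreal (\<bar>u x\<bar> powr p) \<partial>lebesgue_on K) \<le> ennreal (c * (6 * 16 powr p)) * energy p \<Omega> u"
    if K: "compact K" "K \<subseteq> \<Omega>" for K
  proof (rule ennreal_le_epsilon)
    fix e :: real assume e: "0 < e"
    have KL: "K \<in> sets lebesgue" using K by (simp add: borel_compact)
    have mono: "f \<in> borel_measurable (lebesgue_on \<Omega>) \<Longrightarrow> f \<in> borel_measurable (lebesgue_on K)" for f :: "'a \<Rightarrow> ennreal"
      using K(2) measurable_restrict_mono by blast
    define d where "d = e / (c * (6 * 8 powr p) + 1)"
    have d: "d > 0" "c * (6 * 8 powr p) * d \<le> e"
    proof -
      define A where "A = c * (6 * 8 powr p)"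
      have "A \<ge> 0" using c by (simp add: A_def)
      then show "d > 0" "c * (6 * 8 powr p) * d \<le> e"
        using e by (auto simp: d_def A_def[symmetric] field_simps)
    qed
    obtain \<phi> :: "nat \<Rightarrow> 'a \<Rightarrow> real" where phi: "\<And>k. \<phi> k \<in> test_functions \<Omega>"
      "AE x in lebesgue_on K. (\<lambda>k. \<phi> k x) \<longlonglongrightarrow> u x"
      "\<And>k. dirichlet p (\<phi> k) \<le> ennreal (2 powr p) * energy p \<Omega> u + ennreal d"
      by (rule D0_approximation[OF u K d(1)]) (rule that)
    have m: "(\<lambda>x. g x * ennreal (\<bar>\<phi> k x\<bar> powr p)) \<in> borel_measurable (lebesgue_on \<Omega>)" for k
    proof -
      have "\<phi> k \<in> borel_measurable (lebesgue_on \<Omega>)"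
        using borel_measurable_smooth[OF test_functions_smooth[OF phi(1)]]
        by (intro measurable_restrict_space1 measurable_completion) simp
      then show ?thesis by measurable
    qed
    have "(\<integral>\<^sup>+x. g x * ennreal (\<bar>u x\<bar> powr p) \<partial>lebesgue_on K)
        \<le> (\<integral>\<^sup>+x. liminf (\<lambda>k. g x * ennreal (\<bar>\<phi> k x\<bar> powr p)) \<partial>lebesgue_on K)"
    proof (rule nn_integral_mono_AE)
      show "AE x in lebesgue_on K. g x * ennreal (\<bar>u x\<bar> powr p) \<le> liminf (\<lambda>k. g x * ennreal (\<bar>\<phi> k x\<bar> powr p))"
        using phi(2)
      proof eventually_elim
        case (elim x)
        have lim: "(\<lambda>k. ennreal (\<bar>\<phi> k x\<bar> powr p)) \<longlonglongrightarrow> ennreal (\<bar>u x\<bar> powr p)"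
          using elim p by (intro tendsto_ennrealI tendsto_powr' tendsto_rabs tendsto_const) auto
        show ?case
        \<comment> \<open>Multiplication of \<open>ennreal\<close> is discontinuous at top times 0,
          which may occur where g is infinite; at zeros of u the left side is 0 anyway.\<close>
        proof (cases "u x = 0")
          case False
          with lim have "(\<lambda>k. g x * ennreal (\<bar>\<phi> k x\<bar> powr p)) \<longlonglongrightarrow> g x * ennreal (\<bar>u x\<bar> powr p)"
            by (intro tendsto_mult_ennreal tendsto_const) auto
          then have "liminf (\<lambda>k. g x * ennreal (\<bar>\<phi> k x\<bar> powr p)) = g x * ennreal (\<bar>u x\<bar> powr p)"
            by (intro lim_imp_Liminf) auto
          then show ?thesis by simp
        qed simp
      qed
    qed
    also have "\<dots> \<le> liminf (\<lambda>k. \<integral>\<^sup>+x. g x * ennreal (\<bar>\<phi> k x\<bar> powr p) \<partial>lebesgue_on K)"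
      by (intro nn_integral_liminf mono m)
    also have "\<dots> \<le> liminf (\<lambda>k. ennreal (c * (6 * 16 powr p)) * energy p \<Omega> u + ennreal e)"
    proof (intro Liminf_mono always_eventually allI)
      fix k
      have "(\<integral>\<^sup>+x. g x * ennreal (\<bar>\<phi> k x\<bar> powr p) \<partial>lebesgue_on K) \<le> (\<integral>\<^sup>+x. g x * ennreal (\<bar>\<phi> k x\<bar> powr p) \<partial>lebesgue_on \<Omega>)"
        unfolding nn_integral_lebesgue_on_subset[OF KL \<Omega>_sets K(2)]
        by (intro nn_integral_mono) (auto simp: indicator_def)
      also have "\<dots> \<le> ennreal c * (ennreal (6 * 8 powr p) * dirichlet p (\<phi> k))"
        by (rule capacity_bound_test_function[OF phi(1) g gm])
      also have "\<dots> \<le> ennreal c * (ennreal (6 * 8 powr p) * (ennreal (2 powr p) * energy p \<Omega> u + ennreal d))"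
        by (intro mult_left_mono phi) auto
      also have "\<dots> = ennreal (c * (6 * (8 * 2) powr p)) * energy p \<Omega> u + ennreal (c * (6 * 8 powr p) * d)"
        using c d by (subst powr_mult) (auto simp: distrib_left ennreal_mult mult_ac)
      also have "\<dots> \<le> ennreal (c * (6 * 16 powr p)) * energy p \<Omega> u + ennreal e"
        using d by (intro add_mono ennreal_leI) auto
      finally show "(\<integral>\<^sup>+x. g x * ennreal (\<bar>\<phi> k x\<bar> powr p) \<partial>lebesgue_on K) \<le> \<dots>" .
    qed
    also have "\<dots> = ennreal (c * (6 * 16 powr p)) * energy p \<Omega> u + ennreal e"
      by (simp add: Liminf_const)
    finally show "(\<integral>\<^sup>+x. g x * ennreal (\<bar>u x\<bar> powr p) \<partial>lebesgue_on K) \<le> \<dots>" .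
  qed
  obtain C :: "nat \<Rightarrow> 'a set" where C: "\<And>n. compact (C n)" "\<And>n. C n \<subseteq> \<Omega>" "\<And>n. C n \<subseteq> interior (C (Suc n))" "\<Union>(range C) = \<Omega>"
    using open_Union_compact_subsets[OF op] by metis
  have incC: "incseq C"
    using C(3) interior_subset by (intro incseq_SucI) blast
  have CL: "C n \<in> sets lebesgue" for n using C(1) by (simp add: borel_compact)
  let ?h = "\<lambda>n x. g x * ennreal (\<bar>u x\<bar> powr p) * indicator (C n) x"
  have "(\<integral>\<^sup>+x. g x * ennreal (\<bar>u x\<bar> powr p) \<partial>lebesgue_on \<Omega>) = (\<integral>\<^sup>+x. (SUP n. ?h n x) \<partial>lebesgue_on \<Omega>)"
  proof (rule nn_integral_cong)
    fix x assume "x \<in> space (lebesgue_on \<Omega>)"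
    then have "x \<in> \<Union>(range C)" using C(4) by simp
    then obtain n where n: "x \<in> C n" by blast
    show "g x * ennreal (\<bar>u x\<bar> powr p) = (SUP n. ?h n x)"
      using n by (intro antisym SUP_least SUP_upper2[of n]) (auto simp: indicator_def)
  qed
  also have "\<dots> = (SUP n. integral\<^sup>N (lebesgue_on \<Omega>) (?h n))"
  proof (rule nn_integral_monotone_convergence_SUP)
    show "incseq ?h"
      using incC by (auto simp: incseq_def le_fun_def indicator_def subset_iff intro!: mult_left_mono)
    show "?h n \<in> borel_measurable (lebesgue_on \<Omega>)" for n
    proof -
      have "(\<lambda>x. indicator (C n) x :: ennreal) \<in> borel_measurable (lebesgue_on \<Omega>)"
        using CL[of n] by (intro measurable_restrict_space1 borel_measurable_indicator)
      then show ?thesis by measurable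
    qed
  qed
  also have "\<dots> \<le> ennreal (c * (6 * 16 powr p)) * energy p \<Omega> u"
    using local[OF C(1,2)] unfolding nn_integral_lebesgue_on_subset[OF CL \<Omega>_sets C(2)]
    by (intro SUP_least)
  finally show ?thesis .
qed

text \<open>Capacity admits competitors from \<open>D0\<close>, whereas the hypothesis speaks of
  test functions. Where u >= 1 the approximants eventually exceed 1/2, so their doubles are tested
  and Fatou's lemma passes to the limit; doubling and approximation each cost 2^p, together
  4^p.\<close>

lemma capacity_boundI:
  assumes gm [measurable]: "g \<in> borel_measurable (lebesgue_on \<Omega>)" and c: "0 < c"
    and bound: "\<And>\<phi>. \<phi> \<in> test_functions \<Omega> \<Longrightarrow>
      (\<integral>\<^sup>+x. g x * indicator {x. 1 \<le> \<bar>\<phi> x\<bar>} x \<partial>lebesgue_on \<Omega>) \<le> ennreal c * dirichlet p \<phi>"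
  shows "capacity_bound p \<Omega> g (ennreal (c * 4 powr p))"
  unfolding capacity_bound_def
proof (intro allI impI)
  fix F assume F: "F \<in> sets lebesgue" "relatively_compact_in F \<Omega>"
  let ?K = "closure F"
  have K: "compact ?K" "?K \<subseteq> \<Omega>" using F by (auto simp: relatively_compact_in_def)
  have KL: "?K \<in> sets lebesgue" using K by (simp add: borel_compact)
  have FK: "F \<subseteq> ?K" by (rule closure_subset)
  have mono: "f \<in> borel_measurable (lebesgue_on \<Omega>) \<Longrightarrow> f \<in> borel_measurable (lebesgue_on ?K)" for f :: "'a \<Rightarrow> ennreal"
    using K(2) measurable_restrict_mono by blast
  have main: "(\<integral>\<^sup>+x. g x \<partial>lebesgue_on F) \<le> ennreal (c * 4 powr p) * energy p \<Omega> u"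
    if u: "u \<in> D0 p \<Omega>" and U: "open U" "F \<subseteq> U" "U \<subseteq> \<Omega>" "AE x in lebesgue_on U. 1 \<le> u x" for u U
  proof (rule ennreal_le_epsilon)
    fix e :: real assume e: "0 < e"
    define d where "d = e / (c * 2 powr p)"
    have d: "d > 0" "c * 2 powr p * d = e" using e c by (auto simp: d_def)
    obtain \<phi> :: "nat \<Rightarrow> 'a \<Rightarrow> real" where phi: "\<And>k. \<phi> k \<in> test_functions \<Omega>"
      "AE x in lebesgue_on ?K. (\<lambda>k. \<phi> k x) \<longlonglongrightarrow> u x"
      "\<And>k. dirichlet p (\<phi> k) \<le> ennreal (2 powr p) * energy p \<Omega> u + ennreal d"
      by (rule D0_approximation[OF u K d(1)]) (rule that)
    let ?S = "\<lambda>k. {x. 1 \<le> \<bar>2 * \<phi> k x\<bar>}"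
    have S: "?S k \<in> sets lebesgue" for k
      by (intro sets_completionI_sets)
        (simp add: borel_closed closed_Collect_le continuous_intros smooth_continuous_on test_functions_smooth[OF phi(1)])
    have m: "(\<lambda>x. g x * indicator (?S k) x) \<in> borel_measurable (lebesgue_on \<Omega>)" for k
    proof -
      have "(\<lambda>x. indicator (?S k) x :: ennreal) \<in> borel_measurable (lebesgue_on \<Omega>)"
        using S[of k] by (intro measurable_restrict_space1 borel_measurable_indicator)
      then show ?thesis by measurable
    qed
    have "AE x in lebesgue. x \<in> ?K \<longrightarrow> (\<lambda>k. \<phi> k x) \<longlonglongrightarrow> u x"
      using phi(2) by (simp add: AE_lebesgue_on_iff[OF KL])
    moreover have "AE x in lebesgue. x \<in> U \<longrightarrow> 1 \<le> u x"
      using U(4) AE_lebesgue_on_iff[of U] U(1) by (simp add: borel_open)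
    ultimately have "AE x in lebesgue. x \<in> ?K \<longrightarrow> g x * indicator F x \<le> liminf (\<lambda>k. g x * indicator (?S k) x)"
    proof eventually_elim
      case (elim x)
      show ?case
      proof (intro impI, cases "x \<in> F")
        assume x: "x \<in> ?K"
        case True
        then have "u x \<ge> 1" using elim U(2) by auto
        then have "eventually (\<lambda>k. 1 / 2 < \<phi> k x) sequentially"
          using elim x by (intro order_tendstoD(1)[of _ "u x"]) auto
        then have "eventually (\<lambda>k. g x * indicator (?S k) x = g x) sequentially"
          by eventually_elim (auto simp: indicator_def)
        then have "(\<lambda>k. g x * indicator (?S k) x) \<longlonglongrightarrow> g x"
          by (rule tendsto_eventually)
        then have "liminf (\<lambda>k. g x * indicator (?S k) x) = g x"
          by (intro lim_imp_Liminf) auto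
        then show "g x * indicator F x \<le> liminf (\<lambda>k. g x * indicator (?S k) x)" using True by simp
      qed simp
    qed
    then have "(\<integral>\<^sup>+x. g x * indicator F x \<partial>lebesgue_on ?K) \<le> (\<integral>\<^sup>+x. liminf (\<lambda>k. g x * indicator (?S k) x) \<partial>lebesgue_on ?K)"
      by (intro nn_integral_mono_AE) (simp add: AE_lebesgue_on_iff[OF KL])
    also have "\<dots> \<le> liminf (\<lambda>k. \<integral>\<^sup>+x. g x * indicator (?S k) x \<partial>lebesgue_on ?K)"
      by (intro nn_integral_liminf mono m)
    also have "\<dots> \<le> liminf (\<lambda>k. ennreal (c * 4 powr p) * energy p \<Omega> u + ennreal e)"
    proof (intro Liminf_mono always_eventually allI)
      fix k
      have "(\<integral>\<^sup>+x. g x * indicator (?S k) x \<partial>lebesgue_on ?K) \<le> (\<integral>\<^sup>+x. g x * indicator (?S k) x \<partial>lebesgue_on \<Omega>)"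
        unfolding nn_integral_lebesgue_on_subset[OF KL \<Omega>_sets K(2)]
        by (intro nn_integral_mono) (auto simp: indicator_def)
      also have "\<dots> \<le> ennreal c * dirichlet p (\<lambda>x. 2 * \<phi> k x)"
        by (intro bound test_functions_mult phi) simp
      also have "\<dots> = ennreal c * (ennreal (2 powr p) * dirichlet p (\<phi> k))"
        by (simp add: dirichlet_cmult[OF phi(1)])
      also have "\<dots> \<le> ennreal c * (ennreal (2 powr p) * (ennreal (2 powr p) * energy p \<Omega> u + ennreal d))"
        by (intro mult_left_mono phi) auto
      also have "\<dots> = ennreal (c * (2 * 2) powr p) * energy p \<Omega> u + ennreal (c * 2 powr p * d)"
        using c d(1) by (subst powr_mult) (auto simp: distrib_left ennreal_mult mult_ac)
      finally show "(\<integral>\<^sup>+x. g x * indicator (?S k) x \<partial>lebesgue_on ?K) \<le> ennreal (c * 4 powr p) * energy p \<Omega> u + ennreal e"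
        using d(2) by simp
    qed
    also have "\<dots> = ennreal (c * 4 powr p) * energy p \<Omega> u + ennreal e"
      by (simp add: Liminf_const)
    also have "(\<integral>\<^sup>+x. g x * indicator F x \<partial>lebesgue_on ?K) = (\<integral>\<^sup>+x. g x \<partial>lebesgue_on F)"
      by (rule nn_integral_lebesgue_on_subset[OF F(1) KL FK, symmetric])
    finally show "(\<integral>\<^sup>+x. g x \<partial>lebesgue_on F) \<le> ennreal (c * 4 powr p) * energy p \<Omega> u + ennreal e" .
  qed
  have c4: "ennreal (c * 4 powr p) \<noteq> 0" "ennreal (c * 4 powr p) \<noteq> top"
    using c by (auto simp: ennreal_eq_0_iff not_le)
  have "(\<integral>\<^sup>+x. g x \<partial>lebesgue_on F) / ennreal (c * 4 powr p) \<le> Cap p F \<Omega>"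
    unfolding Cap_def
  proof (rule Inf_greatest)
    fix y assume "y \<in> {energy p \<Omega> u |u. u \<in> D0 p \<Omega> \<and> (\<exists>U. open U \<and> F \<subseteq> U \<and> U \<subseteq> \<Omega> \<and> (AE x in lebesgue_on U. 1 \<le> u x))}"
    then show "(\<integral>\<^sup>+x. g x \<partial>lebesgue_on F) / ennreal (c * 4 powr p) \<le> y"
      using main c4 by (auto intro!: divide_le_posI_ennreal simp: zero_less_iff_neq_zero)
  qed
  then have "(\<integral>\<^sup>+x. g x \<partial>lebesgue_on F) / ennreal (c * 4 powr p) * ennreal (c * 4 powr p) \<le> Cap p F \<Omega> * ennreal (c * 4 powr p)"
    by (rule mult_right_mono) simp
  then show "(\<integral>\<^sup>+x. g x \<partial>lebesgue_on F) \<le> ennreal (c * 4 powr p) * Cap p F \<Omega>"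
    using c4 ennreal_divide_self[of "ennreal (c * 4 powr p)"]
    unfolding ennreal_divide_times by (simp add: mult.commute)
qed

end

section \<open>The space \<open>\<E>(\<Omega>)\<close>\<close>

lemma eabs_ereal [simp]: "eabs (ereal r) = ennreal \<bar>r\<bar>"
  by (simp add: eabs_def)

lemma eabs_mult: "eabs (x * y) = eabs x * eabs y"
proof -
  have "enn2ereal (e2ennreal (\<bar>x\<bar> * \<bar>y\<bar>)) = enn2ereal (e2ennreal \<bar>x\<bar> * e2ennreal \<bar>y\<bar>)"
    by (simp add: enn2ereal_e2ennreal times_ennreal.rep_eq)
  moreover have "\<bar>x * y\<bar> = \<bar>x\<bar> * \<bar>y\<bar>"
    by (cases x; cases y) (auto simp: abs_mult)
  ultimately show ?thesis
    by (simp add: eabs_def enn2ereal_inject)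
qed

lemma eabs_add_le: "eabs (x + y) \<le> eabs x + eabs y"
proof -
  have "enn2ereal (e2ennreal \<bar>x + y\<bar>) \<le> enn2ereal (e2ennreal \<bar>x\<bar> + e2ennreal \<bar>y\<bar>)"
    by (cases x; cases y) (simp_all add: enn2ereal_e2ennreal plus_ennreal.rep_eq)
  then show ?thesis
    by (simp add: eabs_def less_eq_ennreal.rep_eq)
qed

lemma eabs_eq_top_iff [simp]: "eabs x = top \<longleftrightarrow> \<bar>x\<bar> = \<infinity>"
  by (cases x) (simp_all add: eabs_def)

lemma eabs_enn2ereal [simp]: "eabs (enn2ereal x) = x"
  by (simp add: eabs_def)

lemma borel_measurable_eabs [measurable]:
  assumes "f \<in> borel_measurable M"
  shows "(\<lambda>x. eabs (f x)) \<in> borel_measurable M"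
  unfolding eabs_def using assms by measurable

lemma epowr_ennreal [simp]: "0 \<le> r \<Longrightarrow> epowr (ennreal r) q = ennreal (r powr q)"
  by (simp add: epowr_def)

lemma epowr_eq_top_iff [simp]: "epowr x q = top \<longleftrightarrow> x = top"
  by (simp add: epowr_def)

lemma epowr_mono:
  assumes "x \<le> y" "0 \<le> q"
  shows "epowr x q \<le> epowr y q"
proof (cases "y = top")
  case False
  then obtain b a where "y = ennreal b" "0 \<le> b" "x = ennreal a" "0 \<le> a"
    using assms(1) by (metis ennreal_cases neq_top_trans)
  then show ?thesis
    using assms by (simp add: powr_mono2 ennreal_leI)
qed (simp add: epowr_def)

lemma epowr_add_le:
  assumes "0 \<le> q"
  shows "epowr (x + y) q \<le> ennreal (2 powr q) * (epowr x q + epowr y q)"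
proof (cases "x = top \<or> y = top")
  case True
  then show ?thesis by (auto simp: epowr_def ennreal_mult_top)
next
  case False
  then obtain a b where *: "x = ennreal a" "0 \<le> a" "y = ennreal b" "0 \<le> b"
    by (metis ennreal_cases)
  then show ?thesis
    using powr_add_le[of a b q] assms
    by (simp add: ennreal_plus[symmetric] ennreal_mult[symmetric] ennreal_leI del: ennreal_plus)
qed

lemma epowr_cmult:
  assumes "0 \<le> c"
  shows "epowr (ennreal c * x) q \<le> ennreal (c powr q) * epowr x q"
proof (cases "x = top")
  case True
  then show ?thesis using assms by (auto simp: epowr_def ennreal_mult_top ennreal_eq_0_iff)
next
  case False
  then obtain a where "x = ennreal a" "0 \<le> a" by (metis ennreal_cases)
  then show ?thesis using assms by (simp add: ennreal_mult[symmetric] powr_mult)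
qed

lemma borel_measurable_epowr [measurable]:
  assumes [measurable]: "f \<in> borel_measurable M"
  shows "(\<lambda>x. epowr (f x) q) \<in> borel_measurable M"
  unfolding epowr_def by measurable

lemma abs_power_in_M_space:
  assumes "u \<in> M_space \<Omega>"
  shows "abs_power p u \<in> M_space \<Omega>"
proof -
  have [measurable]: "u \<in> borel_measurable (lebesgue_on \<Omega>)" and fin: "AE x in lebesgue_on \<Omega>. \<bar>u x\<bar> \<noteq> \<infinity>"
    using assms by (auto simp: M_space_def)
  have "abs_power p u \<in> borel_measurable (lebesgue_on \<Omega>)"
    unfolding abs_power_def by measurable
  moreover have "\<bar>abs_power p u x\<bar> \<noteq> \<infinity>" if "\<bar>u x\<bar> \<noteq> \<infinity>" for x
    using that by (metis abs_power_def eabs_enn2ereal eabs_eq_top_iff epowr_eq_top_iff)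
  then have "AE x in lebesgue_on \<Omega>. \<bar>abs_power p u x\<bar> \<noteq> \<infinity>"
    using fin by (rule eventually_mono[rotated])
  ultimately show ?thesis by (simp add: M_space_def)
qed

lemma E_space_iff:
  "u \<in> E_space p \<Omega> \<longleftrightarrow> u \<in> M_space \<Omega> \<and> assoc_norm p \<Omega> (abs_power p u) < \<infinity>"
  using abs_power_in_M_space by (auto simp: E_space_def H_assoc_def)

lemma assoc_norm_abs_power:
  "assoc_norm p \<Omega> (abs_power p u) =
    Sup {\<integral>\<^sup>+x. eabs (f x) * epowr (eabs (u x)) p \<partial>lebesgue_on \<Omega> | f. f \<in> H_space p \<Omega> \<and> H_norm p \<Omega> f \<le> 1}"
  by (simp add: assoc_norm_def eabs_mult abs_power_def)

lemma assoc_norm_abs_power_leI: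
  assumes "\<And>f. f \<in> H_space p \<Omega> \<Longrightarrow> H_norm p \<Omega> f \<le> 1 \<Longrightarrow>
    (\<integral>\<^sup>+x. eabs (f x) * epowr (eabs (u x)) p \<partial>lebesgue_on \<Omega>) \<le> C"
  shows "assoc_norm p \<Omega> (abs_power p u) \<le> C"
  unfolding assoc_norm_abs_power using assms by (intro Sup_least) auto

lemma le_assoc_norm_abs_power:
  assumes "f \<in> H_space p \<Omega>" "H_norm p \<Omega> f \<le> 1"
  shows "(\<integral>\<^sup>+x. eabs (f x) * epowr (eabs (u x)) p \<partial>lebesgue_on \<Omega>) \<le> assoc_norm p \<Omega> (abs_power p u)"
  unfolding assoc_norm_abs_power using assms by (intro Sup_upper) auto

lemma M_spaceD:
  assumes "u \<in> M_space \<Omega>"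
  shows "u \<in> borel_measurable (lebesgue_on \<Omega>)" "AE x in lebesgue_on \<Omega>. \<bar>u x\<bar> \<noteq> \<infinity>"
  using assms by (auto simp: M_space_def)

lemma H_space_measurable: "f \<in> H_space p \<Omega> \<Longrightarrow> f \<in> borel_measurable (lebesgue_on \<Omega>)"
  by (simp add: H_space_def L1_loc_def M_space_def)

text \<open>Closure under sums asks for finiteness only, so the inequality |u + v|^p <= 2^p (|u|^p +
  |v|^p) under each integral takes the place of a triangle inequality for the norm.\<close>

lemma linear_function_space_E_space:
  assumes p: "1 < p"
  shows "linear_function_space (E_space p \<Omega>)"
  unfolding linear_function_space_def
proof (intro conjI ballI allI)
  have "assoc_norm p \<Omega> (abs_power p (\<lambda>x. 0)) \<le> 0"
    using epowr_ennreal[of 0 p] by (intro assoc_norm_abs_power_leI) (simp add: zero_ereal_def)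
  then show "(\<lambda>x. 0) \<in> E_space p \<Omega>"
    by (simp add: E_space_iff M_space_def)
next
  fix u v assume u: "u \<in> E_space p \<Omega>" and v: "v \<in> E_space p \<Omega>"
  note um = M_spaceD[of u \<Omega>] and vm = M_spaceD[of v \<Omega>]
  have [measurable]: "u \<in> borel_measurable (lebesgue_on \<Omega>)" "v \<in> borel_measurable (lebesgue_on \<Omega>)"
    using u v by (auto simp: E_space_iff um vm)
  have "AE x in lebesgue_on \<Omega>. \<bar>u x\<bar> \<noteq> \<infinity>" "AE x in lebesgue_on \<Omega>. \<bar>v x\<bar> \<noteq> \<infinity>"
    using u v by (auto simp: E_space_iff um vm)
  then have "AE x in lebesgue_on \<Omega>. \<bar>u x + v x\<bar> \<noteq> \<infinity>"
    by eventually_elim auto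
  then have "(\<lambda>x. u x + v x) \<in> M_space \<Omega>"
    by (simp add: M_space_def)
  moreover have "assoc_norm p \<Omega> (abs_power p (\<lambda>x. u x + v x)) \<le>
      ennreal (2 powr p) * (assoc_norm p \<Omega> (abs_power p u) + assoc_norm p \<Omega> (abs_power p v))"
  proof (rule assoc_norm_abs_power_leI)
    fix f assume f: "f \<in> H_space p \<Omega>" "H_norm p \<Omega> f \<le> 1"
    have [measurable]: "f \<in> borel_measurable (lebesgue_on \<Omega>)" using f(1) by (rule H_space_measurable)
    have "(\<integral>\<^sup>+x. eabs (f x) * epowr (eabs (u x + v x)) p \<partial>lebesgue_on \<Omega>) \<le>
        (\<integral>\<^sup>+x. ennreal (2 powr p) * (eabs (f x) * epowr (eabs (u x)) p + eabs (f x) * epowr (eabs (v x)) p) \<partial>lebesgue_on \<Omega>)"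
    proof (rule nn_integral_mono)
      fix x
      have "epowr (eabs (u x + v x)) p \<le> ennreal (2 powr p) * (epowr (eabs (u x)) p + epowr (eabs (v x)) p)"
        using p by (intro order_trans[OF epowr_mono[OF eabs_add_le] epowr_add_le]) auto
      then have "eabs (f x) * epowr (eabs (u x + v x)) p \<le>
          eabs (f x) * (ennreal (2 powr p) * (epowr (eabs (u x)) p + epowr (eabs (v x)) p))"
        by (rule mult_left_mono) simp
      then show "eabs (f x) * epowr (eabs (u x + v x)) p \<le>
          ennreal (2 powr p) * (eabs (f x) * epowr (eabs (u x)) p + eabs (f x) * epowr (eabs (v x)) p)"
        by (simp add: distrib_left mult_ac)
    qed
    also have "\<dots> = ennreal (2 powr p) * ((\<integral>\<^sup>+x. eabs (f x) * epowr (eabs (u x)) p \<partial>lebesgue_on \<Omega>)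
        + (\<integral>\<^sup>+x. eabs (f x) * epowr (eabs (v x)) p \<partial>lebesgue_on \<Omega>))"
      by (simp add: nn_integral_cmult nn_integral_add)
    also have "\<dots> \<le> ennreal (2 powr p) * (assoc_norm p \<Omega> (abs_power p u) + assoc_norm p \<Omega> (abs_power p v))"
      by (intro mult_left_mono add_mono le_assoc_norm_abs_power f) simp
    finally show "(\<integral>\<^sup>+x. eabs (f x) * epowr (eabs (u x + v x)) p \<partial>lebesgue_on \<Omega>) \<le> \<dots>" .
  qed
  ultimately show "(\<lambda>x. u x + v x) \<in> E_space p \<Omega>"
    using u v by (auto simp: E_space_iff ennreal_mult_less_top elim!: le_less_trans)
next
  fix c :: real and u assume u: "u \<in> E_space p \<Omega>"
  have [measurable]: "u \<in> borel_measurable (lebesgue_on \<Omega>)" and fin: "AE x in lebesgue_on \<Omega>. \<bar>u x\<bar> \<noteq> \<infinity>"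
    using u M_spaceD[of u \<Omega>] by (auto simp: E_space_iff)
  have "AE x in lebesgue_on \<Omega>. \<bar>ereal c * u x\<bar> \<noteq> \<infinity>"
    using fin by eventually_elim auto
  then have "(\<lambda>x. ereal c * u x) \<in> M_space \<Omega>"
    by (simp add: M_space_def)
  moreover have "assoc_norm p \<Omega> (abs_power p (\<lambda>x. ereal c * u x)) \<le> ennreal (\<bar>c\<bar> powr p) * assoc_norm p \<Omega> (abs_power p u)"
  proof (rule assoc_norm_abs_power_leI)
    fix f assume f: "f \<in> H_space p \<Omega>" "H_norm p \<Omega> f \<le> 1"
    have [measurable]: "f \<in> borel_measurable (lebesgue_on \<Omega>)" using f(1) by (rule H_space_measurable)
    have "(\<integral>\<^sup>+x. eabs (f x) * epowr (eabs (ereal c * u x)) p \<partial>lebesgue_on \<Omega>) \<le>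
        (\<integral>\<^sup>+x. ennreal (\<bar>c\<bar> powr p) * (eabs (f x) * epowr (eabs (u x)) p) \<partial>lebesgue_on \<Omega>)"
    proof (rule nn_integral_mono)
      fix x
      have "eabs (f x) * epowr (ennreal \<bar>c\<bar> * eabs (u x)) p \<le> eabs (f x) * (ennreal (\<bar>c\<bar> powr p) * epowr (eabs (u x)) p)"
        by (intro mult_left_mono epowr_cmult) auto
      then show "eabs (f x) * epowr (eabs (ereal c * u x)) p \<le> ennreal (\<bar>c\<bar> powr p) * (eabs (f x) * epowr (eabs (u x)) p)"
        by (simp add: eabs_mult mult_ac)
    qed
    also have "\<dots> = ennreal (\<bar>c\<bar> powr p) * (\<integral>\<^sup>+x. eabs (f x) * epowr (eabs (u x)) p \<partial>lebesgue_on \<Omega>)"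
      by (simp add: nn_integral_cmult)
    also have "\<dots> \<le> ennreal (\<bar>c\<bar> powr p) * assoc_norm p \<Omega> (abs_power p u)"
      by (intro mult_left_mono le_assoc_norm_abs_power f) simp
    finally show "(\<integral>\<^sup>+x. eabs (f x) * epowr (eabs (ereal c * u x)) p \<partial>lebesgue_on \<Omega>) \<le> \<dots>" .
  qed
  ultimately show "(\<lambda>x. ereal c * u x) \<in> E_space p \<Omega>"
    using u by (auto simp: E_space_iff ennreal_mult_less_top elim!: le_less_trans)
qed

section \<open>Passing between \<open>H_norm\<close> and capacity bounds; the embedding (a)\<close>

lemma capacity_bound_if_H_norm_le:
  assumes "H_norm p \<Omega> f \<le> ennreal c" "0 < c"
  shows "capacity_bound p \<Omega> (\<lambda>x. eabs (f x)) (ennreal c)"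
  unfolding capacity_bound_def
proof (intro allI impI)
  fix F :: "'a set" assume F: "F \<in> sets lebesgue" "relatively_compact_in F \<Omega>" "emeasure lebesgue F \<noteq> 0"
  let ?a = "\<integral>\<^sup>+x. eabs (f x) \<partial>lebesgue_on F"
  have "?a / Cap p F \<Omega> \<le> H_norm p \<Omega> f"
    unfolding H_norm_def using F by (intro Sup_upper) auto
  also have "\<dots> \<le> ennreal c" by fact
  finally have le: "?a / Cap p F \<Omega> \<le> ennreal c" .
  show "?a \<le> ennreal c * Cap p F \<Omega>"
  \<comment> \<open>Capacity 0 forces a vanishing integral, since a nonzero numerator over 0 is
    infinite; infinite capacity makes the right side infinite because c > 0.\<close>
  proof (cases "Cap p F \<Omega> = 0 \<or> Cap p F \<Omega> = top")
    case True
    then show ?thesis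
      using le assms(2) by (auto simp: ennreal_mult_top top_unique split: if_splits)
  next
    case False
    then have "?a = ?a / Cap p F \<Omega> * Cap p F \<Omega>"
      by (simp add: ennreal_divide_times less_top)
    also have "\<dots> \<le> ennreal c * Cap p F \<Omega>"
      using le by (intro mult_right_mono) auto
    finally show ?thesis .
  qed
qed

lemma H_norm_le_if_capacity_bound:
  assumes "capacity_bound p \<Omega> (\<lambda>x. eabs (f x)) c"
  shows "H_norm p \<Omega> f \<le> c"
  unfolding H_norm_def
proof (rule Sup_least)
  fix y assume "y \<in> {(\<integral>\<^sup>+x. eabs (f x) \<partial>lebesgue_on F) / Cap p F \<Omega> | F.
      F \<in> sets lebesgue \<and> relatively_compact_in F \<Omega> \<and> emeasure lebesgue F \<noteq> 0}"
  then obtain F where y: "y = (\<integral>\<^sup>+x. eabs (f x) \<partial>lebesgue_on F) / Cap p F \<Omega>"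
    and F: "F \<in> sets lebesgue" "relatively_compact_in F \<Omega>" "emeasure lebesgue F \<noteq> 0" by auto
  have le: "(\<integral>\<^sup>+x. eabs (f x) \<partial>lebesgue_on F) \<le> c * Cap p F \<Omega>"
    using assms F unfolding capacity_bound_def by blast
  show "y \<le> c"
  \<comment> \<open>At capacity 0 the bound forces the numerator to be 0, and 0/0 is 0 in
    \<open>ennreal\<close>.\<close>
  proof (cases "Cap p F \<Omega> = 0")
    case True
    then show ?thesis using le by (simp add: y)
  next
    case False
    then show ?thesis
      unfolding y using le by (intro divide_le_posI_ennreal) (auto simp: zero_less_iff_neq_zero mult.commute)
  qed
qed

text \<open>Every weight in the unit ball of \<open>H_space\<close> has capacity bound 1, so
  \<open>capacity_bound_D0\<close> with c = 1 bounds the whole supremum by 6 * 16^p times the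
  energy.\<close>

lemma D0_subset_E_space:
  fixes \<Omega> :: "'a::euclidean_space set"
  assumes op: "open \<Omega>" and p: "1 < p" and u: "u \<in> D0 p \<Omega>"
  shows "(\<lambda>x. ereal (u x)) \<in> E_space p \<Omega>"
    and "E_norm p \<Omega> (\<lambda>x. ereal (u x)) \<le> (6 * 16 powr p) powr (1 / p) * D0_norm p \<Omega> u"
proof -
  let ?u = "\<lambda>x. ereal (u x)"
  have um [measurable]: "u \<in> borel_measurable (lebesgue_on \<Omega>)"
    using D0_measurable[OF op p u] .
  have le: "assoc_norm p \<Omega> (abs_power p ?u) \<le> ennreal (6 * 16 powr p) * energy p \<Omega> u"
  proof (rule assoc_norm_abs_power_leI)
    fix f assume f: "f \<in> H_space p \<Omega>" "H_norm p \<Omega> f \<le> 1"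
    have fm: "(\<lambda>x. eabs (f x)) \<in> borel_measurable (lebesgue_on \<Omega>)"
      using H_space_measurable[OF f(1)] by measurable
    have "capacity_bound p \<Omega> (\<lambda>x. eabs (f x)) (ennreal 1)"
      using f(2) by (intro capacity_bound_if_H_norm_le) auto
    from capacity_bound_D0[OF op p u this _ fm]
    show "(\<integral>\<^sup>+x. eabs (f x) * epowr (eabs (?u x)) p \<partial>lebesgue_on \<Omega>) \<le> ennreal (6 * 16 powr p) * energy p \<Omega> u"
      by simp
  qed
  have fin: "energy p \<Omega> u < \<infinity>" by (rule energy_D0_finite[OF op p u])
  have "?u \<in> M_space \<Omega>" by (simp add: M_space_def)
  then show "?u \<in> E_space p \<Omega>"
    using le fin by (auto simp: E_space_iff ennreal_mult_less_top elim!: le_less_trans)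
  \<comment> \<open>\<open>enn2real\<close> sends infinity to 0, so its monotonicity needs the
    energy to be finite.\<close>
  have "enn2real (assoc_norm p \<Omega> (abs_power p ?u)) \<le> enn2real (ennreal (6 * 16 powr p) * energy p \<Omega> u)"
    using le fin by (intro enn2real_mono) (auto simp: ennreal_mult_less_top)
  also have "\<dots> = (6 * 16 powr p) * enn2real (energy p \<Omega> u)"
    by (simp add: enn2real_mult)
  finally have "E_norm p \<Omega> ?u \<le> ((6 * 16 powr p) * enn2real (energy p \<Omega> u)) powr (1 / p)"
    unfolding E_norm_def using p by (intro powr_mono2) auto
  then show "E_norm p \<Omega> ?u \<le> (6 * 16 powr p) powr (1 / p) * D0_norm p \<Omega> u"
    unfolding D0_norm_def by (subst (asm) powr_mult)
qed

text \<open>Dividing h by c 4^p puts it into the unit ball, where \<open>assoc_norm\<close> may test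
  it. Membership in \<open>H_space\<close> demands the Hardy inequality on \<open>D0\<close>, which
  Maz'ya's argument recovers from the capacity bound.\<close>

lemma E_space_pairing:
  fixes \<Omega> :: "'a::euclidean_space set"
  assumes op: "open \<Omega>" and p: "1 < p" and c: "0 < c"
    and h: "h \<in> borel_measurable (lebesgue_on \<Omega>)" "\<And>x. 0 \<le> h x"
    and loc: "\<And>K. compact K \<Longrightarrow> K \<subseteq> \<Omega> \<Longrightarrow> (\<integral>\<^sup>+x. ennreal (h x) \<partial>lebesgue_on K) < \<infinity>"
    and bound: "\<And>\<phi>. \<phi> \<in> test_functions \<Omega> \<Longrightarrow>
      (\<integral>\<^sup>+x. ennreal (h x) * indicator {x. 1 \<le> \<bar>\<phi> x\<bar>} x \<partial>lebesgue_on \<Omega>) \<le> ennreal c * dirichlet p \<phi>"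
    and um: "u \<in> borel_measurable (lebesgue_on \<Omega>)"
  shows "(\<integral>\<^sup>+x. ennreal (h x) * epowr (eabs (u x)) p \<partial>lebesgue_on \<Omega>)
    \<le> ennreal (c * 4 powr p) * assoc_norm p \<Omega> (abs_power p u)"
proof -
  note [measurable] = h(1) um
  let ?c = "c * 4 powr p"
  let ?f = "\<lambda>x. ereal (h x / ?c)"
  have c4: "?c > 0" using c by simp
  have ef: "eabs (?f x) = ennreal (1 / ?c) * ennreal (h x)" for x
    using h(2)[of x] c4 by (subst ennreal_mult[symmetric]) (auto simp: abs_div)
  have cb: "capacity_bound p \<Omega> (\<lambda>x. ennreal (h x)) (ennreal ?c)"
    by (rule capacity_boundI[OF op p _ c bound]) simp
  have scaled: "(\<integral>\<^sup>+x. eabs (?f x) \<partial>lebesgue_on F) = ennreal (1 / ?c) * (\<integral>\<^sup>+x. ennreal (h x) \<partial>lebesgue_on F)"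
    if "F \<subseteq> \<Omega>" for F
  proof -
    have "h \<in> borel_measurable (lebesgue_on F)"
      using that h(1) measurable_restrict_mono by blast
    then show ?thesis unfolding ef by (intro nn_integral_cmult) simp
  qed
  have "capacity_bound p \<Omega> (\<lambda>x. eabs (?f x)) 1"
    unfolding capacity_bound_def
  proof (intro allI impI)
    fix F :: "'a set" assume F: "F \<in> sets lebesgue" "relatively_compact_in F \<Omega>" "emeasure lebesgue F \<noteq> 0"
    have "F \<subseteq> \<Omega>" using F(2) closure_subset unfolding relatively_compact_in_def by blast
    then have "(\<integral>\<^sup>+x. eabs (?f x) \<partial>lebesgue_on F) = ennreal (1 / ?c) * (\<integral>\<^sup>+x. ennreal (h x) \<partial>lebesgue_on F)"
      by (rule scaled)
    also have "\<dots> \<le> ennreal (1 / ?c) * (ennreal ?c * Cap p F \<Omega>)"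
      using cb F by (intro mult_left_mono) (auto simp: capacity_bound_def)
    also have "\<dots> = Cap p F \<Omega>"
      using c by (simp add: mult.assoc[symmetric] ennreal_mult[symmetric])
    finally show "(\<integral>\<^sup>+x. eabs (?f x) \<partial>lebesgue_on F) \<le> 1 * Cap p F \<Omega>" by simp
  qed
  then have n1: "H_norm p \<Omega> ?f \<le> 1" by (rule H_norm_le_if_capacity_bound)
  have cb1: "capacity_bound p \<Omega> (\<lambda>x. eabs (?f x)) (ennreal 1)"
    using n1 by (intro capacity_bound_if_H_norm_le) auto
  have fm: "?f \<in> borel_measurable (lebesgue_on \<Omega>)" by measurable
  then have fM: "?f \<in> M_space \<Omega>" by (simp add: M_space_def)
  have "(\<integral>\<^sup>+x. eabs (?f x) \<partial>lebesgue_on K) < \<infinity>" if "compact K" "K \<subseteq> \<Omega>" for K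
    using loc[OF that] unfolding scaled[OF that(2)] by (simp add: ennreal_mult_less_top)
  then have "?f \<in> L1_loc \<Omega>" using fM by (auto simp: L1_loc_def)
  moreover have "\<exists>C>0. \<forall>u\<in>D0 p \<Omega>. (\<integral>\<^sup>+x. eabs (?f x) * ennreal (\<bar>u x\<bar> powr p) \<partial>lebesgue_on \<Omega>) \<le> ennreal C * energy p \<Omega> u"
    using capacity_bound_D0[OF op p _ cb1 _ borel_measurable_eabs[OF fm]]
    by (intro exI[of _ "1 * (6 * 16 powr p)"]) auto
  ultimately have fH: "?f \<in> H_space p \<Omega>" by (simp add: H_space_def)
  have "ennreal (1 / ?c) * (\<integral>\<^sup>+x. ennreal (h x) * epowr (eabs (u x)) p \<partial>lebesgue_on \<Omega>)
      = (\<integral>\<^sup>+x. eabs (?f x) * epowr (eabs (u x)) p \<partial>lebesgue_on \<Omega>)"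
    unfolding ef mult.assoc by (rule nn_integral_cmult[symmetric]) measurable
  also have "\<dots> \<le> assoc_norm p \<Omega> (abs_power p u)"
    by (rule le_assoc_norm_abs_power[OF fH n1])
  finally have "ennreal ?c * (ennreal (1 / ?c) * (\<integral>\<^sup>+x. ennreal (h x) * epowr (eabs (u x)) p \<partial>lebesgue_on \<Omega>))
      \<le> ennreal ?c * assoc_norm p \<Omega> (abs_power p u)"
    by (rule mult_left_mono) simp
  then show ?thesis
    using c by (simp add: mult.assoc[symmetric] ennreal_mult[symmetric])
qed

text \<open>The condition on h is the weak L^(N/p) norm in its averaged form. On F = {|\<phi>| >= 1}
  the Sobolev bound |F| <= C e^(N/(N-p)) turns |F|^(1 - p/N) into a multiple of e, because the two
  exponents are reciprocal.\<close>

lemma E_space_pairing_weak_Lebesgue: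
  fixes \<Omega> :: "'a::euclidean_space set"
  assumes op: "open \<Omega>" and p: "1 < p" "p < real DIM('a)"
  obtains C where "C > 0" "\<And>h (u :: 'a \<Rightarrow> ereal). h \<in> borel_measurable (lebesgue_on \<Omega>) \<Longrightarrow> (\<forall>x. 0 \<le> h x) \<Longrightarrow>
      (\<forall>F. F \<in> sets lebesgue \<longrightarrow> F \<subseteq> \<Omega> \<longrightarrow> emeasure lebesgue F < \<infinity> \<longrightarrow>
        (\<integral>\<^sup>+x. ennreal (h x) \<partial>lebesgue_on F) \<le> ennreal (A * measure lebesgue F powr (1 - p / real DIM('a)))) \<Longrightarrow>
      u \<in> borel_measurable (lebesgue_on \<Omega>) \<Longrightarrow>
      (\<integral>\<^sup>+x. ennreal (h x) * epowr (eabs (u x)) p \<partial>lebesgue_on \<Omega>) \<le> ennreal C * assoc_norm p \<Omega> (abs_power p u)"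
proof -
  define q where "q = 1 - p / real DIM('a)"
  have q: "q > 0" "real DIM('a) / (real DIM('a) - p) * q = 1"
    using p by (auto simp: q_def field_simps)
  \<comment> \<open>A is arbitrary, but the final constant must be positive.\<close>
  define B where "B = max A 1"
  obtain C where C: "C > 0" "\<And>(\<phi> :: 'a \<Rightarrow> real) \<Omega> e. \<phi> \<in> test_functions \<Omega> \<Longrightarrow> 0 < e \<Longrightarrow> dirichlet p \<phi> \<le> ennreal e \<Longrightarrow>
      emeasure lborel {x. 1 \<le> \<bar>\<phi> x\<bar>} \<le> ennreal (C * e powr (real DIM('a) / (real DIM('a) - p)))"
    by (rule weak_sobolev[OF p]) (rule that)
  let ?c = "B * C powr q"
  have B: "B > 0" by (simp add: B_def)
  have c: "?c > 0" using C(1) B by simp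
  show thesis
  proof (rule that)
    show "?c * 4 powr p > 0" using c by simp
    fix h :: "'a \<Rightarrow> real" and u :: "'a \<Rightarrow> ereal"
    assume h: "h \<in> borel_measurable (lebesgue_on \<Omega>)" "\<forall>x. 0 \<le> h x" and um: "u \<in> borel_measurable (lebesgue_on \<Omega>)"
    assume weak: "\<forall>F. F \<in> sets lebesgue \<longrightarrow> F \<subseteq> \<Omega> \<longrightarrow> emeasure lebesgue F < \<infinity> \<longrightarrow>
        (\<integral>\<^sup>+x. ennreal (h x) \<partial>lebesgue_on F) \<le> ennreal (A * measure lebesgue F powr (1 - p / real DIM('a)))"
    show "(\<integral>\<^sup>+x. ennreal (h x) * epowr (eabs (u x)) p \<partial>lebesgue_on \<Omega>) \<le> ennreal (?c * 4 powr p) * assoc_norm p \<Omega> (abs_power p u)"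
    proof (rule E_space_pairing[OF op p(1) c h(1) _ _ _ um])
      show "0 \<le> h x" for x using h(2) by blast
    next
      fix K :: "'a set" assume K: "compact K" "K \<subseteq> \<Omega>"
      have "K \<in> sets lebesgue" "emeasure lebesgue K < \<infinity>"
        using emeasure_compact_finite[OF K(1)] by (simp_all add: borel_compact K(1))
      with weak K(2)
      have "(\<integral>\<^sup>+x. ennreal (h x) \<partial>lebesgue_on K) \<le> ennreal (A * measure lebesgue K powr (1 - p / real DIM('a)))"
        by blast
      then show "(\<integral>\<^sup>+x. ennreal (h x) \<partial>lebesgue_on K) < \<infinity>"
        using le_less_trans by fastforce
    next
      fix \<phi> assume phi: "\<phi> \<in> test_functions \<Omega>"
      let ?F = "{x. 1 \<le> \<bar>\<phi> x\<bar>}"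
      obtain K where K: "compact K" "K \<subseteq> \<Omega>" "\<And>x. x \<notin> K \<Longrightarrow> \<phi> x = 0"
        by (rule test_functionsD[OF phi]) (rule that)
      have F\<Omega>: "?F \<subseteq> \<Omega>" using K(2,3) by force
      have Fb: "?F \<in> sets borel"
        by (simp add: borel_closed closed_Collect_le continuous_intros smooth_continuous_on test_functions_smooth[OF phi])
      have L: "\<Omega> \<in> sets lebesgue" using op by (simp add: borel_open)
      obtain E where E: "dirichlet p \<phi> = ennreal E" "E \<ge> 0"
        using dirichlet_finite[OF phi, of p] p by (metis ennreal_cases infinity_ennreal_def less_irrefl order.strict_implies_order less_trans zero_less_one)
      have "(\<integral>\<^sup>+x. ennreal (h x) * indicator ?F x \<partial>lebesgue_on \<Omega>) = (\<integral>\<^sup>+x. ennreal (h x) \<partial>lebesgue_on ?F)"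
        using Fb L F\<Omega> by (intro nn_integral_lebesgue_on_subset[symmetric]) auto
      also have "\<dots> \<le> ennreal (?c * E)"
      proof (rule ennreal_le_epsilon)
        fix d :: real assume d: "0 < d"
        \<comment> \<open>The Sobolev bound needs a positive number and E may vanish; the excess
          d/\<open>?c\<close> contributes exactly d in the end.\<close>
        define e where "e = E + d / ?c"
        have e: "e > 0" "E \<le> e" using E(2) d c by (auto simp: e_def add_nonneg_pos)
        have em: "emeasure lebesgue ?F \<le> ennreal (C * e powr (real DIM('a) / (real DIM('a) - p)))"
          using C(2)[OF phi e(1)] E e(2) Fb by (simp add: ennreal_leI)
        then have fin: "emeasure lebesgue ?F < \<infinity>" using le_less_trans by fastforce
        have "measure lebesgue ?F \<le> C * e powr (real DIM('a) / (real DIM('a) - p))"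
          using em fin C(1) by (subst (asm) emeasure_eq_ennreal_measure) auto
        then have "measure lebesgue ?F powr q \<le> (C * e powr (real DIM('a) / (real DIM('a) - p))) powr q"
          using q by (intro powr_mono2) auto
        also have "\<dots> = C powr q * e"
          using q e C(1) by (simp add: powr_mult powr_powr)
        finally have mq: "measure lebesgue ?F powr q \<le> C powr q * e" .
        have "(\<integral>\<^sup>+x. ennreal (h x) \<partial>lebesgue_on ?F) \<le> ennreal (A * measure lebesgue ?F powr q)"
          using weak[rule_format, OF _ F\<Omega> fin] Fb by (simp add: q_def)
        also have "A * measure lebesgue ?F powr q \<le> B * (C powr q * e)"
          using mq by (intro mult_mono) (auto simp: B_def)
        also have "B * (C powr q * e) = ?c * E + d"
          using C(1) B by (simp add: e_def distrib_left)
        finally show "(\<integral>\<^sup>+x. ennreal (h x) \<partial>lebesgue_on ?F) \<le> ennreal (?c * E) + ennreal d"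
          using c E(2) d by (simp add: ennreal_leI)
      qed
      also have "\<dots> = ennreal ?c * dirichlet p \<phi>"
        using c E by (simp add: ennreal_mult)
      finally show "(\<integral>\<^sup>+x. ennreal (h x) * indicator ?F x \<partial>lebesgue_on \<Omega>) \<le> ennreal ?c * dirichlet p \<phi>" .
    qed
  qed
qed

section \<open>Duality for weak Lebesgue spaces\<close>

lemma nn_integral_powr_from_0:
  fixes a c :: real
  assumes "a > -1" "0 \<le> c"
  shows "(\<integral>\<^sup>+t. ennreal (t powr a) * indicator {0..c} t \<partial>lborel) = ennreal (c powr (a + 1) / (a + 1))"
proof -
  have "(\<integral>\<^sup>+t. ennreal (indicator {0..c} t * t powr a) \<partial>lborel) = ennreal (c powr (a + 1) / (a + 1))"
    using nn_integral_has_integral_lebesgue[OF _ has_integral_powr_from_0[OF assms]]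
    by (simp add: nn_integral_completion)
  moreover have "ennreal (indicator {0..c} t * t powr a) = ennreal (t powr a) * indicator {0..c} t" for t
    by (auto simp: indicator_def)
  ultimately show ?thesis by simp
qed

lemma layer_cake_powr:
  assumes "0 < p" "0 \<le> a"
  shows "(\<integral>\<^sup>+s. ennreal (p * s powr (p - 1)) * indicator {s. 0 < s \<and> s < a} s \<partial>lborel) = ennreal (a powr p)"
proof -
  have "AE s in lborel. s \<noteq> (0::real) \<and> s \<noteq> a"
    by (intro AE_conjI AE_lborel_singleton)
  then have "AE s in lborel. ennreal (p * s powr (p - 1)) * indicator {s. 0 < s \<and> s < a} s
      = ennreal p * (ennreal (s powr (p - 1)) * indicator {0..a} s)"
    by eventually_elim (use assms(1) in \<open>auto simp: indicator_def ennreal_mult\<close>)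
  then have "(\<integral>\<^sup>+s. ennreal (p * s powr (p - 1)) * indicator {s. 0 < s \<and> s < a} s \<partial>lborel)
      = (\<integral>\<^sup>+s. ennreal p * (ennreal (s powr (p - 1)) * indicator {0..a} s) \<partial>lborel)"
    by (rule nn_integral_cong_AE)
  also have "\<dots> = ennreal p * ennreal (a powr (p - 1 + 1) / (p - 1 + 1))"
    using assms by (subst nn_integral_cmult) (auto simp: nn_integral_powr_from_0)
  also have "\<dots> = ennreal (a powr p)"
    using assms by (simp add: ennreal_mult[symmetric])
  finally show ?thesis .
qed

text \<open>A rearrangement may be infinite, so the layer-cake formula is extended to a = top, where
  the integral exceeds every finite value.\<close>

lemma epowr_le_layer_cake:
  assumes "0 < p"
  shows "epowr a p \<le> (\<integral>\<^sup>+s. ennreal (p * s powr (p - 1)) * indicator {s. 0 < s \<and> ennreal s < a} s \<partial>lborel)"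
proof (cases "a = top")
  case False
  then obtain r where r: "a = ennreal r" "0 \<le> r" by (metis ennreal_cases)
  have "{s. 0 < s \<and> ennreal s < a} = {s. 0 < s \<and> s < r}"
    using r by (auto simp: ennreal_less_iff)
  then show ?thesis using r layer_cake_powr[OF assms r(2)] by simp
next
  case True
  let ?I = "\<integral>\<^sup>+s. ennreal (p * s powr (p - 1)) * indicator {s. 0 < s \<and> ennreal s < a} s \<partial>lborel"
  have le: "ennreal r \<le> ?I" if "0 \<le> r" for r
  proof -
    have "ennreal ((r powr (1 / p)) powr p) \<le> ?I"
      unfolding layer_cake_powr[OF assms powr_ge_zero, symmetric]
      using True by (intro nn_integral_mono) (auto simp: indicator_def)
    then show ?thesis using assms that by (simp add: powr_powr)
  qed
  have "?I = top"
  proof (cases ?I rule: ennreal_cases)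
    case (real i)
    with le[of "i + 1"] have "ennreal (i + 1) \<le> ennreal i" by simp
    then show ?thesis using real(1) by simp
  qed
  then show ?thesis by simp
qed

text \<open>The 1 accounts for points of rank at least |F|; the fraction sums a geometric series
  with ratio 2^(\<theta>-1) over the dyadic ranks below |F|.\<close>

definition level_const :: "real \<Rightarrow> real" where
  "level_const \<theta> = 1 + 2 powr \<theta> / (1 - 2 powr (\<theta> - 1))"

context sigma_finite_measure
begin

section \<open>The rank weight of a measurable function\<close>

context
  fixes w :: "'a \<Rightarrow> real" and \<theta> :: real
  assumes w [measurable]: "w \<in> borel_measurable M" and \<theta>: "0 < \<theta>" "\<theta> < 1"
begin

text \<open>\<open>N (w x)\<close> is the rank of x. Ties are counted, so that points of rank below
  \<tau> form a set of measure at most \<tau>; with a strict inequality a constant w would have rank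
  0 everywhere.\<close>

private definition N :: "real \<Rightarrow> ennreal" where
  "N s = (\<integral>\<^sup>+x. indicator {s..} (w x) \<partial>M)"

private lemma N_measurable [measurable]: "N \<in> borel_measurable borel"
proof -
  have "(\<lambda>s. \<integral>\<^sup>+x. (if s \<le> w x then 1 else 0 :: ennreal) \<partial>M) \<in> borel_measurable borel"
    by measurable
  moreover have "N = (\<lambda>s. \<integral>\<^sup>+x. (if s \<le> w x then 1 else 0 :: ennreal) \<partial>M)"
    unfolding N_def by (intro ext nn_integral_cong) (auto simp: indicator_def)
  ultimately show ?thesis by simp
qed

private lemma N_eq: "N s = emeasure M {x \<in> space M. s \<le> w x}"
proof -
  have "N s = (\<integral>\<^sup>+x. indicator {x \<in> space M. s \<le> w x} x \<partial>M)"
    unfolding N_def by (intro nn_integral_cong) (auto simp: indicator_def)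
  then show ?thesis by simp
qed

private lemma N_antimono: "s \<le> t \<Longrightarrow> N t \<le> N s"
  unfolding N_eq by (intro emeasure_mono) auto

text \<open>An infinite rank is sent to 0 by \<open>enn2real\<close>, and 0 \<open>powr\<close> any
  exponent is 0, so infinite and zero ranks both get weight 0. Zero ranks are negligible by
  \<open>AE_N_pos\<close>; infinite ones do not occur above a level whose superlevel set has finite
  measure.\<close>

private definition weight :: "'a \<Rightarrow> real" where
  "weight x = (if 0 < w x then enn2real (N (w x)) powr (- \<theta>) else 0)"

private lemma weight_measurable [measurable]: "weight \<in> borel_measurable M"
  unfolding weight_def by measurable

private lemma weight_nonneg: "0 \<le> weight x"
  by (simp add: weight_def)

private lemma level_sets [measurable]: "{x \<in> space M. 0 < w x \<and> N (w x) < \<tau>} \<in> sets M"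
  by measurable

text \<open>The levels of rank below \<tau> form an upper half-line. If it contains its infimum, the
  set lies in one superlevel set of measure below \<tau>; otherwise it is covered by an increasing
  union of such sets, and only <= survives in the limit.\<close>

private lemma emeasure_level_set:
  "emeasure M {x \<in> space M. 0 < w x \<and> N (w x) < \<tau>} \<le> \<tau>" (is "emeasure M ?T \<le> \<tau>")
proof -
  let ?J = "{s. 0 < s \<and> N s < \<tau>}"
  have up: "t \<in> ?J" if "s \<in> ?J" "s \<le> t" for s t
    using that N_antimono[of s t] by auto
  show ?thesis
  proof (cases "?J = {}")
    case True
    then have "?T = {}" by blast
    then show ?thesis by (simp only: emeasure_empty zero_le)
  next
    case False
    define s0 where "s0 = Inf ?J"
    have bdd: "bdd_below ?J" by (rule bdd_belowI[of _ 0]) auto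
    have above: "t \<in> ?J" if "s0 < t" for t
    proof -
      have "Inf ?J < t" using that by (simp only: s0_def)
      then have "\<exists>s\<in>?J. s < t" by (simp only: cInf_less_iff[OF False bdd])
      then show ?thesis using up less_imp_le by blast
    qed
    show ?thesis
    proof (cases "s0 \<in> ?J")
      case True
      have "?T \<subseteq> {x \<in> space M. s0 \<le> w x}"
        using bdd by (auto simp: s0_def intro!: cInf_lower)
      then have "emeasure M ?T \<le> N s0"
        unfolding N_eq by (intro emeasure_mono) auto
      then show ?thesis using True by auto
    next
      case False
      define A where "A n = {x \<in> space M. s0 + inverse (real (Suc n)) \<le> w x}" for n
      have "?T \<subseteq> (\<Union>n. A n)"
      proof
        fix x assume x: "x \<in> ?T"
        then have "s0 \<le> w x" using bdd by (auto simp: s0_def intro!: cInf_lower)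
        moreover have "s0 \<noteq> w x" using False x by auto
        ultimately have "0 < w x - s0" by simp
        then obtain n where "inverse (real (Suc n)) < w x - s0"
          using reals_Archimedean by blast
        then show "x \<in> (\<Union>n. A n)" using x by (auto simp: A_def intro!: exI[of _ n])
      qed
      then have "emeasure M ?T \<le> emeasure M (\<Union>n. A n)"
        by (intro emeasure_mono) (auto simp: A_def)
      also have "\<dots> = (SUP n. emeasure M (A n))"
      proof (rule SUP_emeasure_incseq[symmetric])
        show "incseq A"
        proof (rule incseq_SucI)
          fix n
          have "inverse (real (Suc (Suc n))) \<le> inverse (real (Suc n))"
            by (intro le_imp_inverse_le) auto
          then have "s0 + inverse (real (Suc (Suc n))) \<le> y" if "s0 + inverse (real (Suc n)) \<le> y" for y
            using that by linarith
          then show "A n \<le> A (Suc n)" unfolding A_def by blast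
        qed
      qed (auto simp: A_def)
      also have "\<dots> \<le> \<tau>"
      proof (rule SUP_least)
        fix n
        have "s0 + inverse (real (Suc n)) \<in> ?J" by (rule above) simp
        then show "emeasure M (A n) \<le> \<tau>" by (simp add: A_def N_eq less_imp_le)
      qed
      finally show ?thesis .
    qed
  qed
qed

private lemma AE_N_pos: "AE x in M. 0 < w x \<longrightarrow> N (w x) \<noteq> 0"
proof -
  let ?Z = "{x \<in> space M. 0 < w x \<and> N (w x) = 0}"
  have "emeasure M ?Z \<le> 0"
  proof (rule ennreal_le_epsilon)
    fix e :: real assume "0 < e"
    then have "?Z \<subseteq> {x \<in> space M. 0 < w x \<and> N (w x) < ennreal e}" by auto
    then have "emeasure M ?Z \<le> emeasure M {x \<in> space M. 0 < w x \<and> N (w x) < ennreal e}"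
      by (intro emeasure_mono) auto
    also have "\<dots> \<le> ennreal e" by (rule emeasure_level_set)
    finally show "emeasure M ?Z \<le> 0 + ennreal e" by simp
  qed
  then show ?thesis
    by (intro AE_I[where N = ?Z]) auto
qed

text \<open>Points are sorted by dyadic rank: either the rank is at least m, or it lies between
  m/2^(k+1) and m/2^k for some k, and the weight is a decreasing power of the rank.\<close>

private lemma weight_pointwise:
  assumes m: "0 < m"
  shows "ennreal (weight x) \<le> ennreal (m powr (- \<theta>)) +
    (\<Sum>k. ennreal ((m / 2 ^ Suc k) powr (- \<theta>)) * indicator {x. 0 < w x \<and> N (w x) < ennreal (m / 2 ^ k)} x)"
    (is "_ \<le> _ + (\<Sum>k. ?f k)")
proof (cases "0 < w x \<and> N (w x) \<noteq> top \<and> N (w x) \<noteq> 0")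
  case False
  then have "weight x = 0" by (auto simp: weight_def)
  then show ?thesis by simp
next
  case True
  then obtain n where n: "N (w x) = ennreal n" "0 \<le> n" by (metis ennreal_cases)
  then have npos: "n > 0" using True by auto
  have wx: "weight x = n powr (- \<theta>)" using True n by (simp add: weight_def)
  show ?thesis
  proof (cases "m \<le> n")
    case True
    then have "weight x \<le> m powr (- \<theta>)"
      unfolding wx using m \<theta> by (intro powr_mono2') auto
    then show ?thesis by (meson add_increasing2 ennreal_leI zero_le)
  next
    case False
    have "(\<lambda>k. m / 2 ^ k) \<longlonglongrightarrow> 0" by (rule LIMSEQ_divide_realpow_zero) simp
    then have "eventually (\<lambda>k. m / 2 ^ k < n) sequentially"
      using npos by (intro order_tendstoD(2)) auto
    then have "\<exists>k. m / 2 ^ k \<le> n" by (auto simp: eventually_sequentially intro: less_imp_le)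
    define j where "j = (LEAST k. m / 2 ^ k \<le> n)"
    have j: "m / 2 ^ j \<le> n" unfolding j_def using \<open>\<exists>k. m / 2 ^ k \<le> n\<close> by (rule LeastI_ex)
    then obtain k where k: "j = Suc k" using False by (cases j) auto
    have "\<not> m / 2 ^ k \<le> n"
      using not_less_Least[of k "\<lambda>k. m / 2 ^ k \<le> n"] k unfolding j_def by simp
    then have "?f k = ennreal ((m / 2 ^ Suc k) powr (- \<theta>))"
      using True n by (simp add: ennreal_less_iff)
    moreover have "weight x \<le> (m / 2 ^ Suc k) powr (- \<theta>)"
      unfolding wx using m \<theta> j k by (intro powr_mono2') auto
    ultimately have "ennreal (weight x) \<le> ?f k" by (simp add: ennreal_leI)
    also have "\<dots> \<le> (\<Sum>k. ?f k)"
    proof -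
      have "h k \<le> (\<Sum>k. h k)" for h :: "nat \<Rightarrow> ennreal"
        using sum_le_suminf[of h "{k}"] by simp
      then show ?thesis .
    qed
    finally show ?thesis by (simp add: add_increasing)
  qed
qed

text \<open>With m = |F|, ranks of at least m contribute at most m^(-\<theta>) on F. The smaller
  ranks are integrated over their full level sets, of measure at most m/2^k, regardless of F; the
  series converges because \<theta> < 1.\<close>

private lemma weight_weak_Lebesgue:
  assumes F [measurable]: "F \<in> sets M" and fin: "emeasure M F < \<infinity>"
  shows "(\<integral>\<^sup>+x. ennreal (weight x) * indicator F x \<partial>M) \<le> ennreal (level_const \<theta> * measure M F powr (1 - \<theta>))"
proof (cases "measure M F = 0")
  case True
  then have "emeasure M F = 0" using fin by (simp add: emeasure_eq_ennreal_measure less_top)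
  then have "AE x in M. x \<notin> F" using F by (intro AE_not_in) (simp add: null_sets_def)
  then have "AE x in M. ennreal (weight x) * indicator F x = 0"
    by eventually_elim auto
  then have "(\<integral>\<^sup>+x. ennreal (weight x) * indicator F x \<partial>M) = (\<integral>\<^sup>+x. 0 \<partial>M)"
    by (rule nn_integral_cong_AE)
  then show ?thesis by simp
next
  case False
  define m where "m = measure M F"
  have m: "m > 0" using False by (simp add: m_def less_le)
  have emF: "emeasure M F = ennreal m" using fin by (simp add: m_def emeasure_eq_ennreal_measure less_top)
  let ?T = "\<lambda>k. {x \<in> space M. 0 < w x \<and> N (w x) < ennreal (m / 2 ^ k)}"
  let ?a = "\<lambda>k. ennreal ((m / 2 ^ Suc k) powr (- \<theta>))"
  have "(\<integral>\<^sup>+x. ennreal (weight x) * indicator F x \<partial>M)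
      \<le> (\<integral>\<^sup>+x. ennreal (m powr (- \<theta>)) * indicator F x + (\<Sum>k. ?a k * indicator (?T k) x) \<partial>M)"
  proof (rule nn_integral_mono)
    fix x assume x: "x \<in> space M"
    show "ennreal (weight x) * indicator F x \<le> ennreal (m powr (- \<theta>)) * indicator F x + (\<Sum>k. ?a k * indicator (?T k) x)"
      using weight_pointwise[OF m, of x] x by (cases "x \<in> F") (auto simp: indicator_def)
  qed
  also have "\<dots> = ennreal (m powr (- \<theta>)) * ennreal m + (\<Sum>k. ?a k * emeasure M (?T k))"
    by (simp add: nn_integral_add nn_integral_suminf nn_integral_cmult_indicator emF)
  also have "(\<Sum>k. ?a k * emeasure M (?T k)) \<le> (\<Sum>k. ennreal (m powr (1 - \<theta>) * 2 powr \<theta> * (2 powr (\<theta> - 1)) ^ k))"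
  proof (intro suminf_le)
    fix k
    have "?a k * emeasure M (?T k) \<le> ?a k * ennreal (m / 2 ^ k)"
      by (intro mult_left_mono emeasure_level_set) simp
    also have "\<dots> = ennreal ((m / 2 ^ Suc k) powr (- \<theta>) * (m / 2 ^ k))"
      using m by (subst ennreal_mult) auto
    also have "(m / 2 ^ Suc k) powr (- \<theta>) * (m / 2 ^ k) = m powr (1 - \<theta>) * 2 powr \<theta> * (2 powr (\<theta> - 1)) ^ k"
    proof -
      have "(m / 2 ^ Suc k) powr (- \<theta>) = m powr (- \<theta>) * (2 powr real (Suc k)) powr \<theta>"
      proof -
        have "(m / x) powr (- \<theta>) = m powr (- \<theta>) * x powr \<theta>" if "x > 0" for x
          using m that by (simp add: powr_divide powr_minus field_simps)
        moreover have "(2 :: real) ^ Suc k = 2 powr real (Suc k)"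
          by (simp only: powr_realpow zero_less_numeral)
        ultimately show ?thesis by (metis zero_less_numeral zero_less_power)
      qed
      also have "(2 powr real (Suc k)) powr \<theta> = 2 powr \<theta> * 2 powr (\<theta> * real k)"
        by (simp add: powr_powr powr_add[symmetric] algebra_simps)
      finally have *: "(m / 2 ^ Suc k) powr (- \<theta>) * (m / 2 ^ k)
          = (m powr (- \<theta>) * m) * 2 powr \<theta> * (2 powr (\<theta> * real k) / 2 ^ k)"
        by simp
      have "m powr (- \<theta>) * m = m powr (1 - \<theta>)"
        using m powr_add[of m "- \<theta>" 1] by simp
      moreover have "2 powr (\<theta> * real k) / 2 ^ k = (2 powr (\<theta> - 1)) ^ k"
        by (simp add: powr_realpow[symmetric] powr_powr powr_diff[symmetric] algebra_simps)
      ultimately show ?thesis unfolding * by simp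
    qed
    finally show "?a k * emeasure M (?T k) \<le> ennreal (m powr (1 - \<theta>) * 2 powr \<theta> * (2 powr (\<theta> - 1)) ^ k)" .
  qed auto
  also have "(\<Sum>k. ennreal (m powr (1 - \<theta>) * 2 powr \<theta> * (2 powr (\<theta> - 1)) ^ k))
      = ennreal (m powr (1 - \<theta>) * 2 powr \<theta> * (1 / (1 - 2 powr (\<theta> - 1))))"
  proof -
    have "2 powr (\<theta> - 1) < (1 :: real)" using \<theta> by (simp add: powr_less_one)
    then have "(\<lambda>k. m powr (1 - \<theta>) * 2 powr \<theta> * (2 powr (\<theta> - 1)) ^ k) sums
        (m powr (1 - \<theta>) * 2 powr \<theta> * (1 / (1 - 2 powr (\<theta> - 1))))"
      by (intro sums_mult geometric_sums) simp
    then show ?thesis by (intro suminf_ennreal_eq) auto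
  qed
  also have "ennreal (m powr (- \<theta>)) * ennreal m = ennreal (m powr (1 - \<theta>))"
    using m powr_add[of m "- \<theta>" 1] by (simp add: ennreal_mult[symmetric])
  also have "ennreal (m powr (1 - \<theta>)) + ennreal (m powr (1 - \<theta>) * 2 powr \<theta> * (1 / (1 - 2 powr (\<theta> - 1))))
      = ennreal (level_const \<theta> * m powr (1 - \<theta>))"
  proof -
    have "2 powr (\<theta> - 1) < (1 :: real)" using \<theta> by (simp add: powr_less_one)
    then show ?thesis
      by (subst ennreal_plus[symmetric]) (auto simp: level_const_def algebra_simps)
  qed
  finally show ?thesis by (simp add: m_def add_left_mono)
qed

text \<open>Wherever w > s the rank is at most m, so almost everywhere there the weight is at least
  m^(-\<theta>). This lower bound is what makes the rank weight detect the distribution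
  function.\<close>

private lemma superlevel_weight:
  assumes s: "0 < s" and fin: "emeasure M {x \<in> space M. s < w x} = ennreal m" "0 \<le> m"
  shows "ennreal (m powr (1 - \<theta>)) \<le> (\<integral>\<^sup>+x. ennreal (weight x) * indicator {s<..} (w x) \<partial>M)"
proof (cases "m = 0")
  case False
  let ?S = "{x \<in> space M. s < w x}"
  have m: "m > 0" using False fin(2) by simp
  have "ennreal (m powr (1 - \<theta>)) = ennreal (m powr (- \<theta>)) * ennreal m"
    using m powr_add[of m "- \<theta>" 1] by (simp add: ennreal_mult[symmetric])
  also have "\<dots> = (\<integral>\<^sup>+x. ennreal (m powr (- \<theta>)) * indicator ?S x \<partial>M)"
    by (simp add: nn_integral_cmult_indicator fin)
  also have "\<dots> \<le> (\<integral>\<^sup>+x. ennreal (weight x) * indicator {s<..} (w x) \<partial>M)"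
  proof (rule nn_integral_mono_AE)
    show "AE x in M. ennreal (m powr (- \<theta>)) * indicator ?S x \<le> ennreal (weight x) * indicator {s<..} (w x)"
      using AE_N_pos
    proof eventually_elim
      case (elim x)
      show ?case
      proof (cases "x \<in> ?S")
        case True
        have "N (w x) \<le> emeasure M ?S"
          unfolding N_eq using True by (intro emeasure_mono) auto
        then have le: "N (w x) \<le> ennreal m" by (simp add: fin)
        then obtain n where n: "N (w x) = ennreal n" "0 \<le> n" by (metis ennreal_cases neq_top_trans ennreal_neq_top)
        have "n > 0" "n \<le> m"
          using elim True s n le fin(2) by (auto simp: less_le)
        then have "m powr (- \<theta>) \<le> weight x"
          using True s n \<theta> by (auto simp: weight_def intro!: powr_mono2')
        then show ?thesis using True by (simp add: ennreal_leI)
      qed simp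
    qed
  qed
  finally show ?thesis .
qed simp

text \<open>These simpler weights serve to show that the superlevel sets of w have finite measure,
  before the ranks can be used.\<close>

private lemma indicator_weight_weak_Lebesgue:
  assumes S [measurable]: "S \<in> sets M" and m: "emeasure M S = ennreal m" "0 < m"
    and F [measurable]: "F \<in> sets M" and fin: "emeasure M F < \<infinity>"
  shows "(\<integral>\<^sup>+x. ennreal (m powr (- \<theta>) * indicator S x) * indicator F x \<partial>M) \<le> ennreal (level_const \<theta> * measure M F powr (1 - \<theta>))"
proof -
  define f where "f = measure M F"
  define a where "a = measure M (S \<inter> F)"
  have emF: "emeasure M F = ennreal f" using fin by (simp add: f_def emeasure_eq_ennreal_measure less_top)
  have le: "emeasure M (S \<inter> F) \<le> emeasure M F" "emeasure M (S \<inter> F) \<le> emeasure M S"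
    by (intro emeasure_mono; auto)+
  have ema: "emeasure M (S \<inter> F) = ennreal a"
    unfolding a_def using le(1) fin by (intro emeasure_eq_ennreal_measure) auto
  have a: "0 \<le> a" "a \<le> f" "a \<le> m"
    using le m emF by (auto simp: ema a_def f_def)
  have "(\<integral>\<^sup>+x. ennreal (m powr (- \<theta>) * indicator S x) * indicator F x \<partial>M)
      = (\<integral>\<^sup>+x. ennreal (m powr (- \<theta>)) * indicator (S \<inter> F) x \<partial>M)"
    by (intro nn_integral_cong) (auto simp: indicator_def)
  also have "\<dots> = ennreal (m powr (- \<theta>) * a)"
    using a by (simp add: nn_integral_cmult_indicator ema ennreal_mult)
  also have "m powr (- \<theta>) * a \<le> f powr (1 - \<theta>)"
  proof (cases "a = 0")
    case False
    then have apos: "a > 0" using a by simp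
    then have "m powr (- \<theta>) * a \<le> a powr (- \<theta>) * a"
      using a \<theta> by (intro mult_right_mono powr_mono2') auto
    also have "\<dots> = a powr (1 - \<theta>)" using apos powr_add[of a "- \<theta>" 1] by simp
    also have "\<dots> \<le> f powr (1 - \<theta>)" using a \<theta> by (intro powr_mono2) auto
    finally show ?thesis .
  qed simp
  also have "f powr (1 - \<theta>) \<le> level_const \<theta> * f powr (1 - \<theta>)"
  proof -
    have "2 powr (\<theta> - 1) < (1 :: real)" using \<theta> by (simp add: powr_less_one)
    then have "1 \<le> level_const \<theta>" by (simp add: level_const_def)
    then show ?thesis by (simp add: mult_le_cancel_right1)
  qed
  finally show ?thesis by (simp add: f_def ennreal_leI)
qed

text \<open>Testing a bound for all weights in weak \<open>L\<^bsup>1/\<theta>\<^esup>\<close> with a decreasing function of the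
  rank of \<open>w x\<close> recovers the Lorentz integral of \<open>w\<close>.\<close>

lemma weak_Lebesgue_duality:
  assumes p: "0 < p" and K: "K < (\<infinity> :: ennreal)"
    and pairing: "\<And>h. h \<in> borel_measurable M \<Longrightarrow> (\<And>x. 0 \<le> h x) \<Longrightarrow>
      (\<And>F. F \<in> sets M \<Longrightarrow> emeasure M F < \<infinity> \<Longrightarrow>
        (\<integral>\<^sup>+x. ennreal (h x) * indicator F x \<partial>M) \<le> ennreal (level_const \<theta> * measure M F powr (1 - \<theta>))) \<Longrightarrow>
      (\<integral>\<^sup>+x. ennreal (h x) * ennreal (\<bar>w x\<bar> powr p) \<partial>M) \<le> K"
  shows "(\<integral>\<^sup>+t. ennreal (t powr (- \<theta>)) *
      (\<integral>\<^sup>+s. ennreal (p * s powr (p - 1)) * indicator {s. 0 < s \<and> ennreal t \<le> emeasure M {x \<in> space M. s < w x}} s \<partial>lborel)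
      * indicator {0<..} t \<partial>lborel) < \<infinity>"
proof -
  let ?\<mu> = "\<lambda>s. emeasure M {x \<in> space M. s < w x}"
  obtain k where k: "K = ennreal k" "0 \<le> k" using K by (metis ennreal_cases infinity_ennreal_def less_irrefl)
  \<comment> \<open>Infinite superlevel sets would make the ranks useless. Their pieces of finite
    measure, from an exhaustion of the space, are paired with normalised indicators; the resulting
    bound does not depend on the piece.\<close>
  have fin: "?\<mu> s \<le> ennreal ((k / s powr p) powr (1 / (1 - \<theta>)))" if s: "0 < s" for s
  proof -
    obtain A :: "nat \<Rightarrow> 'a set" where A: "range A \<subseteq> sets M" "(\<Union>i. A i) = space M" "\<And>i. emeasure M (A i) \<noteq> \<infinity>" "incseq A"
      using sigma_finite_incseq by metis
    let ?S = "\<lambda>i. {x \<in> space M. s < w x} \<inter> A i"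
    have [measurable]: "A i \<in> sets M" for i using A(1) by auto
    have "emeasure M (?S i) \<le> ennreal ((k / s powr p) powr (1 / (1 - \<theta>)))" for i
    proof -
      define m where "m = measure M (?S i)"
      have "emeasure M (?S i) \<le> emeasure M (A i)" by (intro emeasure_mono) auto
      then have "emeasure M (?S i) \<noteq> \<infinity>" using A(3)[of i] by (auto simp: top_unique)
      then have em: "emeasure M (?S i) = ennreal m" by (simp add: m_def emeasure_eq_ennreal_measure)
      show ?thesis
      proof (cases "m = 0")
        case False
        then have m: "m > 0" by (simp add: m_def less_le)
        have "ennreal (s powr p * m powr (1 - \<theta>)) = ennreal (m powr (- \<theta>) * s powr p) * ennreal m"
          using m powr_add[of m "- \<theta>" 1] by (simp add: ennreal_mult[symmetric] mult_ac)
        also have "\<dots> = (\<integral>\<^sup>+x. ennreal (m powr (- \<theta>) * s powr p) * indicator (?S i) x \<partial>M)"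
          by (simp add: nn_integral_cmult_indicator em)
        also have "\<dots> \<le> (\<integral>\<^sup>+x. ennreal (m powr (- \<theta>) * indicator (?S i) x) * ennreal (\<bar>w x\<bar> powr p) \<partial>M)"
          using s p by (intro nn_integral_mono)
            (auto simp: indicator_def ennreal_mult[symmetric] intro!: ennreal_leI mult_left_mono powr_mono2)
        also have "\<dots> \<le> K"
          by (intro pairing indicator_weight_weak_Lebesgue[OF _ em m]) auto
        finally have "s powr p * m powr (1 - \<theta>) \<le> k" using k by simp
        then have "m powr (1 - \<theta>) \<le> k / s powr p"
          using s by (simp add: field_simps)
        then have "(m powr (1 - \<theta>)) powr (1 / (1 - \<theta>)) \<le> (k / s powr p) powr (1 / (1 - \<theta>))"
          using \<theta> by (intro powr_mono2) auto
        then show ?thesis using m \<theta> by (simp add: em powr_powr ennreal_leI)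
      qed (simp add: em)
    qed
    moreover have "?\<mu> s = (SUP i. emeasure M (?S i))"
    proof -
      have "{x \<in> space M. s < w x} = (\<Union>i. ?S i)" using A(2) by blast
      moreover have "incseq ?S" using A(4) by (auto simp: incseq_def)
      moreover have "range ?S \<subseteq> sets M" by auto
      ultimately show ?thesis using SUP_emeasure_incseq[of ?S M] by simp
    qed
    ultimately show ?thesis by (auto intro: SUP_least)
  qed
  have \<mu>_meas [measurable]: "?\<mu> \<in> borel_measurable borel"
  proof -
    have "(\<lambda>s. \<integral>\<^sup>+x. (if s < w x then 1 else 0 :: ennreal) \<partial>M) \<in> borel_measurable borel"
      by measurable
    moreover have "?\<mu> s = (\<integral>\<^sup>+x. (if s < w x then 1 else 0 :: ennreal) \<partial>M)" for s
    proof -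
      have "(\<integral>\<^sup>+x. (if s < w x then 1 else 0 :: ennreal) \<partial>M) = (\<integral>\<^sup>+x. indicator {x \<in> space M. s < w x} x \<partial>M)"
        by (intro nn_integral_cong) (auto simp: indicator_def)
      then show ?thesis by simp
    qed
    ultimately show ?thesis by simp
  qed
  let ?D = "\<lambda>s. ennreal (p * s powr (p - 1))"
  \<comment> \<open>Fubini in (t, s): integrating t up to \<mu>(s) gives
    \<mu>(s)^(1-\<theta>)/(1-\<theta>), which \<open>superlevel_weight\<close> bounds by a weight
    integral; a second exchange and the layer-cake formula lead to the pairing of the weight with
    |w|^p.\<close>
  have "(\<integral>\<^sup>+t. ennreal (t powr (- \<theta>)) * (\<integral>\<^sup>+s. ?D s * indicator {s. 0 < s \<and> ennreal t \<le> ?\<mu> s} s \<partial>lborel) * indicator {0<..} t \<partial>lborel)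
      = (\<integral>\<^sup>+t. \<integral>\<^sup>+s. (if 0 < t \<and> 0 < s \<and> ennreal t \<le> ?\<mu> s then ennreal (t powr (- \<theta>)) * ?D s else 0) \<partial>lborel \<partial>lborel)"
  proof (rule nn_integral_cong)
    fix t :: real
    have "ennreal (t powr (- \<theta>)) * (\<integral>\<^sup>+s. ?D s * indicator {s. 0 < s \<and> ennreal t \<le> ?\<mu> s} s \<partial>lborel) * indicator {0<..} t
        = (\<integral>\<^sup>+s. ennreal (t powr (- \<theta>)) * indicator {0<..} t * (?D s * indicator {s. 0 < s \<and> ennreal t \<le> ?\<mu> s} s) \<partial>lborel)"
      by (subst nn_integral_cmult) (auto simp: mult_ac)
    also have "\<dots> = (\<integral>\<^sup>+s. (if 0 < t \<and> 0 < s \<and> ennreal t \<le> ?\<mu> s then ennreal (t powr (- \<theta>)) * ?D s else 0) \<partial>lborel)"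
      by (intro nn_integral_cong) (auto simp: indicator_def)
    finally show "ennreal (t powr (- \<theta>)) * (\<integral>\<^sup>+s. ?D s * indicator {s. 0 < s \<and> ennreal t \<le> ?\<mu> s} s \<partial>lborel) * indicator {0<..} t = \<dots>" .
  qed
  also have "\<dots> = (\<integral>\<^sup>+s. \<integral>\<^sup>+t. (if 0 < t \<and> 0 < s \<and> ennreal t \<le> ?\<mu> s then ennreal (t powr (- \<theta>)) * ?D s else 0) \<partial>lborel \<partial>lborel)"
    by (rule lborel_pair.Fubini') (simp add: split_beta', measurable)
  also have "\<dots> \<le> (\<integral>\<^sup>+s. ennreal (1 / (1 - \<theta>)) * (\<integral>\<^sup>+x. (if 0 < s \<and> s < w x then ennreal (weight x) * ?D s else 0) \<partial>M) \<partial>lborel)"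
  proof (rule nn_integral_mono)
    fix s :: real
    show "(\<integral>\<^sup>+t. (if 0 < t \<and> 0 < s \<and> ennreal t \<le> ?\<mu> s then ennreal (t powr (- \<theta>)) * ?D s else 0) \<partial>lborel)
        \<le> ennreal (1 / (1 - \<theta>)) * (\<integral>\<^sup>+x. (if 0 < s \<and> s < w x then ennreal (weight x) * ?D s else 0) \<partial>M)"
    proof (cases "0 < s")
      case True
      obtain m where m: "?\<mu> s = ennreal m" "0 \<le> m"
        using fin[OF True] by (metis ennreal_cases ennreal_neq_top neq_top_trans)
      have "(\<integral>\<^sup>+t. (if 0 < t \<and> 0 < s \<and> ennreal t \<le> ?\<mu> s then ennreal (t powr (- \<theta>)) * ?D s else 0) \<partial>lborel)
          \<le> (\<integral>\<^sup>+t. ?D s * (ennreal (t powr (- \<theta>)) * indicator {0..m} t) \<partial>lborel)"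
        using m by (intro nn_integral_mono) (auto simp: indicator_def mult.commute)
      also have "\<dots> = ?D s * ennreal (m powr (1 - \<theta>) / (1 - \<theta>))"
        using \<theta> m nn_integral_powr_from_0[of "- \<theta>" m] by (subst nn_integral_cmult) auto
      also have "\<dots> = ?D s * (ennreal (1 / (1 - \<theta>)) * ennreal (m powr (1 - \<theta>)))"
        using \<theta> by (subst ennreal_mult[symmetric]) auto
      also have "\<dots> \<le> ?D s * (ennreal (1 / (1 - \<theta>)) * (\<integral>\<^sup>+x. ennreal (weight x) * indicator {s<..} (w x) \<partial>M))"
        by (intro mult_left_mono superlevel_weight True m) auto
      also have "\<dots> = ennreal (1 / (1 - \<theta>)) * (\<integral>\<^sup>+x. ?D s * (ennreal (weight x) * indicator {s<..} (w x)) \<partial>M)"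
        by (subst nn_integral_cmult) (auto simp: mult_ac)
      also have "(\<integral>\<^sup>+x. ?D s * (ennreal (weight x) * indicator {s<..} (w x)) \<partial>M)
          = (\<integral>\<^sup>+x. (if 0 < s \<and> s < w x then ennreal (weight x) * ?D s else 0) \<partial>M)"
        using True by (intro nn_integral_cong) (auto simp: indicator_def mult.commute)
      finally show ?thesis .
    qed simp
  qed
  also have "\<dots> = ennreal (1 / (1 - \<theta>)) * (\<integral>\<^sup>+s. \<integral>\<^sup>+x. (if 0 < s \<and> s < w x then ennreal (weight x) * ?D s else 0) \<partial>M \<partial>lborel)"
    by (intro nn_integral_cmult) measurable
  also have "(\<integral>\<^sup>+s. \<integral>\<^sup>+x. (if 0 < s \<and> s < w x then ennreal (weight x) * ?D s else 0) \<partial>M \<partial>lborel)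
      = (\<integral>\<^sup>+x. \<integral>\<^sup>+s. (if 0 < s \<and> s < w x then ennreal (weight x) * ?D s else 0) \<partial>lborel \<partial>M)"
  proof -
    interpret pair_sigma_finite lborel M
      by (intro pair_sigma_finite.intro sigma_finite_lborel sigma_finite_measure_axioms)
    show ?thesis
      by (rule Fubini'[symmetric]) (simp add: split_beta', measurable)
  qed
  also have "\<dots> \<le> (\<integral>\<^sup>+x. ennreal (weight x) * ennreal (\<bar>w x\<bar> powr p) \<partial>M)"
  proof (rule nn_integral_mono)
    fix x
    have "(\<integral>\<^sup>+s. (if 0 < s \<and> s < w x then ennreal (weight x) * ?D s else 0) \<partial>lborel)
        \<le> (\<integral>\<^sup>+s. ennreal (weight x) * (?D s * indicator {s. 0 < s \<and> s < \<bar>w x\<bar>} s) \<partial>lborel)"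
      by (intro nn_integral_mono) (auto simp: indicator_def)
    also have "\<dots> = ennreal (weight x) * ennreal (\<bar>w x\<bar> powr p)"
      using layer_cake_powr[OF p, of "\<bar>w x\<bar>"] by (subst nn_integral_cmult) auto
    finally show "(\<integral>\<^sup>+s. (if 0 < s \<and> s < w x then ennreal (weight x) * ?D s else 0) \<partial>lborel)
        \<le> ennreal (weight x) * ennreal (\<bar>w x\<bar> powr p)" .
  qed
  also have "\<dots> \<le> K"
    by (intro pairing weight_weak_Lebesgue) (auto simp: weight_nonneg)
  finally show ?thesis
    using K by (auto simp: ennreal_mult_less_top mult_left_mono elim!: le_less_trans)
qed

end

end

section \<open>Embedding into the Lorentz space\<close>

lemma sigma_finite_lebesgue_on:
  assumes "S \<in> sets (lebesgue :: 'a::euclidean_space measure)"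
  shows "sigma_finite_measure (lebesgue_on S)"
proof -
  have "sigma_finite_measure (lebesgue :: 'a measure)"
  proof
    show "\<exists>A::'a set set. countable A \<and> A \<subseteq> sets lebesgue \<and> \<Union>A = space lebesgue \<and> (\<forall>a\<in>A. emeasure lebesgue a \<noteq> \<infinity>)"
      by (intro exI[of _ "range (\<lambda>n::nat. box (- real n *\<^sub>R One) (real n *\<^sub>R One))"])
        (auto simp: emeasure_lborel_box_eq UN_box_eq_UNIV)
  qed
  then show ?thesis using assms by (rule sigma_finite_measure_restrict_space)
qed

text \<open>By the layer-cake formula the p-th power of the rearrangement at t is bounded by an
  integral over the levels s below it, and at those the distribution function is at least t. So the
  Lorentz integral is dominated by the one in \<open>weak_Lebesgue_duality\<close> with \<theta> =
  p/N, the exponent of t being p times -1/N.\<close>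

lemma E_space_subset_Lorentz:
  fixes \<Omega> :: "'a::euclidean_space set"
  assumes op: "open \<Omega>" and p: "1 < p" "p < real DIM('a)" and u: "u \<in> E_space p \<Omega>"
  shows "u \<in> Lorentz (sobolev_exponent (real DIM('a)) p) p \<Omega>"
proof -
  define \<theta> where "\<theta> = p / real DIM('a)"
  have \<theta>: "0 < \<theta>" "\<theta> < 1" using p by (auto simp: \<theta>_def)
  have L: "\<Omega> \<in> sets lebesgue" using op by (simp add: borel_open)
  interpret sigma_finite_measure "lebesgue_on \<Omega>" using L by (rule sigma_finite_lebesgue_on)
  have uM: "u \<in> M_space \<Omega>" and fin: "assoc_norm p \<Omega> (abs_power p u) < \<infinity>"
    using u by (auto simp: E_space_iff)
  note um [measurable] = M_spaceD(1)[OF uM]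
  \<comment> \<open>The duality is stated for real functions; as u is finite a.e., the replacement
    changes neither integrals nor distribution function.\<close>
  define w where "w x = real_of_ereal \<bar>u x\<bar>" for x
  have wm: "w \<in> borel_measurable (lebesgue_on \<Omega>)" unfolding w_def[abs_def] by measurable
  have w: "\<bar>u x\<bar> = ereal (w x)" "0 \<le> w x" if "\<bar>u x\<bar> \<noteq> \<infinity>" for x
    using that by (auto simp: w_def)
  obtain C where C: "C > 0" "\<And>h (u :: 'a \<Rightarrow> ereal). h \<in> borel_measurable (lebesgue_on \<Omega>) \<Longrightarrow> (\<forall>x. 0 \<le> h x) \<Longrightarrow>
      (\<forall>F. F \<in> sets lebesgue \<longrightarrow> F \<subseteq> \<Omega> \<longrightarrow> emeasure lebesgue F < \<infinity> \<longrightarrow>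
        (\<integral>\<^sup>+x. ennreal (h x) \<partial>lebesgue_on F) \<le> ennreal (level_const \<theta> * measure lebesgue F powr (1 - p / real DIM('a)))) \<Longrightarrow>
      u \<in> borel_measurable (lebesgue_on \<Omega>) \<Longrightarrow>
      (\<integral>\<^sup>+x. ennreal (h x) * epowr (eabs (u x)) p \<partial>lebesgue_on \<Omega>) \<le> ennreal C * assoc_norm p \<Omega> (abs_power p u)"
    by (rule E_space_pairing_weak_Lebesgue[OF op p, of "level_const \<theta>"]) (rule that)
  let ?K = "ennreal C * assoc_norm p \<Omega> (abs_power p u)"
  let ?I = "\<lambda>t. \<integral>\<^sup>+s. ennreal (p * s powr (p - 1)) * indicator {s. 0 < s \<and> ennreal t \<le> emeasure (lebesgue_on \<Omega>) {x \<in> space (lebesgue_on \<Omega>). s < w x}} s \<partial>lborel"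
  have main: "(\<integral>\<^sup>+t. ennreal (t powr (- \<theta>)) * ?I t * indicator {0<..} t \<partial>lborel) < \<infinity>"
  proof (rule weak_Lebesgue_duality[OF wm \<theta>])
    show "0 < p" using p by simp
    show "?K < \<infinity>" using fin by (simp add: ennreal_mult_less_top)
    fix h :: "'a \<Rightarrow> real"
    assume h: "h \<in> borel_measurable (lebesgue_on \<Omega>)" "\<And>x. 0 \<le> h x"
      and weak: "\<And>F. F \<in> sets (lebesgue_on \<Omega>) \<Longrightarrow> emeasure (lebesgue_on \<Omega>) F < \<infinity> \<Longrightarrow>
        (\<integral>\<^sup>+x. ennreal (h x) * indicator F x \<partial>lebesgue_on \<Omega>) \<le> ennreal (level_const \<theta> * measure (lebesgue_on \<Omega>) F powr (1 - \<theta>))"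
    have "(\<integral>\<^sup>+x. ennreal (h x) * ennreal (\<bar>w x\<bar> powr p) \<partial>lebesgue_on \<Omega>)
        = (\<integral>\<^sup>+x. ennreal (h x) * epowr (eabs (u x)) p \<partial>lebesgue_on \<Omega>)"
    proof (rule nn_integral_cong_AE)
      show "AE x in lebesgue_on \<Omega>. ennreal (h x) * ennreal (\<bar>w x\<bar> powr p) = ennreal (h x) * epowr (eabs (u x)) p"
        using M_spaceD(2)[OF uM] by eventually_elim (simp add: eabs_def w)
    qed
    also have "\<dots> \<le> ?K"
    proof (rule C(2)[OF h(1) _ _ um]; intro allI impI)
      show "0 \<le> h x" for x by (rule h(2))
      fix F assume F: "F \<in> sets lebesgue" "F \<subseteq> \<Omega>" "emeasure lebesgue F < \<infinity>"
      have "F \<in> sets (lebesgue_on \<Omega>)" using F L by (simp add: sets_restrict_space_iff)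
      moreover have em: "emeasure (lebesgue_on \<Omega>) F = emeasure lebesgue F"
        using F L by (intro emeasure_restrict_space) auto
      ultimately show "(\<integral>\<^sup>+x. ennreal (h x) \<partial>lebesgue_on F) \<le> ennreal (level_const \<theta> * measure lebesgue F powr (1 - p / real DIM('a)))"
        using weak[of F] F(3) nn_integral_lebesgue_on_subset[OF F(1) L F(2), of "\<lambda>x. ennreal (h x)"]
        by (simp add: \<theta>_def measure_def)
    qed
    finally show "(\<integral>\<^sup>+x. ennreal (h x) * ennreal (\<bar>w x\<bar> powr p) \<partial>lebesgue_on \<Omega>) \<le> ?K" .
  qed
  let ?r = "sobolev_exponent (real DIM('a)) p"
  have exponent: "(1 / ?r - 1 / p) * p = - \<theta>"
    using p by (simp add: sobolev_exponent_def \<theta>_def field_simps)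
  have "(\<integral>\<^sup>+t\<in>{0<..}. epowr (ennreal (t powr (1 / ?r - 1 / p)) * rearrangement \<Omega> u t) p \<partial>lborel)
      \<le> (\<integral>\<^sup>+t. ennreal (t powr (- \<theta>)) * ?I t * indicator {0<..} t \<partial>lborel)"
  proof (intro nn_integral_mono mult_right_mono)
    fix t :: real
    have "epowr (ennreal (t powr (1 / ?r - 1 / p)) * rearrangement \<Omega> u t) p
        \<le> ennreal ((t powr (1 / ?r - 1 / p)) powr p) * epowr (rearrangement \<Omega> u t) p"
      by (rule epowr_cmult) simp
    also have "(t powr (1 / ?r - 1 / p)) powr p = t powr (- \<theta>)"
      by (simp add: powr_powr exponent)
    also have "epowr (rearrangement \<Omega> u t) p
        \<le> (\<integral>\<^sup>+s. ennreal (p * s powr (p - 1)) * indicator {s. 0 < s \<and> ennreal s < rearrangement \<Omega> u t} s \<partial>lborel)"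
      using p by (intro epowr_le_layer_cake) simp
    also have "\<dots> \<le> ?I t"
    proof (intro nn_integral_mono mult_left_mono)
      fix s :: real
      have "ennreal t \<le> emeasure (lebesgue_on \<Omega>) {x \<in> space (lebesgue_on \<Omega>). s < w x}"
        if s: "0 < s" "ennreal s < rearrangement \<Omega> u t"
      proof -
        have "\<not> emeasure lebesgue {x \<in> \<Omega>. ereal s < \<bar>u x\<bar>} < ennreal t"
        proof
          assume "emeasure lebesgue {x \<in> \<Omega>. ereal s < \<bar>u x\<bar>} < ennreal t"
          then have "rearrangement \<Omega> u t \<le> ennreal s"
            unfolding rearrangement_def using s(1) by (intro Inf_lower) auto
          then show False using s(2) by simp
        qed
        moreover have "emeasure lebesgue {x \<in> \<Omega>. ereal s < \<bar>u x\<bar>} = emeasure (lebesgue_on \<Omega>) {x \<in> space (lebesgue_on \<Omega>). ereal s < \<bar>u x\<bar>}"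
          using L by (subst emeasure_restrict_space) auto
        moreover have "\<dots> = emeasure (lebesgue_on \<Omega>) {x \<in> space (lebesgue_on \<Omega>). s < w x}"
        proof (rule emeasure_eq_AE)
          show "AE x in lebesgue_on \<Omega>. (x \<in> {x \<in> space (lebesgue_on \<Omega>). ereal s < \<bar>u x\<bar>}) = (x \<in> {x \<in> space (lebesgue_on \<Omega>). s < w x})"
            using M_spaceD(2)[OF uM] by eventually_elim (simp add: w)
          show "{x \<in> space (lebesgue_on \<Omega>). ereal s < \<bar>u x\<bar>} \<in> sets (lebesgue_on \<Omega>)"
            by measurable
          show "{x \<in> space (lebesgue_on \<Omega>). s < w x} \<in> sets (lebesgue_on \<Omega>)"
            using wm by measurable
        qed
        ultimately show ?thesis by simp
      qed
      then show "indicator {s. 0 < s \<and> ennreal s < rearrangement \<Omega> u t} s \<le>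
          (indicator {s. 0 < s \<and> ennreal t \<le> emeasure (lebesgue_on \<Omega>) {x \<in> space (lebesgue_on \<Omega>). s < w x}} s :: ennreal)"
        by (auto simp: indicator_def)
    qed simp
    finally show "epowr (ennreal (t powr (1 / ?r - 1 / p)) * rearrangement \<Omega> u t) p \<le> ennreal (t powr (- \<theta>)) * ?I t"
      by (simp add: mult_left_mono)
  qed simp
  also have "\<dots> < \<infinity>" by (rule main)
  finally show ?thesis using uM by (simp add: Lorentz_def)
qed

text \<open>Along a segment of unit length starting where \<open>\<bar>\<phi>\<bar> \<ge> 1\<close>, either \<open>\<bar>\<phi>\<bar> \<ge> 1/2\<close> throughout
  or the gradient has a substantial integral.\<close>

lemma segment_dichotomy:
  fixes \<phi> :: "'a::euclidean_space \<Rightarrow> real"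
  assumes sm: "smooth \<phi>" and p: "1 \<le> p" and x: "1 \<le> \<bar>\<phi> x\<bar>" and b: "norm b = 1"
  shows "1 \<le> ennreal (4 powr p) * (\<integral>\<^sup>+t. (ennreal (norm (gradient \<phi> (x + t *\<^sub>R b)) powr p)
    + indicator {y. 1 \<le> \<bar>2 * \<phi> y\<bar>} (x + t *\<^sub>R b)) * indicator {0..1} t \<partial>lborel)"
    (is "1 \<le> ennreal _ * ?I")
proof (cases "\<forall>t\<in>{0..1}. 1 \<le> \<bar>2 * \<phi> (x + t *\<^sub>R b)\<bar>")
  case True
  have "(1 :: ennreal) = (\<integral>\<^sup>+t. indicator {0..1 :: real} t \<partial>lborel)" by simp
  also have "\<dots> \<le> ?I"
    using True by (intro nn_integral_mono) (auto simp: indicator_def)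
  finally have "1 * 1 \<le> ennreal (4 powr p) * ?I"
    using p by (intro mult_mono) (auto simp: ge_one_powr_ge_zero)
  then show ?thesis by simp
next
  case False
  note [measurable] = borel_measurable_gradient[OF sm]
  obtain r where r: "0 \<le> r" "r \<le> 1" "\<bar>2 * \<phi> (x + r *\<^sub>R b)\<bar> < 1" using False by auto
  let ?g = "\<lambda>t. norm (gradient \<phi> (x + t *\<^sub>R b))"
  let ?J = "\<integral>\<^sup>+t. ennreal (?g t powr p) * indicator {0..1} t \<partial>lborel"
  \<comment> \<open>The drop of |\<phi>| up to r exceeds 1/2. The level 1/4 in
    \<open>le_add_powr\<close> absorbs half of it, and the rest gives 1/4 <= 4^(p-1) times the
    gradient integral.\<close>
  have "ennreal (1 / 2) \<le> ennreal \<bar>\<phi> (x + r *\<^sub>R b) - \<phi> x\<bar>"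
    using r x by (intro ennreal_leI) (auto simp: abs_if split: if_splits)
  also have "\<dots> \<le> (\<integral>\<^sup>+t. ennreal (?g t * norm b) * indicator {0..r} t \<partial>lborel)"
    by (rule smooth_segment_bound[OF sm r(1)])
  also have "\<dots> \<le> (\<integral>\<^sup>+t. ennreal (1 / 4) * indicator {0..1} t + ennreal ((1 / 4) powr (1 - p)) * (ennreal (?g t powr p) * indicator {0..1} t) \<partial>lborel)"
  proof (rule nn_integral_mono)
    fix t
    have "ennreal (?g t) \<le> ennreal (1 / 4 + (1 / 4) powr (1 - p) * ?g t powr p)"
      using le_add_powr[of "?g t" "1 / 4" p] p by (intro ennreal_leI) (simp add: mult.commute)
    also have "\<dots> = ennreal (1 / 4) + ennreal ((1 / 4) powr (1 - p)) * ennreal (?g t powr p)"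
      by (subst ennreal_plus) (auto simp: ennreal_mult)
    finally have "ennreal (?g t) \<le> ennreal (1 / 4) + ennreal ((1 / 4) powr (1 - p)) * ennreal (?g t powr p)" .
    then show "ennreal (?g t * norm b) * indicator {0..r} t \<le> ennreal (1 / 4) * indicator {0..1} t
        + ennreal ((1 / 4) powr (1 - p)) * (ennreal (?g t powr p) * indicator {0..1} t)"
      using r b by (auto simp: indicator_def)
  qed
  also have "\<dots> = ennreal (1 / 4) + ennreal ((1 / 4) powr (1 - p)) * ?J"
    by (subst nn_integral_add) (auto simp: nn_integral_cmult)
  finally have le: "ennreal (1 / 2) \<le> ennreal (1 / 4) + ennreal ((1 / 4) powr (1 - p)) * ?J" .
  have "1 \<le> ennreal (4 powr p) * ?J"
  proof (cases ?J rule: ennreal_cases)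
    case (real j)
    have eq: "(1 / 4 :: real) powr (1 - p) = 4 powr p / 4"
      by (simp add: powr_divide powr_diff)
    have "ennreal (1 / 2) \<le> ennreal (1 / 4) + ennreal (4 powr p / 4) * ennreal j"
      using le by (simp only: eq real)
    also have "\<dots> = ennreal (1 / 4 + 4 powr p / 4 * j)"
      using real by (subst ennreal_mult[symmetric]) (simp_all add: ennreal_plus)
    finally have "1 / 2 \<le> 1 / 4 + 4 powr p / 4 * j"
      by (subst (asm) ennreal_le_iff) (use real in simp_all)
    then have "1 \<le> 4 powr p * j"
      by (simp add: field_simps)
    then show ?thesis unfolding real using real by (simp add: ennreal_mult[symmetric])
  qed (simp add: ennreal_mult_top)
  also have "\<dots> \<le> ennreal (4 powr p) * ?I"
    by (intro mult_left_mono nn_integral_mono) (auto simp: indicator_def)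
  finally show ?thesis .
qed

text \<open>The dichotomy is integrated over starting points x in S and then read from the points y
  = x + t b: for fixed y the parameters t with y - t b in S lie in an interval of length 2 e. The
  thinness of the slab thus survives as a linear factor.\<close>

lemma slab_trace:
  fixes \<phi> :: "'a::euclidean_space \<Rightarrow> real"
  assumes sm: "smooth \<phi>" and p: "1 \<le> p" and b: "b \<in> Basis" and e: "0 \<le> e"
    and S [measurable]: "S \<in> sets borel" and slab: "\<And>x. x \<in> S \<Longrightarrow> \<bar>(x - a) \<bullet> b\<bar> \<le> e"
  shows "emeasure lborel (S \<inter> {x. 1 \<le> \<bar>\<phi> x\<bar>})
    \<le> ennreal (4 powr p) * (ennreal (2 * e) * (dirichlet p \<phi> + emeasure lborel {x. 1 \<le> \<bar>2 * \<phi> x\<bar>}))"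
proof -
  note [measurable] = borel_measurable_gradient[OF sm] borel_measurable_smooth[OF sm]
  define G where "G y = ennreal (norm (gradient \<phi> y) powr p) + indicator {y. 1 \<le> \<bar>2 * \<phi> y\<bar>} y" for y
  have sup [measurable]: "{y. 1 \<le> \<bar>2 * \<phi> y\<bar>} \<in> sets borel" "{x. 1 \<le> \<bar>\<phi> x\<bar>} \<in> sets borel"
    by (simp_all add: borel_closed closed_Collect_le continuous_intros smooth_continuous_on sm)
  have [measurable]: "G \<in> borel_measurable borel" unfolding G_def[abs_def] by measurable
  have "emeasure lborel (S \<inter> {x. 1 \<le> \<bar>\<phi> x\<bar>}) = (\<integral>\<^sup>+x. indicator (S \<inter> {x. 1 \<le> \<bar>\<phi> x\<bar>}) x \<partial>lborel)"
    by simp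
  also have "\<dots> \<le> (\<integral>\<^sup>+x. ennreal (4 powr p) * (\<integral>\<^sup>+t. indicator S x * (G (x + t *\<^sub>R b) * indicator {0..1} t) \<partial>lborel) \<partial>lborel)"
  proof (rule nn_integral_mono)
    fix x
    show "indicator (S \<inter> {x. 1 \<le> \<bar>\<phi> x\<bar>}) x \<le> ennreal (4 powr p) * (\<integral>\<^sup>+t. indicator S x * (G (x + t *\<^sub>R b) * indicator {0..1} t) \<partial>lborel)"
      using segment_dichotomy[OF sm p, of x b] b by (cases "x \<in> S \<inter> {x. 1 \<le> \<bar>\<phi> x\<bar>}") (auto simp: G_def)
  qed
  also have "\<dots> = ennreal (4 powr p) * (\<integral>\<^sup>+x. \<integral>\<^sup>+t. indicator S x * (G (x + t *\<^sub>R b) * indicator {0..1} t) \<partial>lborel \<partial>lborel)"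
    by (intro nn_integral_cmult) measurable
  also have "(\<integral>\<^sup>+x. \<integral>\<^sup>+t. indicator S x * (G (x + t *\<^sub>R b) * indicator {0..1} t) \<partial>lborel \<partial>lborel)
      = (\<integral>\<^sup>+t. \<integral>\<^sup>+x. indicator S x * (G (x + t *\<^sub>R b) * indicator {0..1} t) \<partial>lborel \<partial>lborel)"
    by (rule lborel_pair.Fubini') (simp add: split_beta', measurable)
  also have "\<dots> = (\<integral>\<^sup>+t. \<integral>\<^sup>+y. indicator S (y - t *\<^sub>R b) * (G y * indicator {0..1} t) \<partial>lborel \<partial>lborel)"
  proof (rule nn_integral_cong)
    fix t :: real
    have "(\<integral>\<^sup>+x. indicator S (t *\<^sub>R b + x - t *\<^sub>R b) * (G (t *\<^sub>R b + x) * indicator {0..1} t) \<partial>lborel)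
        = (\<integral>\<^sup>+y. indicator S (y - t *\<^sub>R b) * (G y * indicator {0..1} t) \<partial>lborel)"
      by (rule nn_integral_translate) measurable
    then show "(\<integral>\<^sup>+x. indicator S x * (G (x + t *\<^sub>R b) * indicator {0..1} t) \<partial>lborel)
        = (\<integral>\<^sup>+y. indicator S (y - t *\<^sub>R b) * (G y * indicator {0..1} t) \<partial>lborel)"
      by (simp add: add.commute)
  qed
  also have "\<dots> = (\<integral>\<^sup>+y. \<integral>\<^sup>+t. indicator S (y - t *\<^sub>R b) * (G y * indicator {0..1} t) \<partial>lborel \<partial>lborel)"
    by (rule lborel_pair.Fubini') (simp add: split_beta', measurable)
  also have "\<dots> \<le> (\<integral>\<^sup>+y. ennreal (2 * e) * G y \<partial>lborel)"
  proof (rule nn_integral_mono)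
    fix y :: 'a
    let ?c = "(y - a) \<bullet> b"
    have "(\<integral>\<^sup>+t. indicator S (y - t *\<^sub>R b) * (G y * indicator {0..1} t) \<partial>lborel)
        \<le> (\<integral>\<^sup>+t. G y * indicator {?c - e..?c + e} t \<partial>lborel)"
    proof (rule nn_integral_mono)
      fix t :: real
      have "t \<in> {?c - e..?c + e}" if "y - t *\<^sub>R b \<in> S"
        using slab[OF that] b by (simp add: inner_diff_left abs_le_iff algebra_simps)
      then show "indicator S (y - t *\<^sub>R b) * (G y * indicator {0..1} t) \<le> G y * indicator {?c - e..?c + e} t"
        by (auto simp: indicator_def)
    qed
    also have "\<dots> = ennreal (2 * e) * G y"
      using e by (subst nn_integral_cmult_indicator) (auto simp: mult.commute)
    finally show "(\<integral>\<^sup>+t. indicator S (y - t *\<^sub>R b) * (G y * indicator {0..1} t) \<partial>lborel) \<le> ennreal (2 * e) * G y" .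
  qed
  also have "\<dots> = ennreal (2 * e) * (\<integral>\<^sup>+y. G y \<partial>lborel)"
    by (rule nn_integral_cmult) measurable
  also have "(\<integral>\<^sup>+y. G y \<partial>lborel) = dirichlet p \<phi> + emeasure lborel {x. 1 \<le> \<bar>2 * \<phi> x\<bar>}"
    unfolding G_def dirichlet_def by (subst nn_integral_add) auto
  finally show ?thesis by (simp add: mult_left_mono)
qed

section \<open>Weights on slabs\<close>

text \<open>The constant must not depend on e; this uniformity carries the counterexample. For
  energy at least 1 the volume bound k e suffices. For smaller energy the factor e from
  \<open>slab_trace\<close> cancels the 1/e of the weight, and the Sobolev power N/(N-p) > 1 of the
  energy is at most the energy itself.\<close>

lemma slab_weight_bound:
  fixes \<Omega> :: "'a::euclidean_space set" and a b :: 'a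
  assumes op: "open \<Omega>" and p: "1 < p" "p < real DIM('a)" and b: "b \<in> Basis" and k: "0 < k"
  obtains c where "0 < c" "\<And>S e \<phi>. S \<in> sets borel \<Longrightarrow> S \<subseteq> \<Omega> \<Longrightarrow> 0 < e \<Longrightarrow> (\<forall>x\<in>S. \<bar>(x - a) \<bullet> b\<bar> \<le> e) \<Longrightarrow>
    emeasure lborel S \<le> ennreal (k * e) \<Longrightarrow> \<phi> \<in> test_functions \<Omega> \<Longrightarrow>
    (\<integral>\<^sup>+x. ennreal (indicator S x / e) * indicator {x. 1 \<le> \<bar>\<phi> x\<bar>} x \<partial>lebesgue_on \<Omega>) \<le> ennreal c * dirichlet p \<phi>"
proof -
  define N where "N = real DIM('a)"
  obtain C where C: "C > 0" "\<And>(\<phi> :: 'a \<Rightarrow> real) \<Omega> e. \<phi> \<in> test_functions \<Omega> \<Longrightarrow> 0 < e \<Longrightarrow> dirichlet p \<phi> \<le> ennreal e \<Longrightarrow>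
      emeasure lborel {x. 1 \<le> \<bar>\<phi> x\<bar>} \<le> ennreal (C * e powr (N / (N - p)))"
    by (rule weak_sobolev[OF p, folded N_def]) (rule that)
  define D where "D = 1 + C * (2 powr p) powr (N / (N - p))"
  have D: "D > 0" using C(1) by (simp add: D_def add_pos_nonneg)
  define c where "c = k + 4 powr p * 2 * D"
  have c: "c > 0" using k D by (simp add: c_def add_pos_nonneg)
  have L: "\<Omega> \<in> sets lebesgue" using op by (simp add: borel_open)
  show thesis
  proof (rule that[OF c])
    fix S :: "'a set" and e :: real and \<phi>
    assume S: "S \<in> sets borel" "S \<subseteq> \<Omega>" and e: "0 < e" and slab: "\<forall>x\<in>S. \<bar>(x - a) \<bullet> b\<bar> \<le> e"
      and vol: "emeasure lborel S \<le> ennreal (k * e)" and phi: "\<phi> \<in> test_functions \<Omega>"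
    note sm = test_functions_smooth[OF phi]
    let ?F = "{x. 1 \<le> \<bar>\<phi> x\<bar>}"
    have F [measurable]: "?F \<in> sets borel"
      by (simp add: borel_closed closed_Collect_le continuous_intros smooth_continuous_on sm)
    note [measurable] = S(1)
    obtain E where E: "dirichlet p \<phi> = ennreal E" "E \<ge> 0"
      using dirichlet_finite[OF phi, of p] p by (cases "dirichlet p \<phi>" rule: ennreal_cases) auto
    have "(\<integral>\<^sup>+x. ennreal (indicator S x / e) * indicator ?F x \<partial>lebesgue_on \<Omega>)
        = (\<integral>\<^sup>+x. ennreal (indicator S x / e) * indicator ?F x \<partial>lborel)"
      using S(2) by (intro nn_integral_lebesgue_on_eq_lborel L) (auto simp: indicator_def)
    also have "\<dots> = (\<integral>\<^sup>+x. ennreal (1 / e) * indicator (S \<inter> ?F) x \<partial>lborel)"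
      by (intro nn_integral_cong) (auto simp: indicator_def)
    also have "\<dots> = ennreal (1 / e) * emeasure lborel (S \<inter> ?F)"
      by (rule nn_integral_cmult_indicator) simp
    finally have eq: "(\<integral>\<^sup>+x. ennreal (indicator S x / e) * indicator ?F x \<partial>lebesgue_on \<Omega>) = ennreal (1 / e) * emeasure lborel (S \<inter> ?F)" .
    have "ennreal (1 / e) * emeasure lborel (S \<inter> ?F) \<le> ennreal (c * E)"
    proof (rule ennreal_le_epsilon)
      fix d :: real assume d: "0 < d"
      \<comment> \<open>\<open>weak_sobolev\<close> asks for a positive bound; r exceeds the energy
        by d/c, which the epsilon argument absorbs.\<close>
      define r where "r = E + d / c"
      have r: "0 < r" "E \<le> r" using E(2) d c by (auto simp: r_def add_nonneg_pos)
      have "ennreal (1 / e) * emeasure lborel (S \<inter> ?F) \<le> ennreal (c * r)"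
      proof (cases "1 \<le> r")
        case True
        have "ennreal (1 / e) * emeasure lborel (S \<inter> ?F) \<le> ennreal (1 / e) * ennreal (k * e)"
          by (intro mult_left_mono order_trans[OF emeasure_mono vol]) auto
        also have "\<dots> = ennreal k" using e k by (simp add: ennreal_mult[symmetric])
        also have "\<dots> \<le> ennreal (c * r)"
        proof (rule ennreal_leI)
          have "k \<le> c * 1" using D by (simp add: c_def)
          also have "\<dots> \<le> c * r" using True c by (intro mult_left_mono) auto
          finally show "k \<le> c * r" .
        qed
        finally show ?thesis .
      next
        case False
        have phi2: "(\<lambda>x. 2 * \<phi> x) \<in> test_functions \<Omega>"
          by (intro test_functions_mult phi smooth_const)
        have "dirichlet p (\<lambda>x. 2 * \<phi> x) = ennreal (2 powr p * E)"
          using E by (simp add: dirichlet_cmult[OF phi] ennreal_mult)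
        also have "\<dots> \<le> ennreal (2 powr p * r)"
          using r by (intro ennreal_leI mult_left_mono) auto
        finally have "emeasure lborel {x. 1 \<le> \<bar>2 * \<phi> x\<bar>} \<le> ennreal (C * (2 powr p * r) powr (N / (N - p)))"
          using r by (intro C(2)[OF phi2]) auto
        also have "C * (2 powr p * r) powr (N / (N - p)) \<le> C * ((2 powr p) powr (N / (N - p)) * r)"
        proof -
          have "r powr (N / (N - p)) \<le> r powr 1"
            using r False p by (intro powr_mono') (auto simp: N_def field_simps)
          then show ?thesis using r C(1) by (simp add: powr_mult)
        qed
        finally have em2: "emeasure lborel {x. 1 \<le> \<bar>2 * \<phi> x\<bar>} \<le> ennreal (C * ((2 powr p) powr (N / (N - p)) * r))"
          by (simp add: ennreal_leI)
        have "emeasure lborel (S \<inter> ?F) \<le> ennreal (4 powr p) * (ennreal (2 * e) * (dirichlet p \<phi> + emeasure lborel {x. 1 \<le> \<bar>2 * \<phi> x\<bar>}))"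
          using p e slab by (intro slab_trace[OF sm _ b _ S(1), where a = a]) auto
        also have "\<dots> \<le> ennreal (4 powr p) * (ennreal (2 * e) * (ennreal r + ennreal (C * ((2 powr p) powr (N / (N - p)) * r))))"
          using r E by (intro mult_left_mono add_mono em2) (auto intro: ennreal_leI)
        also have "ennreal r + ennreal (C * ((2 powr p) powr (N / (N - p)) * r)) = ennreal (D * r)"
          using r C(1) by (subst ennreal_plus[symmetric]) (auto simp: D_def algebra_simps)
        also have "ennreal (4 powr p) * (ennreal (2 * e) * ennreal (D * r)) = ennreal (4 powr p * (2 * e * (D * r)))"
          using e D r by (simp add: ennreal_mult)
        finally have "ennreal (1 / e) * emeasure lborel (S \<inter> ?F) \<le> ennreal (1 / e) * ennreal (4 powr p * (2 * e * (D * r)))"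
          by (intro mult_left_mono) auto
        also have "\<dots> = ennreal (4 powr p * 2 * D * r)"
          using e D r by (simp add: ennreal_mult[symmetric])
        also have "\<dots> \<le> ennreal (c * r)"
          using k r by (intro ennreal_leI mult_right_mono) (auto simp: c_def)
        finally show ?thesis .
      qed
      also have "c * r = c * E + d" using c by (simp add: r_def distrib_left)
      finally show "ennreal (1 / e) * emeasure lborel (S \<inter> ?F) \<le> ennreal (c * E) + ennreal d"
        using c E d by simp
    qed
    also have "\<dots> = ennreal c * dirichlet p \<phi>" using c E by (simp add: ennreal_mult)
    finally show "(\<integral>\<^sup>+x. ennreal (indicator S x / e) * indicator ?F x \<partial>lebesgue_on \<Omega>) \<le> ennreal c * dirichlet p \<phi>"
      by (simp only: eq)
  qed
qed

text \<open>Moving the corners of the cube by (l - e) b shrinks only the side in direction b, from 2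
  l to 2 e; as a box the slab has a product formula for its volume.\<close>

lemma emeasure_cbox_slab:
  fixes a b :: "'a::euclidean_space"
  assumes b: "b \<in> Basis" and e: "0 \<le> e" "e \<le> l"
  defines "S \<equiv> cbox (a - l *\<^sub>R One + (l - e) *\<^sub>R b) (a + l *\<^sub>R One - (l - e) *\<^sub>R b)"
  shows "S = {x \<in> cbox (a - l *\<^sub>R One) (a + l *\<^sub>R One). \<bar>(x - a) \<bullet> b\<bar> \<le> e}"
    and "emeasure lborel S = ennreal (2 * e * (2 * l) ^ (DIM('a) - 1))"
proof -
  have coord: "(a - l *\<^sub>R One + (l - e) *\<^sub>R b) \<bullet> i = (if i = b then a \<bullet> i - e else a \<bullet> i - l)"
    "(a + l *\<^sub>R One - (l - e) *\<^sub>R b) \<bullet> i = (if i = b then a \<bullet> i + e else a \<bullet> i + l)" if "i \<in> Basis" for i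
    using that b by (auto simp: inner_diff_left inner_add_left inner_Basis)
  have memS: "x \<in> S \<longleftrightarrow> (\<forall>i\<in>Basis. (if i = b then a \<bullet> i - e else a \<bullet> i - l) \<le> x \<bullet> i
      \<and> x \<bullet> i \<le> (if i = b then a \<bullet> i + e else a \<bullet> i + l))" for x
    unfolding S_def mem_box by (intro ball_cong refl) (simp only: coord)
  have memQ: "x \<in> cbox (a - l *\<^sub>R One) (a + l *\<^sub>R One) \<longleftrightarrow> (\<forall>i\<in>Basis. a \<bullet> i - l \<le> x \<bullet> i \<and> x \<bullet> i \<le> a \<bullet> i + l)" for x
    by (simp add: mem_box inner_diff_left inner_add_left)
  have "x \<in> S \<longleftrightarrow> x \<in> cbox (a - l *\<^sub>R One) (a + l *\<^sub>R One) \<and> \<bar>(x - a) \<bullet> b\<bar> \<le> e" for x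
  proof
    assume "x \<in> S"
    then have x: "\<forall>i\<in>Basis. (if i = b then a \<bullet> i - e else a \<bullet> i - l) \<le> x \<bullet> i
        \<and> x \<bullet> i \<le> (if i = b then a \<bullet> i + e else a \<bullet> i + l)"
      by (simp only: memS)
    have "a \<bullet> i - l \<le> x \<bullet> i \<and> x \<bullet> i \<le> a \<bullet> i + l" if "i \<in> Basis" for i
      using bspec[OF x that] e by (cases "i = b") auto
    moreover have "\<bar>(x - a) \<bullet> b\<bar> \<le> e"
      using bspec[OF x b] by (auto simp: inner_diff_left abs_le_iff)
    ultimately show "x \<in> cbox (a - l *\<^sub>R One) (a + l *\<^sub>R One) \<and> \<bar>(x - a) \<bullet> b\<bar> \<le> e"
      by (simp only: memQ) blast
  next
    assume "x \<in> cbox (a - l *\<^sub>R One) (a + l *\<^sub>R One) \<and> \<bar>(x - a) \<bullet> b\<bar> \<le> e"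
    then show "x \<in> S"
      unfolding memS memQ inner_diff_left by (auto simp: abs_le_iff)
  qed
  then show "S = {x \<in> cbox (a - l *\<^sub>R One) (a + l *\<^sub>R One). \<bar>(x - a) \<bullet> b\<bar> \<le> e}" by blast
  let ?u = "a + l *\<^sub>R One - (l - e) *\<^sub>R b" and ?v = "a - l *\<^sub>R One + (l - e) *\<^sub>R b"
  have "emeasure lborel S = ennreal (\<Prod>i\<in>Basis. (?u - ?v) \<bullet> i)"
    unfolding S_def using e by (intro emeasure_lborel_cbox) (simp add: coord)
  also have "(\<Prod>i\<in>Basis. (?u - ?v) \<bullet> i) = (\<Prod>i\<in>Basis. if i = b then 2 * e else 2 * l)"
  proof (intro prod.cong refl)
    fix i :: 'a assume i: "i \<in> Basis"
    show "(?u - ?v) \<bullet> i = (if i = b then 2 * e else 2 * l)"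
      unfolding inner_diff_left[of ?u ?v] coord[OF i] by simp
  qed
  also have "\<dots> = 2 * e * (\<Prod>i\<in>Basis - {b}. if i = b then 2 * e else 2 * l)"
    using b by (subst prod.remove[of _ b]) auto
  also have "(\<Prod>i\<in>Basis - {b}. if i = b then 2 * e else 2 * l) = (\<Prod>i\<in>Basis - {b}. 2 * l)"
    by (intro prod.cong) auto
  also have "\<dots> = (2 * l) ^ (DIM('a) - 1)"
    using b by (simp add: card_Diff_singleton)
  finally show "emeasure lborel S = ennreal (2 * e * (2 * l) ^ (DIM('a) - 1))" .
qed

text \<open>The function is |(x - a) . b|^(-\<gamma>) on a small cube. Its rearrangement is at most
  a multiple of t^(-\<gamma>), so the Lorentz integrand is of order at most t^(-\<theta> - \<gamma>
  p) near 0, whereas the slab weights of width e see a mean of order at least e^(-\<gamma> p), which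
  diverges.\<close>

lemma exists_Lorentz_not_E_space:
  fixes \<Omega> :: "'a::euclidean_space set"
  assumes op: "open \<Omega>" and ne: "\<Omega> \<noteq> {}" and p: "1 < p" "p < real DIM('a)"
  shows "\<exists>u. u \<in> Lorentz (sobolev_exponent (real DIM('a)) p) p \<Omega> \<and> u \<notin> E_space p \<Omega>"
proof -
  obtain a where "a \<in> \<Omega>" using ne by blast
  then obtain r where r: "0 < r" "cball a r \<subseteq> \<Omega>"
    using op open_contains_cball by blast
  \<comment> \<open>The Euclidean norm is at most the sum of the absolute coordinates, so a cube of
    half-side r/N fits into the ball.\<close>
  define l where "l = r / real DIM('a)"
  have "cbox (a - l *\<^sub>R One) (a + l *\<^sub>R One) \<subseteq> cball a r"
  proof
    fix x assume "x \<in> cbox (a - l *\<^sub>R One) (a + l *\<^sub>R One)"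
    then have "\<bar>(x - a) \<bullet> i\<bar> \<le> l" if "i \<in> Basis" for i
      using that by (auto simp: mem_box inner_diff_left inner_add_left abs_le_iff dest!: bspec[of _ _ i])
    then have "(\<Sum>i\<in>Basis. \<bar>(x - a) \<bullet> i\<bar>) \<le> (\<Sum>i\<in>(Basis :: 'a set). l)"
      by (intro sum_mono)
    then have "norm (x - a) \<le> r"
      using norm_le_l1[of "x - a"] by (simp add: l_def)
    then show "x \<in> cball a r" by (simp add: dist_norm norm_minus_commute)
  qed
  then have l: "0 < l" "cbox (a - l *\<^sub>R One) (a + l *\<^sub>R One) \<subseteq> \<Omega>"
    using r by (auto simp: l_def)
  obtain b :: 'a where b: "b \<in> Basis" using nonempty_Basis by blast
  define \<theta> where "\<theta> = p / real DIM('a)"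
  have \<theta>: "0 < \<theta>" "\<theta> < 1" using p by (auto simp: \<theta>_def)
  \<comment> \<open>The midpoint of the range 0 < \<gamma> p < 1 - \<theta>: the lower end makes the
    slab means diverge, the upper end keeps the Lorentz integral finite.\<close>
  define \<gamma> where "\<gamma> = (1 - \<theta>) / (2 * p)"
  have \<gamma>: "0 < \<gamma>" "\<gamma> * p = (1 - \<theta>) / 2" using \<theta> p by (auto simp: \<gamma>_def)
  let ?Q = "cbox (a - l *\<^sub>R One) (a + l *\<^sub>R One)"
  define S where "S e = {x \<in> ?Q. \<bar>(x - a) \<bullet> b\<bar> \<le> e}" for e
  define v where "v x = (if x \<in> ?Q then \<bar>(x - a) \<bullet> b\<bar> powr (- \<gamma>) else 0)" for x
  let ?u = "\<lambda>x. ereal (v x)"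
  have L: "\<Omega> \<in> sets lebesgue" using op by (simp add: borel_open)
  have vb: "v \<in> borel_measurable borel"
  proof -
    have "(\<lambda>x. if x \<in> ?Q then \<bar>(x - a) \<bullet> b\<bar> powr (- \<gamma>) else 0) \<in> borel_measurable borel"
      by measurable
    then show ?thesis by (simp add: v_def[abs_def])
  qed
  then have vm: "v \<in> borel_measurable (lebesgue_on \<Omega>)"
    by (intro measurable_restrict_space1 measurable_completion) simp
  then have uM: "?u \<in> M_space \<Omega>" by (simp add: M_space_def)
  define k where "k = 2 * (2 * l) ^ (DIM('a) - 1)"
  have k: "k > 0" using l by (simp add: k_def)
  have Sb: "S e \<in> sets borel" if "0 \<le> e" "e \<le> l" for e
    unfolding S_def emeasure_cbox_slab(1)[OF b that, symmetric] by simp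
  have vol: "emeasure lborel (S e) = ennreal (k * e)" if "0 \<le> e" "e \<le> l" for e
    unfolding S_def emeasure_cbox_slab(1)[OF b that, symmetric] emeasure_cbox_slab(2)[OF b that]
    by (simp add: k_def mult_ac)
  have "?u \<notin> E_space p \<Omega>"
  proof
    assume "?u \<in> E_space p \<Omega>"
    then obtain K where K: "assoc_norm p \<Omega> (abs_power p ?u) = ennreal K" "0 \<le> K"
      by (cases "assoc_norm p \<Omega> (abs_power p ?u)" rule: ennreal_cases) (auto simp: E_space_iff)
    obtain c where c: "0 < c" "\<And>S e \<phi>. S \<in> sets borel \<Longrightarrow> S \<subseteq> \<Omega> \<Longrightarrow> 0 < e \<Longrightarrow> (\<forall>x\<in>S. \<bar>(x - a) \<bullet> b\<bar> \<le> e) \<Longrightarrow>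
        emeasure lborel S \<le> ennreal (k * e) \<Longrightarrow> \<phi> \<in> test_functions \<Omega> \<Longrightarrow>
        (\<integral>\<^sup>+x. ennreal (indicator S x / e) * indicator {x. 1 \<le> \<bar>\<phi> x\<bar>} x \<partial>lebesgue_on \<Omega>) \<le> ennreal c * dirichlet p \<phi>"
      by (rule slab_weight_bound[OF op p b k, of a]) (rule that)
    have bound: "e powr (- \<gamma> * p) * (k / 2) \<le> c * 4 powr p * K" if e: "0 < e" "e \<le> l" for e
    proof -
      have SQ: "S e \<subseteq> \<Omega>" using l(2) by (auto simp: S_def)
      have Se [measurable]: "S e \<in> sets borel" "S (e / 2) \<in> sets borel" using e by (auto intro: Sb)
      have pair: "(\<integral>\<^sup>+x. ennreal (indicator (S e) x / e) * epowr (eabs (?u x)) p \<partial>lebesgue_on \<Omega>)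
          \<le> ennreal (c * 4 powr p) * assoc_norm p \<Omega> (abs_power p ?u)"
      proof (rule E_space_pairing[OF op p(1) c(1)])
        have "(\<lambda>x. indicator (S e) x / e) \<in> borel_measurable borel" by measurable
        then show "(\<lambda>x. indicator (S e) x / e) \<in> borel_measurable (lebesgue_on \<Omega>)"
          by (intro measurable_restrict_space1 measurable_completion) simp
        show "0 \<le> indicator (S e) x / e" for x using e by simp
        show "?u \<in> borel_measurable (lebesgue_on \<Omega>)" using uM by (rule M_spaceD)
        show "(\<integral>\<^sup>+x. ennreal (indicator (S e) x / e) * indicator {x. 1 \<le> \<bar>\<phi> x\<bar>} x \<partial>lebesgue_on \<Omega>) \<le> ennreal c * dirichlet p \<phi>"
          if "\<phi> \<in> test_functions \<Omega>" for \<phi>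
          using e that by (intro c(2) SQ Se) (auto simp: S_def[of e] vol[symmetric])
        fix X :: "'a set" assume X: "compact X" "X \<subseteq> \<Omega>"
        have XL: "X \<in> sets lebesgue" using X(1) by (simp add: borel_compact)
        have "(\<integral>\<^sup>+x. ennreal (indicator (S e) x / e) \<partial>lebesgue_on X) \<le> (\<integral>\<^sup>+x. ennreal (1 / e) * indicator X x \<partial>lebesgue)"
          unfolding nn_integral_lebesgue_on[OF XL] using e
          by (intro nn_integral_mono) (auto simp: indicator_def)
        also have "\<dots> = ennreal (1 / e) * emeasure lborel X"
          using XL X(1) by (simp add: nn_integral_cmult_indicator borel_compact)
        also have "\<dots> < \<infinity>" using emeasure_compact_finite[OF X(1)] by (simp add: ennreal_mult_less_top)
        finally show "(\<integral>\<^sup>+x. ennreal (indicator (S e) x / e) \<partial>lebesgue_on X) < \<infinity>" .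
      qed
      \<comment> \<open>The inner half of the slab is discarded because v is 0 on the hyperplane
        itself, by the convention for \<open>powr\<close>. The outer half has volume k e/2, and
        |v|^p >= e^(-\<gamma> p) there.\<close>
      have "ennreal (e powr (- \<gamma> * p) / e * (k * e / 2)) = ennreal (e powr (- \<gamma> * p) / e) * ennreal (k * e / 2)"
        using e k by (intro ennreal_mult) auto
      also have "ennreal (k * e / 2) = emeasure lborel (S e - S (e / 2))"
      proof -
        have "S (e / 2) \<subseteq> S e" using e by (auto simp: S_def)
        then have "emeasure lborel (S e - S (e / 2)) = emeasure lborel (S e) - emeasure lborel (S (e / 2))"
          using Se vol[of "e / 2"] e by (intro emeasure_Diff) auto
        also have "\<dots> = ennreal (k * e - k * (e / 2))"
          using e k by (simp add: vol ennreal_minus)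
        finally show ?thesis by (simp add: mult.commute)
      qed
      also have "ennreal (e powr (- \<gamma> * p) / e) * emeasure lborel (S e - S (e / 2))
          = (\<integral>\<^sup>+x. ennreal (e powr (- \<gamma> * p) / e) * indicator (S e - S (e / 2)) x \<partial>lborel)"
        by (rule nn_integral_cmult_indicator[symmetric]) simp
      also have "\<dots> = (\<integral>\<^sup>+x. ennreal (e powr (- \<gamma> * p) / e) * indicator (S e - S (e / 2)) x \<partial>lebesgue_on \<Omega>)"
        using SQ by (intro nn_integral_lebesgue_on_eq_lborel[symmetric] L) (auto simp: indicator_def)
      also have "\<dots> \<le> (\<integral>\<^sup>+x. ennreal (indicator (S e) x / e) * epowr (eabs (?u x)) p \<partial>lebesgue_on \<Omega>)"
      proof (rule nn_integral_mono)
        fix x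
        show "ennreal (e powr (- \<gamma> * p) / e) * indicator (S e - S (e / 2)) x \<le> ennreal (indicator (S e) x / e) * epowr (eabs (?u x)) p"
        proof (cases "x \<in> S e - S (e / 2)")
          case True
          then have x: "x \<in> ?Q" "e / 2 < \<bar>(x - a) \<bullet> b\<bar>" "\<bar>(x - a) \<bullet> b\<bar> \<le> e" by (auto simp: S_def)
          have "e powr (- \<gamma> * p) \<le> \<bar>(x - a) \<bullet> b\<bar> powr (- \<gamma> * p)"
            using x e \<gamma> p by (intro powr_mono2') auto
          also have "\<dots> = \<bar>v x\<bar> powr p" using x by (simp add: v_def powr_powr)
          finally have "ennreal (e powr (- \<gamma> * p) / e) \<le> ennreal (1 / e * \<bar>v x\<bar> powr p)"
            using e by (intro ennreal_leI) (simp add: divide_right_mono)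
          also have "\<dots> = ennreal (1 / e) * ennreal (\<bar>v x\<bar> powr p)"
            using e by (intro ennreal_mult) auto
          finally show ?thesis using True by simp
        qed simp
      qed
      also have "\<dots> \<le> ennreal (c * 4 powr p) * ennreal K" using pair by (simp only: K)
      also have "\<dots> = ennreal (c * 4 powr p * K)" using c K by (intro ennreal_mult[symmetric]) auto
      finally have "e powr (- \<gamma> * p) / e * (k * e / 2) \<le> c * 4 powr p * K"
        using c K by (subst (asm) ennreal_le_iff) auto
      then show ?thesis using e by simp
    qed
    \<comment> \<open>By \<open>bound\<close>, e^(-\<gamma> p) would be at most T for all small e;
      the e chosen here makes it at least T + 1.\<close>
    define T where "T = c * 4 powr p * K / (k / 2)"
    have T: "T \<ge> 0" using c K k by (simp add: T_def)
    define e where "e = min l ((T + 1) powr (- 1 / (\<gamma> * p)))"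
    have e: "0 < e" "e \<le> l" using l T by (auto simp: e_def)
    have gp: "\<gamma> * p > 0" using \<gamma> p by simp
    have "T + 1 = ((T + 1) powr (- 1 / (\<gamma> * p))) powr (- (\<gamma> * p))"
      using T \<gamma>(1) p by (simp add: powr_powr)
    also have "\<dots> \<le> e powr (- (\<gamma> * p))"
      using e gp by (intro powr_mono2') (auto simp: e_def)
    also have "\<dots> \<le> T"
      using bound[OF e] k by (simp add: T_def field_simps)
    finally show False by simp
  qed
  moreover have "?u \<in> Lorentz (sobolev_exponent (real DIM('a)) p) p \<Omega>"
  proof -
    \<comment> \<open>A value above s forces the distance to the hyperplane to be at most
      s^(-1/\<gamma>), and the cube caps it at l.\<close>
    have dist: "emeasure lebesgue {x \<in> \<Omega>. ereal s < \<bar>?u x\<bar>} \<le> ennreal (k * min l (s powr (- 1 / \<gamma>)))" if s: "0 < s" for s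
    proof -
      define e where "e = min l (s powr (- 1 / \<gamma>))"
      have e: "0 \<le> e" "e \<le> l" using l s by (auto simp: e_def)
      have "{x \<in> \<Omega>. ereal s < \<bar>?u x\<bar>} \<subseteq> S e"
      proof
        fix x assume "x \<in> {x \<in> \<Omega>. ereal s < \<bar>?u x\<bar>}"
        then have x: "s < \<bar>v x\<bar>" by simp
        then have Q: "x \<in> ?Q" using s by (auto simp: v_def split: if_splits)
        define y where "y = \<bar>(x - a) \<bullet> b\<bar>"
        have sy: "s < y powr (- \<gamma>)" using x Q by (simp add: v_def y_def)
        then have "y \<noteq> 0" using s by auto
        then have y: "y > 0" by (simp add: y_def)
        have "(y powr (- \<gamma>)) powr (- 1 / \<gamma>) \<le> s powr (- 1 / \<gamma>)"
          using s sy \<gamma> by (intro powr_mono2') auto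
        then have "y \<le> s powr (- 1 / \<gamma>)" using y \<gamma> by (simp add: powr_powr)
        moreover have "y \<le> l"
          using Q b by (auto simp: y_def mem_box inner_diff_left inner_add_left abs_le_iff dest!: bspec[of _ _ b])
        ultimately show "x \<in> S e" using Q by (simp add: S_def y_def e_def)
      qed
      then have "emeasure lebesgue {x \<in> \<Omega>. ereal s < \<bar>?u x\<bar>} \<le> emeasure lebesgue (S e)"
        using Sb[OF e] by (intro emeasure_mono) auto
      also have "\<dots> = ennreal (k * e)" using vol[OF e] Sb[OF e] by simp
      finally show ?thesis by (simp add: e_def)
    qed
    \<comment> \<open>The factor 2 creates room: the rearrangement asks for measure strictly below
      t, and the chosen level gives at most t/2.\<close>
    have r1: "rearrangement \<Omega> ?u t \<le> ennreal ((2 * k / t) powr \<gamma>)" if t: "0 < t" for t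
      unfolding rearrangement_def
    proof (rule Inf_lower, intro CollectI exI conjI)
      let ?s = "(2 * k / t) powr \<gamma>"
      show "0 < ?s" using t k by simp
      have "?s powr (- 1 / \<gamma>) = t / (2 * k)"
        using \<gamma> t k by (simp add: powr_powr powr_minus)
      then have "k * min l (?s powr (- 1 / \<gamma>)) \<le> k * (t / (2 * k))"
        using k by (intro mult_left_mono) auto
      also have "\<dots> < t" using k t by simp
      finally have "ennreal (k * min l (?s powr (- 1 / \<gamma>))) < ennreal t"
        using t by (intro ennreal_lessI)
      then show "emeasure lebesgue {x \<in> \<Omega>. ereal ?s < \<bar>?u x\<bar>} < ennreal t"
        using dist[OF \<open>0 < ?s\<close>] by (rule le_less_trans[rotated])
    qed simp
    \<comment> \<open>Beyond k l, the volume of the cube, the rearrangement vanishes, so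
      integrability is at stake only at t = 0.\<close>
    have r2: "rearrangement \<Omega> ?u t = 0" if t: "k * l < t" for t
    proof -
      have small: "rearrangement \<Omega> ?u t \<le> 0 + ennreal s" if s: "0 < s" for s
      proof -
        have "k * min l (s powr (- 1 / \<gamma>)) < t"
        proof -
          have "k * min l (s powr (- 1 / \<gamma>)) \<le> k * l"
            using k by (intro mult_left_mono) auto
          with t show ?thesis by linarith
        qed
        then have "ennreal (k * min l (s powr (- 1 / \<gamma>))) < ennreal t"
          using t k l mult_pos_pos[OF k l(1)] by (intro ennreal_lessI) linarith+
        then have "emeasure lebesgue {x \<in> \<Omega>. ereal s < \<bar>?u x\<bar>} < ennreal t"
          using dist[OF s] by (rule le_less_trans[rotated])
        then show ?thesis
          unfolding rearrangement_def add_0 using s by (intro Inf_lower) blast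
      qed
      have "rearrangement \<Omega> ?u t \<le> 0"
        by (rule ennreal_le_epsilon) (rule small)
      then show ?thesis by simp
    qed
    let ?r = "sobolev_exponent (real DIM('a)) p"
    have exponent: "(1 / ?r - 1 / p) * p = - \<theta>"
      using p by (simp add: sobolev_exponent_def \<theta>_def field_simps)
    \<comment> \<open>By the choice of \<gamma>, q = -(1 + \<theta>)/2, so t^q is integrable at
      0.\<close>
    define q where "q = - \<theta> - \<gamma> * p"
    have q: "q > - 1" using \<theta> \<gamma> by (simp add: q_def field_simps)
    have kl: "k * l > 0" using k l by simp
    have "(\<integral>\<^sup>+t\<in>{0<..}. epowr (ennreal (t powr (1 / ?r - 1 / p)) * rearrangement \<Omega> ?u t) p \<partial>lborel)
        \<le> (\<integral>\<^sup>+t. ennreal ((2 * k) powr (\<gamma> * p)) * (ennreal (t powr q) * indicator {0..k * l} t) \<partial>lborel)"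
    proof (rule nn_integral_mono)
      fix t :: real
      show "epowr (ennreal (t powr (1 / ?r - 1 / p)) * rearrangement \<Omega> ?u t) p * indicator {0<..} t
          \<le> ennreal ((2 * k) powr (\<gamma> * p)) * (ennreal (t powr q) * indicator {0..k * l} t)"
      proof (cases "0 < t")
        case True
        show ?thesis
        proof (cases "t \<le> k * l")
          case False
          then show ?thesis using r2[of t] epowr_ennreal[of 0 p] by simp
        next
          case le: True
          have "epowr (ennreal (t powr (1 / ?r - 1 / p)) * rearrangement \<Omega> ?u t) p
              \<le> epowr (ennreal (t powr (1 / ?r - 1 / p)) * ennreal ((2 * k / t) powr \<gamma>)) p"
            using p by (intro epowr_mono mult_left_mono r1 True) auto
          also have "\<dots> = ennreal ((t powr (1 / ?r - 1 / p) * (2 * k / t) powr \<gamma>) powr p)"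
            by (simp add: ennreal_mult[symmetric])
          also have "(t powr (1 / ?r - 1 / p) * (2 * k / t) powr \<gamma>) powr p = (2 * k) powr (\<gamma> * p) * t powr q"
          proof -
            have "(t powr d * (2 * k / t) powr \<gamma>) powr p = (2 * k) powr (\<gamma> * p) * t powr q" if "d * p = - \<theta>" for d
            proof -
              have "(t powr d * (2 * k / t) powr \<gamma>) powr p = t powr (d * p) * (2 * k / t) powr (\<gamma> * p)"
                by (simp only: powr_mult[of "t powr d"] powr_powr)
              also have "\<dots> = (2 * k) powr (\<gamma> * p) * (t powr (- \<theta>) / t powr (\<gamma> * p))"
                using that by (simp add: powr_divide)
              also have "t powr (- \<theta>) / t powr (\<gamma> * p) = t powr q"
                by (simp only: q_def powr_diff)
              finally show ?thesis .
            qed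
            from this[OF exponent] show ?thesis .
          qed
          also have "ennreal \<dots> = ennreal ((2 * k) powr (\<gamma> * p)) * ennreal (t powr q)"
            by (intro ennreal_mult) auto
          finally show ?thesis using True le by simp
        qed
      qed simp
    qed
    also have "\<dots> = ennreal ((2 * k) powr (\<gamma> * p)) * ennreal ((k * l) powr (q + 1) / (q + 1))"
      using q kl by (subst nn_integral_cmult) (auto simp: nn_integral_powr_from_0)
    also have "\<dots> < \<infinity>" by (simp add: ennreal_mult_less_top)
    finally show ?thesis using uM by (simp add: Lorentz_def)
  qed
  ultimately show ?thesis by blast
qed

theorem theorem7:
  fixes p :: real and \<Omega> :: "'a::euclidean_space set"
  assumes "1 < p" and "p < real DIM('a)"
    and "open \<Omega>" and "\<Omega> \<noteq> {}"
  shows "(\<exists>C::real. \<forall>u\<in>D0 p \<Omega>.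
            (\<lambda>x. ereal (u x)) \<in> E_space p \<Omega> \<and>
            E_norm p \<Omega> (\<lambda>x. ereal (u x)) \<le> C * D0_norm p \<Omega> u)
       \<and> (linear_function_space (E_space p \<Omega>) \<and>
          E_space p \<Omega> \<subset> Lorentz (sobolev_exponent (real DIM('a)) p) p \<Omega>)"
proof (intro conjI)
  show "\<exists>C::real. \<forall>u\<in>D0 p \<Omega>.
            (\<lambda>x. ereal (u x)) \<in> E_space p \<Omega> \<and>
            E_norm p \<Omega> (\<lambda>x. ereal (u x)) \<le> C * D0_norm p \<Omega> u"
    using D0_subset_E_space[OF assms(3,1)] by blast
  show "linear_function_space (E_space p \<Omega>)"
    by (rule linear_function_space_E_space[OF assms(1)])
  show "E_space p \<Omega> \<subset> Lorentz (sobolev_exponent (real DIM('a)) p) p \<Omega>"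
    using E_space_subset_Lorentz[OF assms(3,1,2)] exists_Lorentz_not_E_space[OF assms(3,4,1,2)]
    by blast
qed

end
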